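(* Let $K$ be a compact Hausdorff space and $Y$ a Banach space. Then $\mathcal{W}(C(K),Y)\cap\operatorname{RSE}(C(K),Y)$ is dense in $\mathcal{W}(C(K),Y)$.
   Context: Banach spaces are over $\mathbb{K}$, where $\mathbb{K}=\mathbb{R}$ or $\mathbb{C}$, and are nonzero (in particular $C(K)\neq\{0\}$). $C(K)$ is the space of continuous $\mathbb{K}$-valued functions on $K$ with the supremum norm. $\mathbb{T}=\{\theta\in\mathbb{K}\colon |\theta|=1\}$; $B_X$, $S_X$ are the closed unit ball and unit sphere of $X$; $\mathcal{L}(X,Y)$ is the space of bounded linear operators with the operator norm, and density is with respect to this norm. $\mathcal{W}(X,Y)\subseteq\mathcal{L}(X,Y)$ is the set of weakly compact operators. $T\in\operatorname{RSE}(X,Y)$ (range strongly exposing) means: there exists $x_0\in S_X$ such that whenever $(x_n)\subseteq B_X$ satisfies $\|Tx_n\|\to\|T\|$, there are a subsequence $(x_{\sigma(n)})$ and $\theta\in\mathbb{T}$ with $Tx_{\sigma(n)}\to\theta Tx_0$ in norm. *)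

theory Defs
  imports "HOL-Analysis.Analysis"
begin

(* The type classes of HOL-Analysis only know real normed spaces.  A normed space over
   the field 'f (real or complex) is a real normed space with a scalar multiplication by 'f
   that extends the real one and is compatible with the norm; the additive group, the norm,
   and hence completeness, are those of the underlying real space. *)

locale normed_space_over = vector_space scale
  for scale :: "'f::real_normed_field \<Rightarrow> 'a::real_normed_vector \<Rightarrow> 'a" +
  assumes scale_of_real: "scale (of_real r) x = r *\<^sub>R x"
    and norm_scale: "norm (scale c x) = norm c * norm x"

definition scaleC_bcontfun ::
  "complex \<Rightarrow> ('k::topological_space \<Rightarrow>\<^sub>C complex) \<Rightarrow> ('k \<Rightarrow>\<^sub>C complex)"
  where "scaleC_bcontfun c f = Bcontfun (\<lambda>x. c * apply_bcontfun f x)"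

lemma apply_scaleC_bcontfun [simp]:
  "apply_bcontfun (scaleC_bcontfun c f) x = c * apply_bcontfun f x"
proof -
  have "norm (c * apply_bcontfun f x) \<le> norm c * norm f" for x
    by (simp add: norm_mult mult_left_mono norm_bounded)
  then have "(\<lambda>x. c * apply_bcontfun f x) \<in> bcontfun"
    by (auto simp: bcontfun_def bounded_iff intro!: continuous_intros)
  then show ?thesis
    by (simp add: scaleC_bcontfun_def Bcontfun_inverse)
qed

(* The bounded 'f-linear operators.  Elements of the type of bounded linear functions are
   only real-linear; their norm is the operator norm, which does not depend on the scalars. *)

definition bounded_ops ::
  "('f::real_normed_field \<Rightarrow> 'a::real_normed_vector \<Rightarrow> 'a) \<Rightarrow> ('f \<Rightarrow> 'b::real_normed_vector \<Rightarrow> 'b)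
    \<Rightarrow> ('a \<Rightarrow>\<^sub>L 'b) set"
  where "bounded_ops sX sY = {T. Vector_Spaces.linear sX sY (blinfun_apply T)}"

definition weak_topology ::
  "('f::real_normed_field \<Rightarrow> 'a::real_normed_vector \<Rightarrow> 'a) \<Rightarrow> 'a topology"
  where "weak_topology s =
    topology_generated_by {blinfun_apply \<phi> -` U | \<phi> U. \<phi> \<in> bounded_ops s (*) \<and> open U}"

definition weakly_compact_ops ::
  "('f::real_normed_field \<Rightarrow> 'a::real_normed_vector \<Rightarrow> 'a) \<Rightarrow> ('f \<Rightarrow> 'b::real_normed_vector \<Rightarrow> 'b)
    \<Rightarrow> ('a \<Rightarrow>\<^sub>L 'b) set"
  where "weakly_compact_ops sX sY = {T \<in> bounded_ops sX sY.
    compactin (weak_topology sY) (weak_topology sY closure_of (blinfun_apply T ` cball 0 1))}"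

definition RSE ::
  "('f::real_normed_field \<Rightarrow> 'a::real_normed_vector \<Rightarrow> 'a) \<Rightarrow> ('f \<Rightarrow> 'b::real_normed_vector \<Rightarrow> 'b)
    \<Rightarrow> ('a \<Rightarrow>\<^sub>L 'b) set"
  where "RSE sX sY = {T \<in> bounded_ops sX sY.
    \<exists>x\<^sub>0. norm x\<^sub>0 = 1 \<and>
      (\<forall>x :: nat \<Rightarrow> 'a.
        (\<forall>n. norm (x n) \<le> 1) \<and> (\<lambda>n. norm (blinfun_apply T (x n))) \<longlonglongrightarrow> norm T \<longrightarrow>
        (\<exists>\<sigma> \<theta>. strict_mono \<sigma> \<and> norm \<theta> = 1 \<and>
          (\<lambda>n. blinfun_apply T (x (\<sigma> n))) \<longlonglongrightarrow> sY \<theta> (blinfun_apply T x\<^sub>0)))}"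

lemma normed_space_over_scaleR:
  "normed_space_over ((*\<^sub>R) :: real \<Rightarrow> 'a::real_normed_vector \<Rightarrow> 'a)"
  by unfold_locales (auto simp: algebra_simps)

lemma normed_space_over_scaleC_bcontfun:
  "normed_space_over (scaleC_bcontfun :: complex \<Rightarrow> ('k::topological_space \<Rightarrow>\<^sub>C complex) \<Rightarrow> _)"
proof unfold_locales
  fix a b c :: complex and f g :: "'k \<Rightarrow>\<^sub>C complex" and r :: real
  show "scaleC_bcontfun a (f + g) = scaleC_bcontfun a f + scaleC_bcontfun a g"
    by (rule bcontfun_eqI) (simp add: algebra_simps)
  show "scaleC_bcontfun (a + b) f = scaleC_bcontfun a f + scaleC_bcontfun b f"
    by (rule bcontfun_eqI) (simp add: algebra_simps)
  show "scaleC_bcontfun a (scaleC_bcontfun b f) = scaleC_bcontfun (a * b) f"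
    by (rule bcontfun_eqI) (simp add: algebra_simps)
  show "scaleC_bcontfun 1 f = f"
    by (rule bcontfun_eqI) simp
  show "scaleC_bcontfun (of_real r) f = r *\<^sub>R f"
    by (rule bcontfun_eqI) (simp add: scaleR_conv_of_real)
  have le: "norm (scaleC_bcontfun c f) \<le> norm c * norm f" for c and f :: "'k \<Rightarrow>\<^sub>C complex"
    by (rule norm_bound) (simp add: norm_mult mult_left_mono norm_bounded)
  show "norm (scaleC_bcontfun c f) = norm c * norm f"
  proof (cases "c = 0")
    case True
    with le[of c f] show ?thesis by simp
  next
    case False
    have "f = scaleC_bcontfun (inverse c) (scaleC_bcontfun c f)"
      using False by (intro bcontfun_eqI) simp
    with le[of "inverse c" "scaleC_bcontfun c f"]
    have "norm f \<le> norm (scaleC_bcontfun c f) / norm c"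
      by (simp add: norm_inverse divide_inverse mult.commute)
    with False have "norm c * norm f \<le> norm (scaleC_bcontfun c f)"
      by (simp add: field_simps)
    with le[of c f] show ?thesis by linarith
  qed
qed

end

theory Submission
  imports Defs
begin

text \<open>
  Why the theorem holds. A weakly compact operator \<open>T\<close> on \<open>C(K)\<close> is integration against a countably
  additive vector measure \<open>m\<close>, so it has a control measure \<open>\<nu>\<close> and acts on bounded Borel functions.
  Suppose that this extended operator has, up to a scalar of modulus one, a single maximizer \<open>\<phi>\<close> in
  the unit ball, and that every maximizing sequence converges to it in \<open>L\<^sup>2(\<nu>)\<close> after multiplication by
  scalars of modulus one. In general \<open>\<phi>\<close> is not continuous, but by Egorov's theorem it is continuous
  on a set \<open>F\<close> whose complement carries little of \<open>m\<close>. Take a continuous \<open>x\<close> with \<open>\<parallel>x\<parallel> = 1\<close> and \<open>x = \<phi>\<close>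
  on \<open>F\<close>, and with \<open>x(t\<^sub>0) = 1\<close> at some point \<open>t\<^sub>0\<close>; this is possible because almost maximizers of \<open>T\<close>
  can be chosen with the value one at \<open>t\<^sub>0\<close> (\<open>almost_norming_with_value_one\<close>). The map \<open>P\<close> which sends \<open>f\<close> to \<open>f\<close> on \<open>F\<close> and to \<open>f(t\<^sub>0) \<phi>\<close> off
  \<open>F\<close> is a contraction with \<open>P x = \<phi>\<close>. Hence \<open>S = T P\<close> satisfies \<open>\<parallel>S\<parallel> \<le> \<parallel>T\<parallel> = \<parallel>T \<phi>\<parallel> = \<parallel>S x\<parallel>\<close>, it is
  close to \<open>T\<close>, and \<open>P\<close> turns a maximizing sequence for \<open>S\<close> into one for \<open>T\<close>, so its images
  accumulate only at multiples of \<open>T \<phi> = S x\<close>. This is \<open>attaining_perturbation\<close>.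

  An essentially unique maximizer is produced by a small rank one perturbation
  (\<open>rank_one_perturbation\<close>). The unit ball is bounded in the Hilbert space \<open>L\<^sup>2(\<nu>)\<close>, where a
  smooth variational principle gives a small linear functional \<open>\<rho>\<close> for which all maximizing
  sequences of \<open>f \<mapsto> \<parallel>T f\<parallel> + \<rho>(f)\<close> are Cauchy (\<open>strongly_exposing_perturbation\<close>); adding \<open>\<psi> \<otimes> e\<close>
  to \<open>T\<close>, with \<open>\<psi>\<close> the scalar functional of real part \<open>\<rho>\<close> and \<open>e\<close> the direction of the limit of
  \<open>T f\<^sub>n\<close>, turns that sum into the norm of an operator. Both perturbations stay weakly compact because
  the image of the ball remains in the closure of the old image plus a compact piece of a line
  (\<open>weakly_compact_near_rank_one\<close>).

  No measure is constructed. The control measure is a positive linear functional on \<open>C(K)\<close>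
  (\<open>control_functional\<close>), obtained from the single consequence of weak compactness that
  \<open>T k\<^sub>n \<longlonglongrightarrow> 0\<close> whenever \<open>\<Sum> \<bar>k\<^sub>n\<bar> \<le> 1\<close> (\<open>weakly_compact_imp_exhaustive\<close>). The set \<open>F\<close> is a
  decreasing sequence of continuous cut-off functions, \<open>\<phi>\<close> a sequence of continuous functions that is
  Cauchy for \<open>\<nu>\<close> (\<open>Egorov_localization\<close>), and \<open>S\<close> a limit of operators \<open>T P\<^sub>n\<close>.

  Real and complex scalars are treated at once: the scalar field is a normed field with a Euclidean
  structure and a conjugation, and all convexity arguments use the underlying real spaces.
\<close>

section \<open>Dominated extension of functionals\<close>

text \<open>The inequality for positive scalars suffices: applied to \<open>c\<close> and \<open>1/c\<close> it gives equality, and with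
  \<open>c = 2\<close> it gives \<open>p 0 = 0\<close>.\<close>

definition sublinear :: "('a::real_vector \<Rightarrow> real) \<Rightarrow> bool" where
  "sublinear p \<longleftrightarrow> (\<forall>x y. p (x + y) \<le> p x + p y) \<and> (\<forall>c>0. \<forall>x. p (c *\<^sub>R x) \<le> c * p x)"

lemma sublinear_add: "sublinear p \<Longrightarrow> p (x + y) \<le> p x + p y"
  by (simp add: sublinear_def)

lemma sublinear_scale:
  assumes "sublinear p" "c > 0" shows "p (c *\<^sub>R x) = c * p x"
proof (rule antisym)
  show "p (c *\<^sub>R x) \<le> c * p x"
    using assms by (simp add: sublinear_def)
  have "p (inverse c *\<^sub>R (c *\<^sub>R x)) \<le> inverse c * p (c *\<^sub>R x)"
    using assms unfolding sublinear_def by (metis positive_imp_inverse_positive)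
  then show "c * p x \<le> p (c *\<^sub>R x)"
    using assms(2) by (simp add: field_simps)
qed

lemma sublinear_zero: "sublinear p \<Longrightarrow> p 0 = 0"
  using sublinear_scale[of p 2 0] by simp

lemma sublinear_minus: "sublinear p \<Longrightarrow> - p (- x) \<le> p x"
  using sublinear_add[of p x "- x"] sublinear_zero[of p] by simp

text \<open>The functional \<open>q y = inf\<^sub>t (p (y + t x) - t p x)\<close>, the infimum over \<open>t \<ge> 0\<close>, is the largest sublinear
  minorant of \<open>p\<close> with value at most \<open>- p x\<close> at \<open>- x\<close>. A minimal sublinear functional must therefore be odd.\<close>

lemma sublinear_tilt:
  assumes p: "sublinear p"
  obtains q where "sublinear q" "\<And>y. q y \<le> p y" "q (- x) \<le> - p x"
proof
  define S where "S y = (\<lambda>t. p (y + t *\<^sub>R x) - t * p x) ` {0..}" for y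
  define q where "q y = Inf (S y)" for y
  have tp: "t * p x = p (t *\<^sub>R x)" if "t \<ge> 0" for t
    using sublinear_scale[OF p, of t x] sublinear_zero[OF p] that by (cases "t = 0") auto
  have lower: "- p (- y) \<le> s" if sS: "s \<in> S y" for s y
  proof -
    obtain t where t: "t \<ge> 0" "s = p (y + t *\<^sub>R x) - t * p x"
      using sS by (auto simp: S_def)
    have "p (t *\<^sub>R x) \<le> p (y + t *\<^sub>R x) + p (- y)"
      using sublinear_add[OF p, of "y + t *\<^sub>R x" "- y"] by simp
    then show ?thesis using t tp by simp
  qed
  have bdd: "bdd_below (S y)" for y
    using lower by (auto simp: bdd_below_def)
  have ne: "S y \<noteq> {}" for y by (auto simp: S_def)
  have qle: "q y \<le> p (y + t *\<^sub>R x) - t * p x" if "t \<ge> 0" for y t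
    unfolding q_def by (rule cInf_lower[OF _ bdd]) (use that in \<open>auto simp: S_def\<close>)
  have qadd: "q (y + z) \<le> q y + q z" for y z
  proof -
    have "q (y + z) - b \<le> a" if a: "a \<in> S y" and b: "b \<in> S z" for a b
    proof -
      obtain s where s: "s \<ge> 0" "a = p (y + s *\<^sub>R x) - s * p x"
        using a by (auto simp: S_def)
      obtain t where t: "t \<ge> 0" "b = p (z + t *\<^sub>R x) - t * p x"
        using b by (auto simp: S_def)
      have "p ((y + z) + (s + t) *\<^sub>R x) \<le> p (y + s *\<^sub>R x) + p (z + t *\<^sub>R x)"
        using sublinear_add[OF p, of "y + s *\<^sub>R x" "z + t *\<^sub>R x"]
        by (simp add: algebra_simps)
      with qle[of "s + t" "y + z"] s t show ?thesis by (simp add: algebra_simps)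
    qed
    then have "q (y + z) - b \<le> q y" if "b \<in> S z" for b
      unfolding q_def[of y] using that by (intro cInf_greatest[OF ne]) auto
    then have "q (y + z) - q y \<le> q z"
      unfolding q_def[of z] by (intro cInf_greatest[OF ne]) (auto simp: algebra_simps)
    then show ?thesis by simp
  qed
  have qscale: "q (c *\<^sub>R y) \<le> c * q y" if "c > 0" for c y
  proof -
    have "q (c *\<^sub>R y) / c \<le> a" if a: "a \<in> S y" for a
    proof -
      obtain s where s: "s \<ge> 0" "a = p (y + s *\<^sub>R x) - s * p x"
        using a by (auto simp: S_def)
      have "q (c *\<^sub>R y) \<le> p (c *\<^sub>R y + (c * s) *\<^sub>R x) - (c * s) * p x"
        using s \<open>c > 0\<close> by (intro qle) auto
      also have "c *\<^sub>R y + (c * s) *\<^sub>R x = c *\<^sub>R (y + s *\<^sub>R x)" by (simp add: algebra_simps)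
      also have "p \<dots> = c * p (y + s *\<^sub>R x)" by (rule sublinear_scale[OF p \<open>c > 0\<close>])
      finally have "q (c *\<^sub>R y) \<le> c * a" using s(2) by (simp add: right_diff_distrib mult.assoc)
      then show ?thesis using \<open>c > 0\<close> by (simp add: pos_divide_le_eq mult.commute)
    qed
    then have "q (c *\<^sub>R y) / c \<le> q y"
      unfolding q_def[of y] by (intro cInf_greatest[OF ne])
    then show ?thesis using \<open>c > 0\<close> by (simp add: field_simps)
  qed
  show "sublinear q" using qadd qscale by (simp add: sublinear_def)
  show "q y \<le> p y" for y using qle[of 0 y] by simp
  show "q (- x) \<le> - p x" using qle[of 1 "- x"] sublinear_zero[OF p] by simp
qed

text \<open>By Zorn's lemma there is a minimal sublinear functional below \<open>p\<close>, and minimal ones are linear.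
  Starting from the tilt of \<open>p\<close> along \<open>x\<close> forces the value at \<open>x\<close> to be \<open>p x\<close>.\<close>

theorem Hahn_Banach_sublinear:
  fixes p :: "'a::real_vector \<Rightarrow> real"
  assumes p: "sublinear p"
  obtains \<phi> where "linear \<phi>" "\<And>y. \<phi> y \<le> p y" "\<phi> x = p x"
proof -
  obtain p' where p': "sublinear p'" "\<And>y. p' y \<le> p y" "p' (- x) \<le> - p x"
    using sublinear_tilt[OF p] by metis
  define A where "A = {q. sublinear q \<and> q \<le> p'}"
  have "\<exists>m\<in>A. \<forall>a\<in>A. a \<le> m \<longrightarrow> a = m"
  proof (rule predicate_Zorn[where P = "\<lambda>a b. b \<le> a"])
    show "partial_order_on A (relation_of (\<lambda>a b. b \<le> a) A)"
      by (rule partial_order_on_relation_ofI) auto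
  next
    fix C assume C: "C \<in> Chains (relation_of (\<lambda>a b. b \<le> a) A)"
    show "\<exists>u\<in>A. \<forall>a\<in>C. u \<le> a"
    proof (cases "C = {}")
      case True
      then show ?thesis using p' by (auto simp: A_def)
    next
      case False
      have CA: "q \<in> A" and tot: "q \<le> r \<or> r \<le> q" if "q \<in> C" "r \<in> C" for q r
        using C that by (auto simp: Chains_def relation_of_def)
      have sub: "sublinear q" and qle: "q y \<le> p' y" if "q \<in> C" for q y
        using CA[OF that that] by (auto simp: A_def le_fun_def)
      define u where "u y = Inf ((\<lambda>q. q y) ` C)" for y
      have bdd: "bdd_below ((\<lambda>q. q y) ` C)" for y
      proof (rule bdd_belowI2)
        fix q assume q: "q \<in> C"
        show "- p' (- y) \<le> q y"
          using sublinear_minus[OF sub[OF q], of y] qle[OF q, of "- y"] by linarith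
      qed
      have ule: "u y \<le> q y" if "q \<in> C" for q y
        unfolding u_def using that by (intro cInf_lower bdd) auto
      have ugr: "c \<le> u y" if "\<And>q. q \<in> C \<Longrightarrow> c \<le> q y" for c y
        unfolding u_def using False that by (intro cInf_greatest) auto
      have "u (y + z) \<le> u y + u z" for y z
      proof -
        have *: "u (y + z) \<le> q y + r z" if qr: "q \<in> C" "r \<in> C" for q r
        proof (cases "q \<le> r")
          case True
          have "u (y + z) \<le> q (y + z)" by (rule ule[OF qr(1)])
          also have "\<dots> \<le> q y + q z" by (rule sublinear_add[OF sub[OF qr(1)]])
          also have "\<dots> \<le> q y + r z" using True by (simp add: le_fun_def)
          finally show ?thesis .
        next
          case False
          then have "r \<le> q" using tot[OF qr] by simp
          have "u (y + z) \<le> r (y + z)" by (rule ule[OF qr(2)])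
          also have "\<dots> \<le> r y + r z" by (rule sublinear_add[OF sub[OF qr(2)]])
          also have "\<dots> \<le> q y + r z" using \<open>r \<le> q\<close> by (simp add: le_fun_def)
          finally show ?thesis .
        qed
        have "u (y + z) - r z \<le> u y" if "r \<in> C" for r
          using *[OF _ that] by (intro ugr) (simp add: algebra_simps)
        then have "u (y + z) - u y \<le> u z"
          by (intro ugr) (simp add: algebra_simps)
        then show ?thesis by simp
      qed
      moreover have "u (c *\<^sub>R y) \<le> c * u y" if "c > 0" for c y
      proof -
        have "u (c *\<^sub>R y) / c \<le> u y"
        proof (rule ugr)
          fix q assume q: "q \<in> C"
          show "u (c *\<^sub>R y) / c \<le> q y"
            using ule[OF q, of "c *\<^sub>R y"] sublinear_scale[OF sub[OF q] that, of y] that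
            by (simp add: field_simps)
        qed
        then show ?thesis using that by (simp add: field_simps)
      qed
      ultimately have "sublinear u" by (simp add: sublinear_def)
      moreover have "u \<le> p'"
        using False ule qle by (metis all_not_in_conv le_funI order_trans)
      ultimately have "u \<in> A" by (simp add: A_def)
      then show ?thesis using ule by (intro bexI[of _ u]) (auto simp: le_fun_def)
    qed
  qed
  then obtain m where m: "sublinear m" "m \<le> p'"
    and min: "\<And>a. sublinear a \<Longrightarrow> a \<le> p' \<Longrightarrow> a \<le> m \<Longrightarrow> a = m"
    by (auto simp: A_def)
  have odd: "m (- z) = - m z" for z
  proof -
    obtain q where q: "sublinear q" "\<And>y. q y \<le> m y" "q (- z) \<le> - m z"
      using sublinear_tilt[OF m(1)] by metis
    have "q \<le> m" using q(2) by (simp add: le_fun_def)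
    then have "q = m" using min[OF q(1)] m(2) by simp
    with q(3) sublinear_minus[OF m(1), of "- z"] show ?thesis by simp
  qed
  have add: "m (y + z) = m y + m z" for y z
  proof (rule antisym[OF sublinear_add[OF m(1)]])
    show "m y + m z \<le> m (y + z)"
      using sublinear_add[OF m(1), of "- y" "- z"] odd[of "y + z"] odd[of y] odd[of z]
      by (simp add: algebra_simps)
  qed
  have "m (c *\<^sub>R y) = c *\<^sub>R m y" for c y
  proof (cases "c > 0")
    case True
    then show ?thesis using sublinear_scale[OF m(1)] by simp
  next
    case False
    show ?thesis
    proof (cases "c = 0")
      case True then show ?thesis using sublinear_zero[OF m(1)] by simp
    next
      case nz: False
      with False have "- c > 0" by simp
      from sublinear_scale[OF m(1) this, of y] odd[of "c *\<^sub>R y"] show ?thesis by simp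
    qed
  qed
  then have lin: "linear m" using add by (intro linearI)
  have le: "m y \<le> p y" for y using m(2) p'(2)[of y] by (meson le_funD order_trans)
  have "m (- x) \<le> - p x" using m(2) p'(3) by (meson le_funD order_trans)
  then have "m x = p x" using odd[of x] le[of x] by simp
  with lin le show thesis using that by blast
qed

lemma bounded_functional_below:
  fixes p :: "'a::real_normed_vector \<Rightarrow> real"
  assumes p: "sublinear p" and le: "\<And>y. p y \<le> norm y"
  obtains \<phi> :: "'a \<Rightarrow>\<^sub>L real"
  where "norm \<phi> \<le> 1" "\<And>y. blinfun_apply \<phi> y \<le> p y" "blinfun_apply \<phi> x = p x"
proof -
  obtain f where f: "linear f" "\<And>y. f y \<le> p y" "f x = p x"
    using Hahn_Banach_sublinear[OF p] by metis
  have abs: "\<bar>f y\<bar> \<le> norm y" for y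
    using f(2)[of y] f(2)[of "- y"] le[of y] le[of "- y"] linear_neg[OF f(1), of y] by simp
  have "bounded_linear f"
    using f(1) abs by (auto simp: linear_conv_bounded_linear[symmetric] bounded_linear_def
        bounded_linear_axioms_def intro!: exI[of _ 1])
  then have "blinfun_apply (Blinfun f) = f" by (rule bounded_linear_Blinfun_apply)
  moreover have "norm (Blinfun f) \<le> 1"
    by (rule norm_blinfun_bound) (use abs calculation in auto)
  ultimately show thesis using f that[of "Blinfun f"] by simp
qed

lemma norming_functional:
  fixes x :: "'a::real_normed_vector"
  obtains \<phi> :: "'a \<Rightarrow>\<^sub>L real" where "norm \<phi> \<le> 1" "blinfun_apply \<phi> x = norm x"
proof -
  have "sublinear (norm :: 'a \<Rightarrow> real)"
    by (simp add: sublinear_def norm_triangle_ineq)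
  then show thesis
    using bounded_functional_below[of norm x] that by (metis order_refl)
qed

section \<open>Rosenthal's disjointification lemma\<close>

text \<open>Split the indices into infinitely many infinite classes. Either one class works, or in each class
  there is an index whose row has mass more than \<open>\<epsilon>\<close> inside its own class. Selecting one such index per
  class gives a submatrix whose rows have lost \<open>\<epsilon>\<close>, and this can be repeated at most \<open>k\<close> times.\<close>

lemma Rosenthal_off_diagonal:
  fixes a :: "nat \<Rightarrow> nat \<Rightarrow> real"
  assumes "\<And>i j. a i j \<ge> 0" "\<epsilon> > 0"
    and "\<And>i F. finite F \<Longrightarrow> (\<Sum>j\<in>F. a i j) \<le> real k * \<epsilon>"
  shows "\<exists>r :: nat \<Rightarrow> nat. inj r \<and> (\<forall>i F. finite F \<longrightarrow> i \<notin> F \<longrightarrow> (\<Sum>j\<in>F. a (r i) (r j)) \<le> \<epsilon>)"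
  using assms
proof (induction k arbitrary: a)
  case 0
  have z: "(\<Sum>j\<in>F. a (id i) (id j)) \<le> \<epsilon>" if "finite F" for i F
    using "0.prems"(2) "0.prems"(3)[OF that, of i] by simp
  show ?case by (rule exI[where x = "id :: nat \<Rightarrow> nat"], intro conjI allI impI inj_on_id z)
next
  case (Suc k)
  \<comment> \<open>The classes are the rows of the pairing function.\<close>
  define e where "e p n = prod_encode (p, n)" for p n :: nat
  have e_inj: "e p n = e q m \<longleftrightarrow> p = q \<and> n = m" for p q n m
    by (simp add: e_def)
  show ?case
  proof (cases "\<exists>p. \<forall>i F. finite F \<longrightarrow> i \<notin> F \<longrightarrow> (\<Sum>j\<in>F. a (e p i) (e p j)) \<le> \<epsilon>")
    case True
    then obtain p where "\<forall>i F. finite F \<longrightarrow> i \<notin> F \<longrightarrow> (\<Sum>j\<in>F. a (e p i) (e p j)) \<le> \<epsilon>" ..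
    moreover have "inj (e p)" by (simp add: inj_def e_inj)
    ultimately show ?thesis by blast
  next
    case False
    then have "\<forall>p. \<exists>i F. finite F \<and> i \<notin> F \<and> (\<Sum>j\<in>F. a (e p i) (e p j)) > \<epsilon>"
      by (auto simp: not_le)
    then obtain i F where iF: "\<And>p. finite (F p)" "\<And>p. i p \<notin> F p"
      "\<And>p. (\<Sum>j\<in>F p. a (e p (i p)) (e p j)) > \<epsilon>"
      by metis
    define r where "r p = e p (i p)" for p
    have r_inj: "inj r" by (simp add: inj_def r_def e_inj)
    have "(\<Sum>q\<in>G. a (r p) (r q)) \<le> real k * \<epsilon>" if G: "finite G" for p G
    proof -
      have "(\<Sum>q\<in>G. a (r p) (r q)) = (\<Sum>j\<in>r ` G. a (r p) j)"
        using r_inj by (subst sum.reindex) (auto simp: inj_on_def)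
      moreover have "(\<Sum>j\<in>F p. a (r p) (e p j)) = (\<Sum>j\<in>e p ` F p. a (r p) j)"
        by (subst sum.reindex) (auto simp: inj_on_def e_inj)
      moreover have "r ` G \<inter> e p ` F p = {}"
        using iF(2) by (auto simp: r_def e_inj)
      ultimately have "(\<Sum>q\<in>G. a (r p) (r q)) + (\<Sum>j\<in>F p. a (r p) (e p j))
          = (\<Sum>j\<in>r ` G \<union> e p ` F p. a (r p) j)"
        using G iF(1) by (subst sum.union_disjoint) auto
      also have "\<dots> \<le> real (Suc k) * \<epsilon>"
        using G iF(1) by (intro Suc.prems(3)) auto
      finally show ?thesis
        using iF(3)[of p] by (simp add: r_def algebra_simps)
    qed
    then obtain r' :: "nat \<Rightarrow> nat" where r': "inj r'"
      "\<forall>i F. finite F \<longrightarrow> i \<notin> F \<longrightarrow> (\<Sum>j\<in>F. a (r (r' i)) (r (r' j))) \<le> \<epsilon>"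
      using Suc.IH[of "\<lambda>p q. a (r p) (r q)"] Suc.prems(1,2) by auto
    moreover have "inj (r \<circ> r')" using r_inj r'(1) by (rule inj_compose)
    ultimately show ?thesis by (intro exI[of _ "r \<circ> r'"]) (simp add: o_def)
  qed
qed

section \<open>Strongly exposing perturbations in a semi-inner product space\<close>

text \<open>The example in view is \<open>C(K)\<close> with the \<open>L\<^sup>2\<close> inner product of a positive functional, which is in
  general neither definite nor complete.\<close>

locale semi_inner =
  fixes ip :: "'a::real_vector \<Rightarrow> 'a \<Rightarrow> real"
  assumes ip_sym: "ip x y = ip y x"
    and ip_add: "ip (x + y) z = ip x z + ip y z"
    and ip_scale: "ip (c *\<^sub>R x) z = c * ip x z"
    and ip_pos: "ip x x \<ge> 0"
begin

definition "nrm x = sqrt (ip x x)"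

lemma ip_linear: "linear (\<lambda>x. ip x z)"
  by (intro linearI) (simp_all add: ip_add ip_scale)

lemma ip_diff: "ip (x - y) z = ip x z - ip y z"
  using linear_diff[OF ip_linear] .

lemma ip_right: "ip z (x + y) = ip z x + ip z y" "ip z (x - y) = ip z x - ip z y"
  "ip z (c *\<^sub>R x) = c * ip z x"
  by (simp_all add: ip_sym[of z] ip_add ip_diff ip_scale)

lemma ip_zero: "ip 0 z = 0"
  using ip_scale[of 0 0 z] by simp

lemmas ip_simps = ip_add ip_diff ip_scale ip_right

lemma nrm_sq: "nrm x ^ 2 = ip x x"
  by (simp add: nrm_def ip_pos)

lemma nrm_zero [simp]: "nrm 0 = 0"
  by (simp add: nrm_def ip_zero)

lemma nrm_nonneg: "nrm x \<ge> 0"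
  by (simp add: nrm_def ip_pos)

lemma Cauchy_Schwarz: "\<bar>ip x y\<bar> \<le> nrm x * nrm y"
proof -
  have "(2 * ip x y)\<^sup>2 - 4 * ip x x * ip y y \<le> 0"
  proof (rule ccontr)
    assume "\<not> ?thesis"
    then have d: "ip x x * ip y y < (ip x y)\<^sup>2" by (simp add: power2_eq_square)
    have q: "0 \<le> ip x x + 2 * t * ip x y + t^2 * ip y y" for t
      using ip_pos[of "x + t *\<^sub>R y"] ip_sym[of x y]
      by (simp add: ip_simps power2_eq_square algebra_simps)
    show False
    proof (cases "ip y y = 0")
      case True
      then have "ip x y \<noteq> 0" using d by auto
      then show False
        using q[of "- (ip x x + 1) / (2 * ip x y)"] True by (simp add: field_simps)
    next
      case False
      then have pos: "ip y y > 0" using ip_pos[of y] by simp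
      have "0 \<le> ip x x - (ip x y)^2 / ip y y"
        using q[of "- ip x y / ip y y"] pos
        by (simp add: power2_eq_square field_simps)
      then show False using d pos by (simp add: field_simps)
    qed
  qed
  then have "(ip x y)\<^sup>2 \<le> (nrm x * nrm y)\<^sup>2"
    by (simp add: power_mult_distrib nrm_sq)
  then have "\<bar>ip x y\<bar> \<le> \<bar>nrm x * nrm y\<bar>" by (rule abs_le_square_iff[THEN iffD2])
  then show ?thesis using nrm_nonneg by simp
qed

lemma nrm_triangle: "nrm (x + y) \<le> nrm x + nrm y"
proof (rule power2_le_imp_le)
  have "nrm (x + y) ^ 2 = nrm x ^ 2 + 2 * ip x y + nrm y ^ 2"
    using ip_sym[of x y] by (simp add: nrm_sq ip_simps)
  also have "\<dots> \<le> (nrm x + nrm y)^2"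
    using Cauchy_Schwarz[of x y] by (simp add: power2_sum)
  finally show "nrm (x + y) ^ 2 \<le> (nrm x + nrm y)^2" .
qed (simp add: nrm_nonneg)

lemma nrm_scale: "nrm (c *\<^sub>R x) = \<bar>c\<bar> * nrm x"
  by (simp add: nrm_def ip_simps real_sqrt_mult flip: mult.assoc power2_eq_square)

text \<open>Let \<open>g b\<close> be the supremum of \<open>F f + \<langle>f, b\<rangle>\<close> over \<open>B\<close>; it is convex and Lipschitz. At an almost
  maximum \<open>b\<close> of \<open>g - \<kappa> \<parallel>\<cdot> - a\<parallel>\<^sup>2\<close> the parallelogram law bounds the second difference
  \<open>g (b + h) + g (b - h) - 2 g b\<close> by about \<open>2 \<kappa> \<parallel>h\<parallel>\<^sup>2\<close>, whereas two almost maximizers \<open>f1\<close>, \<open>f2\<close> at \<open>b\<close>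
  make it at least about \<open>\<langle>f1 - f2, h\<rangle>\<close>. So \<open>f1\<close> and \<open>f2\<close> are close. A large \<open>\<kappa>\<close> keeps \<open>b\<close> near \<open>a\<close>.\<close>

lemma small_slice:
  assumes B: "B \<noteq> {}" "\<And>f. f \<in> B \<Longrightarrow> nrm f \<le> 1" and F: "\<And>f. f \<in> B \<Longrightarrow> F f \<le> C"
    and pos: "\<tau> > 0" "\<eta> > 0"
  shows "\<exists>b \<delta>. \<delta> > 0 \<and> nrm (b - a) \<le> \<tau> \<and>
    (\<forall>f1\<in>B. \<forall>f2\<in>B. (\<forall>h\<in>B. F h + ip h b \<le> F f1 + ip f1 b + \<delta>) \<longrightarrow>
       (\<forall>h\<in>B. F h + ip h b \<le> F f2 + ip f2 b + \<delta>) \<longrightarrow> nrm (f1 - f2) \<le> \<eta>)"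
proof -
  define g where "g c = (SUP f\<in>B. F f + ip f c)" for c
  have ub: "F f + ip f c \<le> C + nrm c" if "f \<in> B" for f c
    using F[OF that] Cauchy_Schwarz[of f c] B(2)[OF that] nrm_nonneg[of c]
      mult_right_mono[of "nrm f" 1 "nrm c"] by simp
  have bdd: "bdd_above ((\<lambda>f. F f + ip f c) ` B)" for c
    using ub by (intro bdd_aboveI2) auto
  have g_ge: "F f + ip f c \<le> g c" if "f \<in> B" for f c
    unfolding g_def using that bdd by (rule cSUP_upper)
  have g_le: "g c \<le> u" if "\<And>f. f \<in> B \<Longrightarrow> F f + ip f c \<le> u" for c u
    unfolding g_def using B(1) that by (rule cSUP_least)
  have lip: "g c \<le> g a + nrm (c - a)" for c
  proof (rule g_le)
    fix f assume f: "f \<in> B"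
    have "ip f c - ip f a \<le> nrm (c - a)"
      using Cauchy_Schwarz[of f "c - a"] B(2)[OF f] nrm_nonneg[of "c - a"]
        mult_right_mono[of "nrm f" 1 "nrm (c - a)"] by (simp add: ip_simps)
    then show "F f + ip f c \<le> g a + nrm (c - a)" using g_ge[OF f, of a] by linarith
  qed
  \<comment> \<open>If \<open>b\<close> were farther than \<open>\<tau>\<close> from \<open>a\<close>, the penalty would exceed the Lipschitz gain plus \<open>\<delta>\<close>.\<close>
  define \<kappa> where "\<kappa> = 2 / \<tau> + 1"
  have \<kappa>: "\<kappa> > 0" "\<kappa> * \<tau> \<ge> 2" using pos by (auto simp: \<kappa>_def field_simps)
  define \<delta> where "\<delta> = min \<tau> (\<eta>^2 / (32 * \<kappa>))"
  have \<delta>: "\<delta> > 0" "\<delta> \<le> \<tau>" "32 * \<kappa> * \<delta> \<le> \<eta>^2"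
    using pos \<kappa> by (auto simp: \<delta>_def field_simps min_def)
  define G where "G c = g c - \<kappa> * nrm (c - a) ^ 2" for c
  have G_ub: "G c \<le> g a + 1 / \<kappa>" for c
  proof -
    have "nrm (c - a) - \<kappa> * nrm (c - a)^2 \<le> 1 / \<kappa>"
    proof -
      have "0 \<le> (\<kappa> * nrm (c - a) - 1)^2 + \<kappa> * nrm (c - a)" using \<kappa> nrm_nonneg by simp
      then show ?thesis using \<kappa> by (simp add: field_simps power2_eq_square)
    qed
    then show ?thesis using lip[of c] by (simp add: G_def)
  qed
  have Gbdd: "bdd_above (range G)" using G_ub by (intro bdd_aboveI2) auto
  obtain b where b: "(SUP c. G c) - \<delta> < G b"
    using less_cSUP_iff[OF _ Gbdd, of "(SUP c. G c) - \<delta>"] \<delta>(1) by auto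
  have near: "G c \<le> G b + \<delta>" for c
    using cSUP_upper[OF UNIV_I Gbdd, of c] b by linarith
  have "nrm (b - a) \<le> \<tau>"
  proof (rule ccontr)
    assume "\<not> ?thesis"
    then have r: "nrm (b - a) > \<tau>" by simp
    have "G a = g a" by (simp add: G_def)
    then have "\<kappa> * nrm (b - a)^2 \<le> nrm (b - a) + \<delta>"
      using near[of a] lip[of b] by (simp add: G_def)
    also have "\<dots> < 2 * nrm (b - a)" using r \<delta>(2) by linarith
    also have "\<dots> \<le> \<kappa> * \<tau> * nrm (b - a)" using \<kappa> nrm_nonneg by (intro mult_right_mono) auto
    also have "\<dots> \<le> \<kappa> * nrm (b - a)^2"
      using r \<kappa> pos nrm_nonneg[of "b - a"] by (simp add: power2_eq_square mult_right_mono)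
    finally show False by simp
  qed
  moreover have "nrm (f1 - f2) \<le> \<eta>"
    if f: "f1 \<in> B" "f2 \<in> B" and m1: "\<forall>h\<in>B. F h + ip h b \<le> F f1 + ip f1 b + \<delta>"
      and m2: "\<forall>h\<in>B. F h + ip h b \<le> F f2 + ip f2 b + \<delta>" for f1 f2
  proof -
    have gb: "g b \<le> F f1 + ip f1 b + \<delta>" "g b \<le> F f2 + ip f2 b + \<delta>"
      using m1 m2 by (auto intro!: g_le)
    \<comment> \<open>The multiple of \<open>f1 - f2\<close> that optimizes the linear against the quadratic term.\<close>
    define h where "h = (1 / (4 * \<kappa>)) *\<^sub>R (f1 - f2)"
    have par: "nrm (b + h - a)^2 + nrm (b - h - a)^2 = 2 * nrm (b - a)^2 + 2 * nrm h ^2"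
      by (simp add: nrm_sq ip_simps)
    have "g (b + h) + g (b - h) = G (b + h) + G (b - h)
        + \<kappa> * (nrm (b + h - a)^2 + nrm (b - h - a)^2)"
      by (simp add: G_def algebra_simps)
    also have "\<dots> \<le> 2 * (G b + \<delta>) + \<kappa> * (2 * nrm (b - a)^2 + 2 * nrm h ^2)"
      using near[of "b + h"] near[of "b - h"] by (simp add: par)
    also have "\<dots> = 2 * g b + 2 * \<delta> + 2 * \<kappa> * nrm h ^2"
      by (simp add: G_def algebra_simps)
    finally have 1: "g (b + h) + g (b - h) \<le> 2 * g b + 2 * \<delta> + 2 * \<kappa> * nrm h ^2" .
    have 2: "F f1 + ip f1 (b + h) + (F f2 + ip f2 (b - h)) \<le> g (b + h) + g (b - h)"
      by (intro add_mono g_ge f)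
    have 3: "ip (f1 - f2) h \<le> 4 * \<delta> + 2 * \<kappa> * nrm h ^2"
      using 1 2 gb by (simp add: ip_simps)
    have "ip (f1 - f2) h = nrm (f1 - f2)^2 / (4 * \<kappa>)"
      unfolding h_def ip_right(3) nrm_sq by simp
    moreover have "nrm h ^ 2 = nrm (f1 - f2)^2 / (16 * \<kappa>^2)"
      using \<kappa> by (simp add: h_def nrm_scale power_mult_distrib power_divide)
    moreover from this have "2 * \<kappa> * nrm h ^ 2 = nrm (f1 - f2)^2 / (8 * \<kappa>)"
      using \<kappa> by (simp add: power2_eq_square)
    ultimately have "nrm (f1 - f2)^2 / (4 * \<kappa>) \<le> 4 * \<delta> + nrm (f1 - f2)^2 / (8 * \<kappa>)"
      using 3 by linarith
    then have "nrm (f1 - f2)^2 \<le> 32 * \<kappa> * \<delta>" using \<kappa> by (simp add: field_simps)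
    also have "\<dots> \<le> \<eta>^2" by (rule \<delta>)
    finally show ?thesis by (rule power2_le_imp_le) (use pos in simp)
  qed
  ultimately show ?thesis using \<delta>(1) by blast
qed

text \<open>Iterate \<open>small_slice\<close>: each new point \<open>a (n + 1)\<close> lies within an eighth of the slice width \<open>d n\<close> of
  \<open>a n\<close>, and the widths halve, so an almost maximizer for the limit functional \<open>\<rho>\<close> lies in every
  slice. The limit is taken among functionals because the points \<open>a n\<close> need not converge in the space.\<close>

theorem strongly_exposing_perturbation:
  assumes B: "B \<noteq> {}" "\<And>f. f \<in> B \<Longrightarrow> nrm f \<le> 1" and F: "\<And>f. f \<in> B \<Longrightarrow> F f \<le> C"
    and \<epsilon>: "\<epsilon> > 0"
  obtains \<rho> where "linear \<rho>" "\<And>f. \<bar>\<rho> f\<bar> \<le> \<epsilon> * nrm f"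
    "\<And>\<eta>. \<eta> > 0 \<Longrightarrow> \<exists>\<delta>>0. \<forall>f1\<in>B. \<forall>f2\<in>B. (\<forall>h\<in>B. F h + \<rho> h \<le> F f1 + \<rho> f1 + \<delta>) \<longrightarrow>
       (\<forall>h\<in>B. F h + \<rho> h \<le> F f2 + \<rho> f2 + \<delta>) \<longrightarrow> nrm (f1 - f2) \<le> \<eta>"
proof -
  define P where "P n = (\<lambda>(b, \<delta>). \<delta> > 0 \<and>
    (\<forall>f1\<in>B. \<forall>f2\<in>B. (\<forall>h\<in>B. F h + ip h b \<le> F f1 + ip f1 b + \<delta>) \<longrightarrow>
       (\<forall>h\<in>B. F h + ip h b \<le> F f2 + ip f2 b + \<delta>) \<longrightarrow> nrm (f1 - f2) \<le> 2 / 2 ^ n))" for n :: nat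
  define Q where "Q = (\<lambda>(n::nat) (a, \<delta>) (b, \<delta>'). nrm (b - a) \<le> \<delta> / 8 \<and> \<delta>' \<le> \<delta> / (2::real))"
  have "\<exists>s. \<forall>n. (P n (s n) \<and> (n = 0 \<longrightarrow> s n = (0, \<epsilon>))) \<and> Q n (s n) (s (Suc n))"
  proof (rule dependent_nat_choice)
    have "nrm (f1 - f2) \<le> 2" if "f1 \<in> B" "f2 \<in> B" for f1 f2
      using nrm_triangle[of f1 "(-1) *\<^sub>R f2"] nrm_scale[of "-1" f2] B(2)[OF that(1)] B(2)[OF that(2)]
      by simp
    then show "\<exists>x. P 0 x \<and> (0 = 0 \<longrightarrow> x = (0, \<epsilon>))"
      using \<epsilon> by (auto simp: P_def)
  next
    fix x n assume "P n x \<and> (n = 0 \<longrightarrow> x = (0, \<epsilon>))"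
    then obtain a \<delta> where x: "x = (a, \<delta>)" and \<delta>: "\<delta> > 0" by (cases x) (auto simp: P_def)
    have "\<exists>b \<delta>'. \<delta>' > 0 \<and> nrm (b - a) \<le> \<delta> / 8 \<and>
      (\<forall>f1\<in>B. \<forall>f2\<in>B. (\<forall>h\<in>B. F h + ip h b \<le> F f1 + ip f1 b + \<delta>') \<longrightarrow>
        (\<forall>h\<in>B. F h + ip h b \<le> F f2 + ip f2 b + \<delta>') \<longrightarrow> nrm (f1 - f2) \<le> 2 / 2 ^ Suc n)"
      using B F \<delta> by (intro small_slice) auto
    then obtain b \<delta>' where b: "\<delta>' > 0" "nrm (b - a) \<le> \<delta> / 8"
      "\<And>f1 f2. f1\<in>B \<Longrightarrow> f2\<in>B \<Longrightarrow> (\<forall>h\<in>B. F h + ip h b \<le> F f1 + ip f1 b + \<delta>') \<Longrightarrow>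
       (\<forall>h\<in>B. F h + ip h b \<le> F f2 + ip f2 b + \<delta>') \<Longrightarrow> nrm (f1 - f2) \<le> 2 / 2 ^ Suc n"
      by blast
    have "P (Suc n) (b, min \<delta>' (\<delta> / 2))"
    proof -
      have mono: "\<forall>h\<in>B. F h + ip h b \<le> F f + ip f b + \<delta>'"
        if "\<forall>h\<in>B. F h + ip h b \<le> F f + ip f b + min \<delta>' (\<delta> / 2)" for f
        using that by fastforce
      show ?thesis
        unfolding P_def prod.case using b(1) \<delta>
        by (intro conjI ballI impI) (simp, rule b(3)[OF _ _ mono mono])
    qed
    moreover have "Q n x (b, min \<delta>' (\<delta> / 2))" using b(2) by (simp add: Q_def x)
    ultimately show "\<exists>y. (P (Suc n) y \<and> (Suc n = 0 \<longrightarrow> y = (0, \<epsilon>))) \<and> Q n x y" by auto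
  qed
  then obtain s where s: "\<And>n. P n (s n)" "s 0 = (0, \<epsilon>)" "\<And>n. Q n (s n) (s (Suc n))"
    by metis
  define a where "a n = fst (s n)" for n
  define d where "d n = snd (s n)" for n
  have d_pos: "d n > 0" for n using s(1)[of n] by (auto simp: P_def d_def)
  have step: "nrm (a (Suc n) - a n) \<le> d n / 8" "d (Suc n) \<le> d n / 2" for n
    using s(3)[of n] by (auto simp: Q_def a_def d_def split: prod.splits)
  have slice: "nrm (f1 - f2) \<le> 2 / 2 ^ n" if "f1 \<in> B" "f2 \<in> B"
    "\<forall>h\<in>B. F h + ip h (a n) \<le> F f1 + ip f1 (a n) + d n"
    "\<forall>h\<in>B. F h + ip h (a n) \<le> F f2 + ip f2 (a n) + d n" for f1 f2 n
    using s(1)[of n] that by (auto simp: P_def a_def d_def split: prod.splits)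
  have tail: "nrm (a (n + k) - a n) \<le> d n / 4 - d (n + k) / 4" for n k
  proof (induction k)
    case 0
    then show ?case by (simp add: nrm_def ip_zero)
  next
    case (Suc k)
    have "a (n + Suc k) - a n = (a (Suc (n + k)) - a (n + k)) + (a (n + k) - a n)" by simp
    then have "nrm (a (n + Suc k) - a n) \<le> nrm (a (Suc (n + k)) - a (n + k)) + nrm (a (n + k) - a n)"
      by (metis nrm_triangle)
    then show ?case using Suc step[of "n + k"] by simp
  qed
  have d_le: "d n \<le> \<epsilon> / 2 ^ n" for n
  proof (induction n)
    case 0
    then show ?case using s(2) by (simp add: d_def)
  next
    case (Suc n)
    then show ?case using step(2)[of n] by simp
  qed
  have tail': "\<bar>ip f (a m) - ip f (a n)\<bar> \<le> nrm f * (d n / 4)" if nm: "n \<le> m" for f m n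
  proof -
    obtain k where k: "m = n + k" using le_Suc_ex[OF nm] by blast
    have "\<bar>ip f (a m - a n)\<bar> \<le> nrm f * nrm (a m - a n)" by (rule Cauchy_Schwarz)
    also have "\<dots> \<le> nrm f * (d n / 4)"
      using tail[of n k] d_pos[of "n + k"] by (intro mult_left_mono nrm_nonneg) (simp add: k)
    finally show ?thesis by (simp add: ip_simps)
  qed
  have d_lim: "(\<lambda>n. nrm f * (d n / 4)) \<longlonglongrightarrow> 0" for f
  proof -
    have "d \<longlonglongrightarrow> 0"
    proof (rule tendsto_sandwich[of "\<lambda>_. 0"])
      show "(\<lambda>n. \<epsilon> / 2 ^ n) \<longlonglongrightarrow> 0"
        using LIMSEQ_divide_realpow_zero[of 2 \<epsilon>] by simp
    qed (use d_le less_imp_le[OF d_pos] in auto)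
    from tendsto_mult_left[OF this, of "nrm f / 4"] show ?thesis by (simp add: mult.commute)
  qed
  have "Cauchy (\<lambda>n. ip f (a n))" for f
  proof (rule metric_CauchyI)
    fix e :: real assume "e > 0"
    then have "\<exists>N. nrm f * (d N / 4) < e / 2"
      using order_tendstoD(2)[OF d_lim[of f], of "e/2"] by (auto simp: eventually_sequentially)
    then obtain N where N: "nrm f * (d N / 4) < e / 2" ..
    have "dist (ip f (a m)) (ip f (a n)) < e" if "m \<ge> N" "n \<ge> N" for m n
      using tail'[OF that(1), of f] tail'[OF that(2), of f] N unfolding dist_real_def by linarith
    then show "\<exists>M. \<forall>m\<ge>M. \<forall>n\<ge>M. dist (ip f (a m)) (ip f (a n)) < e" by blast
  qed
  then have conv: "convergent (\<lambda>n. ip f (a n))" for f by (rule Cauchy_convergent)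
  define \<rho> where "\<rho> f = lim (\<lambda>n. ip f (a n))" for f
  have lim: "(\<lambda>n. ip f (a n)) \<longlonglongrightarrow> \<rho> f" for f
    using conv[of f] by (simp add: \<rho>_def convergent_LIMSEQ_iff)
  have close: "\<bar>\<rho> f - ip f (a n)\<bar> \<le> nrm f * (d n / 4)" for f n
  proof (rule tendsto_upperbound)
    show "(\<lambda>m. \<bar>ip f (a m) - ip f (a n)\<bar>) \<longlonglongrightarrow> \<bar>\<rho> f - ip f (a n)\<bar>"
      by (intro tendsto_intros lim)
    show "\<forall>\<^sub>F m in sequentially. \<bar>ip f (a m) - ip f (a n)\<bar> \<le> nrm f * (d n / 4)"
      using tail' by (auto simp: eventually_sequentially)
  qed simp
  show thesis
  proof (rule that[of \<rho>])
    show "linear \<rho>"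
    proof (rule linearI)
      show "\<rho> (x + y) = \<rho> x + \<rho> y" for x y
        using tendsto_add[OF lim[of x] lim[of y]] lim[of "x + y"]
        by (simp add: ip_simps LIMSEQ_unique)
      show "\<rho> (c *\<^sub>R x) = c *\<^sub>R \<rho> x" for c x
        using tendsto_mult_left[OF lim[of x], of c] lim[of "c *\<^sub>R x"]
        by (simp add: ip_simps LIMSEQ_unique)
    qed
  next
    fix f
    have "ip f (a 0) = 0" using ip_right(3)[of f 0 0] by (simp add: a_def s(2))
    then have "\<bar>\<rho> f\<bar> \<le> nrm f * (\<epsilon> / 4)" using close[of f 0] s(2) by (simp add: d_def)
    also have "\<dots> \<le> \<epsilon> * nrm f" using \<epsilon> nrm_nonneg[of f] by simp
    finally show "\<bar>\<rho> f\<bar> \<le> \<epsilon> * nrm f" .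
  next
    fix \<eta> :: real assume \<eta>: "\<eta> > 0"
    have lim2: "(\<lambda>n. 2 / 2 ^ n :: real) \<longlonglongrightarrow> 0"
      using LIMSEQ_divide_realpow_zero[of 2 2] by simp
    have "\<exists>n. 2 / 2 ^ n < \<eta>"
      using order_tendstoD(2)[OF lim2 \<eta>] by (auto simp: eventually_sequentially)
    then obtain n where n: "2 / 2 ^ n < \<eta>" ..
    have tr: "\<forall>h\<in>B. F h + ip h (a n) \<le> F f + ip f (a n) + d n"
      if f: "f \<in> B" and m: "\<forall>h\<in>B. F h + \<rho> h \<le> F f + \<rho> f + d n / 2" for f
    proof
      fix h assume h: "h \<in> B"
      have c: "\<bar>\<rho> u - ip u (a n)\<bar> \<le> d n / 4" if "u \<in> B" for u
      proof -
        have "nrm u * (d n / 4) \<le> 1 * (d n / 4)"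
          using B(2)[OF that] d_pos[of n] by (intro mult_right_mono) auto
        then show ?thesis using close[of u n] by linarith
      qed
      show "F h + ip h (a n) \<le> F f + ip f (a n) + d n"
        using c[OF h] c[OF f] bspec[OF m h] by linarith
    qed
    show "\<exists>\<delta>>0. \<forall>f1\<in>B. \<forall>f2\<in>B. (\<forall>h\<in>B. F h + \<rho> h \<le> F f1 + \<rho> f1 + \<delta>) \<longrightarrow>
       (\<forall>h\<in>B. F h + \<rho> h \<le> F f2 + \<rho> f2 + \<delta>) \<longrightarrow> nrm (f1 - f2) \<le> \<eta>"
    proof (intro exI[of _ "d n / 2"] conjI ballI impI)
      fix f1 f2 assume f: "f1 \<in> B" "f2 \<in> B" and m: "\<forall>h\<in>B. F h + \<rho> h \<le> F f1 + \<rho> f1 + d n / 2"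
        "\<forall>h\<in>B. F h + \<rho> h \<le> F f2 + \<rho> f2 + d n / 2"
      have "nrm (f1 - f2) \<le> 2 / 2 ^ n" by (rule slice[OF f tr[OF f(1) m(1)] tr[OF f(2) m(2)]])
      then show "nrm (f1 - f2) \<le> \<eta>" using n by linarith
    qed (simp add: d_pos)
  qed
qed

end

section \<open>Unconditional series with weakly clustering partial sums\<close>

text \<open>A substitute for a weak* cluster point of \<open>\<phi>\<close>: a functional below the sublinear
  \<open>v \<mapsto> limsup (\<phi> n v)\<close> that agrees with it at \<open>s\<close>.\<close>

lemma limsup_functional:
  fixes \<phi> :: "nat \<Rightarrow> 'y::real_normed_vector \<Rightarrow>\<^sub>L real"
  assumes le1: "\<And>n. norm (\<phi> n) \<le> 1"
  obtains \<psi> :: "'y \<Rightarrow>\<^sub>L real" where "\<And>v n c. (\<And>m. m \<ge> n \<Longrightarrow> \<phi> m v \<le> c) \<Longrightarrow> \<psi> v \<le> c"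
    "\<And>n c. (\<And>m. m \<ge> n \<Longrightarrow> c \<le> \<phi> m s) \<Longrightarrow> c \<le> \<psi> s"
proof -
  define E where "E v = {c. \<exists>n. \<forall>m\<ge>n. \<phi> m v \<le> c}" for v
  define p where "p v = Inf (E v)" for v
  have abs: "\<bar>\<phi> n v\<bar> \<le> norm v" for n v
    using norm_blinfun[of "\<phi> n" v] mult_right_mono[OF le1[of n], of "norm v"] by simp
  have ne: "norm v \<in> E v" for v using abs by (auto simp: E_def abs_le_iff)
  have lower: "- norm v \<le> c" if "c \<in> E v" for v c
  proof -
    obtain n where "\<phi> n v \<le> c" using \<open>c \<in> E v\<close> by (auto simp: E_def)
    then show ?thesis using abs[of n v] by linarith
  qed
  have bdd: "bdd_below (E v)" for v using lower by (auto simp: bdd_below_def)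
  have ple: "p v \<le> c" if "\<And>m. m \<ge> n \<Longrightarrow> \<phi> m v \<le> c" for v n c
    unfolding p_def by (rule cInf_lower[OF _ bdd]) (use that in \<open>auto simp: E_def\<close>)
  have pge: "c \<le> p v" if "\<And>m. m \<ge> n \<Longrightarrow> c \<le> \<phi> m v" for v n c
    unfolding p_def
  proof (rule cInf_greatest)
    show "E v \<noteq> {}" using ne[of v] by blast
    fix d assume "d \<in> E v"
    then obtain k where k: "\<And>m. m \<ge> k \<Longrightarrow> \<phi> m v \<le> d" by (auto simp: E_def)
    show "c \<le> d" using that[of "max n k"] k[of "max n k"] by simp
  qed
  have "p (u + v) \<le> p u + p v" for u v
  proof -
    have *: "p (u + v) \<le> c + d" if cd: "c \<in> E u" "d \<in> E v" for c d
    proof -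
      obtain n k where "\<And>m. m \<ge> n \<Longrightarrow> \<phi> m u \<le> c" "\<And>m. m \<ge> k \<Longrightarrow> \<phi> m v \<le> d"
        using cd by (auto simp: E_def)
      then show ?thesis
        by (intro ple[of "max n k"]) (simp add: blinfun.add_right add_mono)
    qed
    have "p (u + v) - d \<le> p u" if "d \<in> E v" for d
      unfolding p_def[of u] using *[OF _ that] ne[of u] by (intro cInf_greatest) (auto simp: algebra_simps)
    then have "p (u + v) - p u \<le> p v"
      unfolding p_def[of v] using ne[of v] by (intro cInf_greatest) (auto simp: algebra_simps)
    then show ?thesis by simp
  qed
  moreover have "p (a *\<^sub>R v) \<le> a * p v" if "a > 0" for a v
  proof -
    have "p (a *\<^sub>R v) / a \<le> p v"
      unfolding p_def[of v]
    proof (rule cInf_greatest)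
      show "E v \<noteq> {}" using ne[of v] by blast
      fix d assume "d \<in> E v"
      then obtain k where k: "\<And>m. m \<ge> k \<Longrightarrow> \<phi> m v \<le> d" by (auto simp: E_def)
      have "p (a *\<^sub>R v) \<le> a * d"
        using k \<open>a > 0\<close> by (intro ple[of k]) (simp add: blinfun.scaleR_right)
      then show "p (a *\<^sub>R v) / a \<le> d" using \<open>a > 0\<close> by (simp add: pos_divide_le_eq mult.commute)
    qed
    then show ?thesis using \<open>a > 0\<close> by (simp add: pos_divide_le_eq mult.commute)
  qed
  ultimately have "sublinear p" by (simp add: sublinear_def)
  moreover have "p v \<le> norm v" for v
    using abs by (intro ple[of 0]) (simp add: abs_le_iff)
  ultimately obtain \<psi> :: "'y \<Rightarrow>\<^sub>L real" where \<psi>: "\<And>v. \<psi> v \<le> p v" "\<psi> s = p s"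
    using bounded_functional_below[of p s] by metis
  show thesis
  proof (rule that[of \<psi>])
    show "\<psi> v \<le> c" if "\<And>m. m \<ge> n \<Longrightarrow> \<phi> m v \<le> c" for v n c
    proof -
      have "p v \<le> c" by (rule ple[of n]) (rule that)
      then show ?thesis using \<psi>(1)[of v] by linarith
    qed
    show "c \<le> \<psi> s" if "\<And>m. m \<ge> n \<Longrightarrow> c \<le> \<phi> m s" for n c
    proof -
      have "c \<le> p s" by (rule pge[of n]) (rule that)
      then show ?thesis using \<psi>(2) by simp
    qed
  qed
qed

text \<open>Suppose \<open>\<parallel>y n\<parallel> \<ge> \<delta>\<close> along a subsequence, with norming functionals \<open>\<phi> n\<close>. By Rosenthal's lemma one may
  assume that \<open>\<phi> n\<close> has total mass at most \<open>\<delta>/4\<close> on the other terms. Then \<open>\<phi> n\<close> is at least \<open>3\<delta>/4\<close>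
  on all long partial sums, hence large at their weak cluster point \<open>s\<close>, while on a fixed partial sum
  it is eventually at most \<open>\<delta>/4\<close>. The functional \<open>limsup (\<phi> n)\<close> separates \<open>s\<close> from all partial sums.\<close>

theorem unconditional_terms_null:
  fixes y :: "nat \<Rightarrow> 'y::real_normed_vector"
  assumes bnd: "\<And>F s. finite F \<Longrightarrow> (\<And>j. \<bar>s j\<bar> \<le> 1) \<Longrightarrow> norm (\<Sum>j\<in>F. s j *\<^sub>R y j) \<le> C"
    and cluster: "\<And>r :: nat \<Rightarrow> nat. inj r \<Longrightarrow> \<exists>s. \<forall>\<phi> :: 'y \<Rightarrow>\<^sub>L real. \<forall>\<epsilon>>0. \<forall>N. \<exists>n\<ge>N.
      \<bar>\<phi> (\<Sum>i<n. y (r i)) - \<phi> s\<bar> < \<epsilon>"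
  shows "y \<longlonglongrightarrow> 0"
proof (rule ccontr)
  assume "\<not> ?thesis"
  then obtain \<delta> where \<delta>: "\<delta> > 0" and "\<forall>N. \<exists>n\<ge>N. norm (y n) \<ge> \<delta>"
    by (auto simp: lim_sequentially not_less)
  then have inf: "infinite {n. norm (y n) \<ge> \<delta>}"
    by (simp add: infinite_nat_iff_unbounded_le)
  define \<sigma> where "\<sigma> = enumerate {n. norm (y n) \<ge> \<delta>}"
  have \<sigma>: "inj \<sigma>" "\<And>n. norm (y (\<sigma> n)) \<ge> \<delta>"
    using strict_mono_enumerate[OF inf] enumerate_in_set[OF inf]
    by (auto simp: \<sigma>_def strict_mono_imp_inj_on)
  have "\<forall>n. \<exists>\<phi> :: 'y \<Rightarrow>\<^sub>L real. norm \<phi> \<le> 1 \<and> blinfun_apply \<phi> (y (\<sigma> n)) = norm (y (\<sigma> n))"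
    using norming_functional by metis
  then obtain \<phi> :: "nat \<Rightarrow> 'y \<Rightarrow>\<^sub>L real"
    where \<phi>: "\<And>n. norm (\<phi> n) \<le> 1" "\<And>n. \<phi> n (y (\<sigma> n)) = norm (y (\<sigma> n))"
    by metis
  define a where "a i j = \<bar>\<phi> i (y (\<sigma> j))\<bar>" for i j
  obtain k where k: "C / (\<delta> / 4) \<le> real k" using real_arch_simple by blast
  have row: "(\<Sum>j\<in>F. a i j) \<le> real k * (\<delta> / 4)" if F: "finite F" for i F
  proof -
    define s where "s m = sgn (\<phi> i (y m))" for m
    have "(\<Sum>j\<in>F. a i j) = (\<Sum>j\<in>F. \<phi> i (s (\<sigma> j) *\<^sub>R y (\<sigma> j)))"
      by (simp add: a_def s_def blinfun.scaleR_right abs_sgn mult.commute)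
    also have "\<dots> = \<phi> i (\<Sum>m\<in>\<sigma> ` F. s m *\<^sub>R y m)"
      using \<sigma>(1) by (subst sum.reindex) (auto simp: blinfun.sum_right inj_on_def)
    also have "\<dots> \<le> norm (\<Sum>m\<in>\<sigma> ` F. s m *\<^sub>R y m)"
      using norm_blinfun[of "\<phi> i" "\<Sum>m\<in>\<sigma> ` F. s m *\<^sub>R y m"] \<phi>(1)[of i]
        mult_right_mono[OF \<phi>(1)[of i], of "norm (\<Sum>m\<in>\<sigma> ` F. s m *\<^sub>R y m)"] by simp
    also have "\<dots> \<le> C" using F by (intro bnd) (auto simp: s_def sgn_real_def)
    also have "C \<le> real k * (\<delta> / 4)" using k \<delta> by (simp add: field_simps)
    finally show ?thesis .
  qed
  obtain r :: "nat \<Rightarrow> nat" where r: "inj r"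
    "\<And>i F. finite F \<Longrightarrow> i \<notin> F \<Longrightarrow> (\<Sum>j\<in>F. a (r i) (r j)) \<le> \<delta> / 4"
    using Rosenthal_off_diagonal[of a "\<delta> / 4" k] row \<delta> by (auto simp: a_def)
  define z where "z i = y (\<sigma> (r i))" for i
  obtain s where "\<forall>\<phi> :: 'y \<Rightarrow>\<^sub>L real. \<forall>\<epsilon>>0. \<forall>N. \<exists>n\<ge>N.
      \<bar>blinfun_apply \<phi> (\<Sum>i<n. (y \<circ> \<sigma> \<circ> r) i) - blinfun_apply \<phi> s\<bar> < \<epsilon>"
    using cluster[OF inj_compose[OF \<sigma>(1) r(1)]] unfolding o_def by blast
  then have s: "\<And>\<phi> :: 'y \<Rightarrow>\<^sub>L real. \<And>\<epsilon> N. \<epsilon> > 0 \<Longrightarrow> \<exists>n\<ge>N. \<bar>\<phi> (\<Sum>i<n. z i) - \<phi> s\<bar> < \<epsilon>"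
    by (simp add: z_def)
  have off: "\<bar>\<phi> (r i) (\<Sum>j\<in>F. z j)\<bar> \<le> \<delta> / 4" if "finite F" "i \<notin> F" for i F
  proof -
    have "\<bar>\<phi> (r i) (\<Sum>j\<in>F. z j)\<bar> \<le> (\<Sum>j\<in>F. a (r i) (r j))"
      unfolding blinfun.sum_right a_def z_def by (rule sum_abs)
    then show ?thesis using r(2)[OF that] by linarith
  qed
  have diag: "3 / 4 * \<delta> \<le> \<phi> (r i) (\<Sum>j<n. z j)" if "i < n" for i n
  proof -
    have "(\<Sum>j<n. z j) = z i + (\<Sum>j\<in>{..<n} - {i}. z j)"
      using that by (subst sum.remove[of _ i]) auto
    then have "\<phi> (r i) (\<Sum>j<n. z j) = norm (y (\<sigma> (r i))) + \<phi> (r i) (\<Sum>j\<in>{..<n} - {i}. z j)"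
      by (simp add: blinfun.add_right z_def \<phi>(2))
    then show ?thesis using off[of "{..<n} - {i}" i] \<sigma>(2)[of "r i"] by simp
  qed
  have ge: "\<delta> * (5 / 8) \<le> \<phi> (r i) s" for i
  proof -
    obtain n where "n \<ge> Suc i" "\<bar>\<phi> (r i) (\<Sum>j<n. z j) - \<phi> (r i) s\<bar> < \<delta> / 8"
      using s[of "\<delta> / 8" "Suc i" "\<phi> (r i)"] \<delta> by auto
    then show ?thesis using diag[of i n] unfolding abs_less_iff by linarith
  qed
  obtain \<psi> :: "'y \<Rightarrow>\<^sub>L real" where \<psi>: "\<And>v n c. (\<And>m. m \<ge> n \<Longrightarrow> \<phi> (r m) v \<le> c) \<Longrightarrow> \<psi> v \<le> c"
    "\<And>n c. (\<And>m. m \<ge> n \<Longrightarrow> c \<le> \<phi> (r m) s) \<Longrightarrow> c \<le> \<psi> s"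
    using limsup_functional[of "\<lambda>m. \<phi> (r m)" s] \<phi>(1) by metis
  have le: "\<psi> (\<Sum>j<n. z j) \<le> \<delta> / 4" for n
  proof (rule \<psi>(1)[of n])
    show "\<phi> (r m) (\<Sum>j<n. z j) \<le> \<delta> / 4" if "n \<le> m" for m
      using off[of "{..<n}" m] that unfolding abs_le_iff by simp
  qed
  have "\<delta> * (5 / 8) \<le> \<psi> s" by (rule \<psi>(2)[of 0]) (rule ge)
  moreover obtain n where "\<bar>\<psi> (\<Sum>j<n. z j) - \<psi> s\<bar> < \<delta> / 8"
    using s[of "\<delta> / 8" 0 \<psi>] \<delta> by auto
  ultimately show False using \<delta> le[of n] unfolding abs_less_iff by linarith
qed

section \<open>The variation of a functional on C(K)\<close>

lemma apply_Bcontfun: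
  assumes "compact (UNIV :: 'k::topological_space set)"
    and "continuous_on UNIV (f :: 'k \<Rightarrow> 'f::real_normed_vector)"
  shows "apply_bcontfun (Bcontfun f) = f"
  using assms by (intro Bcontfun_inverse)
    (auto simp: bcontfun_def intro: compact_imp_bounded compact_continuous_image)

text \<open>Multiplication by a continuous scalar function. On a compact space the product is automatically
  bounded; elsewhere the value of \<open>Bcontfun\<close> may be arbitrary.\<close>

definition scale_fun ::
  "('k::topological_space \<Rightarrow> real) \<Rightarrow> ('k \<Rightarrow>\<^sub>C 'f::real_normed_vector) \<Rightarrow> 'k \<Rightarrow>\<^sub>C 'f"
  where "scale_fun u f = Bcontfun (\<lambda>t. u t *\<^sub>R apply_bcontfun f t)"

lemma apply_scale_fun:
  assumes "compact (UNIV :: 'k::topological_space set)" "continuous_on UNIV (u :: 'k \<Rightarrow> real)"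
  shows "apply_bcontfun (scale_fun u f) t = u t *\<^sub>R apply_bcontfun f t"
  unfolding scale_fun_def using assms
  by (subst apply_Bcontfun) (auto intro!: continuous_intros)

lemma continuous_bounded_above:
  assumes "compact (UNIV :: 'k::topological_space set)" "continuous_on UNIV (u :: 'k \<Rightarrow> real)"
  obtains c where "\<And>t. u t \<le> c" "c \<ge> 0"
proof -
  have "bounded (range u)"
    using assms by (intro compact_imp_bounded compact_continuous_image)
  then obtain c where c: "\<And>t. \<bar>u t\<bar> \<le> c" by (auto simp: bounded_iff)
  then have "u t \<le> c" for t using abs_le_D1 by blast
  moreover have "c \<ge> 0" using c[of undefined] by linarith
  ultimately show thesis using that by blast
qed

text \<open>The total variation of the measure of \<open>\<mu>\<close>, integrated against \<open>w\<close>.\<close>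

definition variation :: "(('k::topological_space \<Rightarrow>\<^sub>C 'f::real_normed_vector) \<Rightarrow>\<^sub>L real) \<Rightarrow> ('k \<Rightarrow> real) \<Rightarrow> real"
  where "variation \<mu> w = Sup {\<mu> f | f. \<forall>t. norm (apply_bcontfun f t) \<le> w t}"

lemma variation_upper:
  assumes "\<And>t. w t \<le> c" "\<And>t. norm (apply_bcontfun f t) \<le> w t"
  shows "blinfun_apply \<mu> f \<le> variation \<mu> w"
  unfolding variation_def
proof (rule cSup_upper)
  have "\<mu> g \<le> norm \<mu> * c" if "\<forall>t. norm (apply_bcontfun g t) \<le> w t" for g
  proof -
    have "norm g \<le> c" using that assms(1) by (intro norm_bound) (meson order_trans)
    then have "norm \<mu> * norm g \<le> norm \<mu> * c" by (intro mult_left_mono) auto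
    then show ?thesis using norm_blinfun[of \<mu> g] by simp
  qed
  then show "bdd_above {\<mu> f | f. \<forall>t. norm (apply_bcontfun f t) \<le> w t}"
    by (auto intro!: bdd_aboveI[of _ "norm \<mu> * c"])
qed (use assms in auto)

lemma variation_least:
  assumes "\<And>t. 0 \<le> w t" "\<And>f. (\<And>t. norm (apply_bcontfun f t) \<le> w t) \<Longrightarrow> blinfun_apply \<mu> f \<le> b"
  shows "variation \<mu> w \<le> b"
  unfolding variation_def
proof (rule cSup_least)
  have "\<mu> 0 \<in> {\<mu> f | f. \<forall>t. norm (apply_bcontfun f t) \<le> w t}"
    using assms(1) by (intro CollectI exI[of _ 0]) auto
  then show "{\<mu> f | f. \<forall>t. norm (apply_bcontfun f t) \<le> w t} \<noteq> {}" by blast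
qed (use assms(2) in auto)

lemma variation_zero [simp]: "variation \<mu> (\<lambda>t. 0) = 0"
proof -
  have "variation \<mu> (\<lambda>t. 0) \<le> 0"
  proof (rule variation_least)
    fix f :: "'a \<Rightarrow>\<^sub>C 'b" assume "\<And>t. norm (apply_bcontfun f t) \<le> 0"
    then have "f = 0" by (intro bcontfun_eqI) simp
    then show "blinfun_apply \<mu> f \<le> 0" by (simp add: blinfun.zero_right)
  qed simp
  moreover have "0 \<le> variation \<mu> (\<lambda>t. 0)"
    using variation_upper[of "\<lambda>t. 0" 0 0 \<mu>] by (simp add: blinfun.zero_right)
  ultimately show ?thesis by simp
qed

lemma variation_nonneg:
  assumes "\<And>t. 0 \<le> w t" "\<And>t. w t \<le> c" shows "0 \<le> variation \<mu> w"
  using variation_upper[of w c 0 \<mu>] assms by (simp add: blinfun.zero_right)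

text \<open>A function dominated by \<open>v + w\<close> is split in the proportion \<open>v : w\<close>. Adding \<open>e > 0\<close> to the
  denominator keeps the pieces continuous where \<open>v + w\<close> vanishes, at the price of an error of norm
  at most \<open>e\<close>.\<close>

lemma variation_add:
  fixes \<mu> :: "('k::topological_space \<Rightarrow>\<^sub>C 'f::real_normed_vector) \<Rightarrow>\<^sub>L real"
  assumes K: "compact (UNIV :: 'k set)"
    and v: "continuous_on UNIV v" "\<And>t. 0 \<le> v t" and w: "continuous_on UNIV w" "\<And>t. 0 \<le> w t"
  shows "variation \<mu> (\<lambda>t. v t + w t) = variation \<mu> v + variation \<mu> w"
proof (rule antisym)
  obtain c where c: "\<And>t. v t \<le> c" "c \<ge> 0" using continuous_bounded_above[OF K v(1)] by metis
  obtain d where d: "\<And>t. w t \<le> d" "d \<ge> 0" using continuous_bounded_above[OF K w(1)] by metis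
  show "variation \<mu> (\<lambda>t. v t + w t) \<le> variation \<mu> v + variation \<mu> w"
  proof (rule variation_least)
    fix f :: "'k \<Rightarrow>\<^sub>C 'f" assume f: "\<And>t. norm (apply_bcontfun f t) \<le> v t + w t"
    have "\<mu> f \<le> variation \<mu> v + variation \<mu> w + norm \<mu> * e" if e: "e > 0" for e
    proof -
      have pos: "v t + w t + e > 0" for t using v(2)[of t] w(2)[of t] e by simp
      have cont: "continuous_on UNIV (\<lambda>t. v t / (v t + w t + e))"
        "continuous_on UNIV (\<lambda>t. w t / (v t + w t + e))"
        using pos by (auto intro!: continuous_intros v w simp: less_imp_neq[symmetric])
      define g where "g = scale_fun (\<lambda>t. v t / (v t + w t + e)) f"
      define h where "h = scale_fun (\<lambda>t. w t / (v t + w t + e)) f"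
      have g: "apply_bcontfun g t = (v t / (v t + w t + e)) *\<^sub>R apply_bcontfun f t"
        and h: "apply_bcontfun h t = (w t / (v t + w t + e)) *\<^sub>R apply_bcontfun f t" for t
        using cont by (auto simp: g_def h_def apply_scale_fun[OF K])
      have fr: "norm (apply_bcontfun f t) / (v t + w t + e) \<le> 1" for t
        using f[of t] pos[of t] e by simp
      have gn: "norm (apply_bcontfun g t) \<le> v t" for t
        using mult_left_mono[OF fr[of t] v(2)[of t]] v(2)[of t] pos[of t] by (simp add: g)
      have hn: "norm (apply_bcontfun h t) \<le> w t" for t
        using mult_left_mono[OF fr[of t] w(2)[of t]] w(2)[of t] pos[of t] by (simp add: h)
      have "norm (f - g - h) \<le> e"
      proof (rule norm_bound)
        fix t
        have "apply_bcontfun (f - g - h) t =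
            (1 - v t / (v t + w t + e) - w t / (v t + w t + e)) *\<^sub>R apply_bcontfun f t"
          by (simp add: g h scaleR_diff_left)
        also have "1 - v t / (v t + w t + e) - w t / (v t + w t + e) = e / (v t + w t + e)"
        proof -
          have "v t / (v t + w t + e) + w t / (v t + w t + e) + e / (v t + w t + e) = 1"
            using pos[of t] by (simp add: add_divide_distrib[symmetric])
          then show ?thesis by simp
        qed
        finally show "norm (apply_bcontfun (f - g - h) t) \<le> e"
          using mult_left_mono[OF fr[of t], of e] e pos[of t] by simp
      qed
      then have "norm \<mu> * norm (f - g - h) \<le> norm \<mu> * e" by (intro mult_left_mono) auto
      then have "\<mu> (f - g - h) \<le> norm \<mu> * e"
        using norm_blinfun[of \<mu> "f - g - h"] by simp
      moreover have "\<mu> g \<le> variation \<mu> v" using c gn by (intro variation_upper[of _ c])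
      moreover have "\<mu> h \<le> variation \<mu> w" using d hn by (intro variation_upper[of _ d])
      ultimately show ?thesis by (simp add: blinfun.diff_right)
    qed
    then have *: "\<mu> f \<le> variation \<mu> v + variation \<mu> w + norm \<mu> * e" if "e > 0" for e
      using that by blast
    show "\<mu> f \<le> variation \<mu> v + variation \<mu> w"
    proof (rule field_le_epsilon)
      fix e :: real assume e: "e > 0"
      have p1: "norm \<mu> + 1 > 0" using norm_ge_zero[of \<mu>] by linarith
      then have "e / (norm \<mu> + 1) > 0" using e by simp
      moreover have "norm \<mu> * (e / (norm \<mu> + 1)) \<le> e"
        using e p1 by (simp add: pos_divide_le_eq algebra_simps)
      ultimately show "\<mu> f \<le> variation \<mu> v + variation \<mu> w + e"
        using *[of "e / (norm \<mu> + 1)"] by linarith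
    qed
  qed (use v w in \<open>simp add: add_nonneg_nonneg\<close>)
  have "\<mu> f + \<mu> g \<le> variation \<mu> (\<lambda>t. v t + w t)"
    if "\<And>t. norm (apply_bcontfun f t) \<le> v t" "\<And>t. norm (apply_bcontfun g t) \<le> w t" for f g
  proof -
    have "\<mu> (f + g) \<le> variation \<mu> (\<lambda>t. v t + w t)"
    proof (rule variation_upper[of _ "c + d"])
      show "norm (apply_bcontfun (f + g) t) \<le> v t + w t" for t
        using that norm_triangle_mono by (simp add: norm_triangle_mono)
    qed (simp add: c d add_mono)
    then show ?thesis by (simp add: blinfun.add_right)
  qed
  then have "variation \<mu> v \<le> variation \<mu> (\<lambda>t. v t + w t) - \<mu> g"
    if "\<And>t. norm (apply_bcontfun g t) \<le> w t" for g
    using that v(2) by (intro variation_least) (auto simp: algebra_simps)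
  then have "variation \<mu> w \<le> variation \<mu> (\<lambda>t. v t + w t) - variation \<mu> v"
    using w(2) by (intro variation_least) (auto simp: algebra_simps)
  then show "variation \<mu> v + variation \<mu> w \<le> variation \<mu> (\<lambda>t. v t + w t)" by simp
qed

lemma variation_scale_le:
  fixes \<mu> :: "('k::topological_space \<Rightarrow>\<^sub>C 'f::real_normed_vector) \<Rightarrow>\<^sub>L real"
  assumes "\<And>t. 0 \<le> w t" "\<And>t. w t \<le> c" "a > 0"
  shows "variation \<mu> (\<lambda>t. a * w t) \<le> a * variation \<mu> w"
proof (rule variation_least)
  fix f :: "'k \<Rightarrow>\<^sub>C 'f" assume f: "\<And>t. norm (apply_bcontfun f t) \<le> a * w t"
  have "\<mu> ((1 / a) *\<^sub>R f) \<le> variation \<mu> w"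
    using assms f by (intro variation_upper[of _ c]) (auto simp: field_simps)
  then show "\<mu> f \<le> a * variation \<mu> w" using assms(3) by (simp add: blinfun.scaleR_right field_simps)
qed (use assms in auto)

lemma variation_scale:
  assumes "\<And>t. 0 \<le> w t" "\<And>t. w t \<le> c" "a \<ge> 0"
  shows "variation \<mu> (\<lambda>t. a * w t) = a * variation \<mu> w"
proof (cases "a = 0")
  case False
  then have a: "a > 0" using assms(3) by simp
  have "variation \<mu> (\<lambda>t. inverse a * (a * w t)) \<le> inverse a * variation \<mu> (\<lambda>t. a * w t)"
    using assms a by (intro variation_scale_le[of _ "a * c"]) auto
  then have "a * variation \<mu> w \<le> variation \<mu> (\<lambda>t. a * w t)"
    using a by (simp add: field_simps)
  with variation_scale_le[of w c a \<mu>] assms a show ?thesis by simp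
qed simp

text \<open>The functional acts on plain functions, of which only the continuous ones matter; this avoids
  coercing every pointwise expression into the type of bounded continuous functions.\<close>

definition positive_functional :: "(('k::topological_space \<Rightarrow> real) \<Rightarrow> real) \<Rightarrow> bool" where
  "positive_functional \<nu> \<longleftrightarrow>
    (\<forall>u v. continuous_on UNIV u \<longrightarrow> continuous_on UNIV v \<longrightarrow> \<nu> (\<lambda>t. u t + v t) = \<nu> u + \<nu> v) \<and>
    (\<forall>a u. continuous_on UNIV u \<longrightarrow> \<nu> (\<lambda>t. a * u t) = a * \<nu> u) \<and>
    (\<forall>u. continuous_on UNIV u \<longrightarrow> (\<forall>t. 0 \<le> u t) \<longrightarrow> 0 \<le> \<nu> u)"

lemma positive_functionalD:
  assumes "positive_functional \<nu>" "continuous_on UNIV u"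
  shows "continuous_on UNIV v \<Longrightarrow> \<nu> (\<lambda>t. u t + v t) = \<nu> u + \<nu> v"
    and "\<nu> (\<lambda>t. a * u t) = a * \<nu> u"
    and "(\<And>t. 0 \<le> u t) \<Longrightarrow> 0 \<le> \<nu> u"
  using assms by (auto simp: positive_functional_def)

lemma positive_functional_mono:
  assumes "positive_functional \<nu>" "continuous_on UNIV u" "continuous_on UNIV v" "\<And>t. u t \<le> v t"
  shows "\<nu> u \<le> \<nu> v"
proof -
  have "continuous_on UNIV (\<lambda>t. v t + (-1) * u t)" using assms by (intro continuous_intros)
  then have "0 \<le> \<nu> (\<lambda>t. v t + (-1) * u t)"
    by (rule positive_functionalD(3)[OF assms(1)]) (simp add: assms(4))
  also have "\<dots> = \<nu> v + \<nu> (\<lambda>t. (-1) * u t)"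
    by (rule positive_functionalD(1)[OF assms(1,3)]) (intro continuous_intros assms)
  also have "\<nu> (\<lambda>t. (-1) * u t) = (-1) * \<nu> u"
    by (rule positive_functionalD(2)[OF assms(1,2)])
  finally show ?thesis by simp
qed

text \<open>The variation is additive on the cone of nonnegative functions, so \<open>w \<mapsto> V (w\<^sup>+) - V (w\<^sup>-)\<close> extends it
  linearly.\<close>

lemma variation_functional:
  fixes \<mu> :: "('k::topological_space \<Rightarrow>\<^sub>C 'f::real_normed_vector) \<Rightarrow>\<^sub>L real"
  assumes K: "compact (UNIV :: 'k set)"
  obtains \<nu> where "positive_functional \<nu>" "\<And>w. (\<And>t. 0 \<le> w t) \<Longrightarrow> \<nu> w = variation \<mu> w"
proof
  define V where "V = variation \<mu>"
  define \<nu> where "\<nu> u = V (\<lambda>t. max 0 (u t)) - V (\<lambda>t. max 0 (- u t))" for u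
  have Vadd: "V (\<lambda>t. v t + w t) = V v + V w"
    if "continuous_on UNIV v" "\<And>t. 0 \<le> v t" "continuous_on UNIV w" "\<And>t. 0 \<le> w t" for v w
    unfolding V_def by (rule variation_add[OF K that])
  have diff: "\<nu> (\<lambda>t. v t - w t) = V v - V w"
    if vw: "continuous_on UNIV v" "\<And>t. 0 \<le> v t" "continuous_on UNIV w" "\<And>t. 0 \<le> w t" for v w
  proof -
    have "V (\<lambda>t. max 0 (v t - w t) + w t) = V (\<lambda>t. max 0 (- (v t - w t)) + v t)"
      by (rule arg_cong[where f = V]) (auto simp: max_def)
    moreover have "V (\<lambda>t. max 0 (v t - w t) + w t) = V (\<lambda>t. max 0 (v t - w t)) + V w"
      using vw by (intro Vadd continuous_intros) auto
    moreover have "V (\<lambda>t. max 0 (- (v t - w t)) + v t) = V (\<lambda>t. max 0 (- (v t - w t))) + V v"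
      using vw by (intro Vadd continuous_intros) auto
    ultimately show ?thesis by (simp add: \<nu>_def)
  qed
  have repr: "\<exists>v w. continuous_on UNIV v \<and> (\<forall>t. 0 \<le> v t) \<and> continuous_on UNIV w \<and> (\<forall>t. 0 \<le> w t) \<and>
      u = (\<lambda>t. v t - w t)" if u: "continuous_on UNIV u" for u :: "'k \<Rightarrow> real"
  proof -
    have "continuous_on UNIV (\<lambda>t. max 0 (u t))" "continuous_on UNIV (\<lambda>t. max 0 (- u t))"
      using u by (auto intro!: continuous_intros)
    moreover have "u = (\<lambda>t. max 0 (u t) - max 0 (- u t))" by (auto simp: max_def fun_eq_iff)
    ultimately show ?thesis
      by (intro exI[of _ "\<lambda>t. max 0 (u t)"] exI[of _ "\<lambda>t. max 0 (- u t)"]) simp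
  qed
  have pos: "\<nu> w = V w" if "\<And>t. 0 \<le> w t" for w
  proof -
    have "(\<lambda>t. max 0 (w t)) = w" "(\<lambda>t. max 0 (- w t)) = (\<lambda>t. 0)"
      using that by (auto simp: fun_eq_iff max_def antisym)
    then show ?thesis by (simp add: \<nu>_def V_def)
  qed
  then show "\<nu> w = variation \<mu> w" if "\<And>t. 0 \<le> w t" for w
    using that by (simp add: V_def)
  show "positive_functional \<nu>"
    unfolding positive_functional_def
  proof (intro conjI allI impI)
    fix u v :: "'k \<Rightarrow> real" assume uv: "continuous_on UNIV u" "continuous_on UNIV v"
    obtain u1 u2 where u: "continuous_on UNIV u1" "\<And>t. 0 \<le> u1 t" "continuous_on UNIV u2"
      "\<And>t. 0 \<le> u2 t" "u = (\<lambda>t. u1 t - u2 t)" using repr[OF uv(1)] by blast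
    obtain v1 v2 where v: "continuous_on UNIV v1" "\<And>t. 0 \<le> v1 t" "continuous_on UNIV v2"
      "\<And>t. 0 \<le> v2 t" "v = (\<lambda>t. v1 t - v2 t)" using repr[OF uv(2)] by blast
    note * = u v
    have "\<nu> (\<lambda>t. u t + v t) = \<nu> (\<lambda>t. (u1 t + v1 t) - (u2 t + v2 t))"
      by (simp add: * algebra_simps)
    also have "\<dots> = V (\<lambda>t. u1 t + v1 t) - V (\<lambda>t. u2 t + v2 t)"
      using * by (intro diff) (auto intro!: continuous_intros)
    also have "\<dots> = \<nu> u + \<nu> v" using * by (simp add: Vadd diff)
    finally show "\<nu> (\<lambda>t. u t + v t) = \<nu> u + \<nu> v" .
  next
    fix a :: real and u :: "'k \<Rightarrow> real" assume u: "continuous_on UNIV u"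
    obtain u1 u2 where *: "continuous_on UNIV u1" "\<And>t. 0 \<le> u1 t" "continuous_on UNIV u2"
      "\<And>t. 0 \<le> u2 t" "u = (\<lambda>t. u1 t - u2 t)" using repr[OF u] by blast
    obtain c1 where c1: "\<And>t. u1 t \<le> c1" using continuous_bounded_above[OF K *(1)] by metis
    obtain c2 where c2: "\<And>t. u2 t \<le> c2" using continuous_bounded_above[OF K *(3)] by metis
    have sc: "V (\<lambda>t. b * u1 t) = b * V u1" "V (\<lambda>t. b * u2 t) = b * V u2" if "b \<ge> 0" for b
      unfolding V_def using that variation_scale[of u1 c1 b \<mu>] variation_scale[of u2 c2 b \<mu>] c1 c2 * by auto
    show "\<nu> (\<lambda>t. a * u t) = a * \<nu> u"
    proof (cases "a \<ge> 0")
      case True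
      have "\<nu> (\<lambda>t. a * u t) = \<nu> (\<lambda>t. a * u1 t - a * u2 t)" by (simp add: * algebra_simps)
      also have "\<dots> = V (\<lambda>t. a * u1 t) - V (\<lambda>t. a * u2 t)"
        using * True by (intro diff) (auto intro!: continuous_intros)
      also have "\<dots> = a * \<nu> u" using * True by (simp add: sc diff algebra_simps)
      finally show ?thesis .
    next
      case False
      have "\<nu> (\<lambda>t. a * u t) = \<nu> (\<lambda>t. (- a) * u2 t - (- a) * u1 t)" by (simp add: * algebra_simps)
      also have "\<dots> = V (\<lambda>t. (- a) * u2 t) - V (\<lambda>t. (- a) * u1 t)"
        using * False by (intro diff) (auto intro!: continuous_intros simp: mult_nonpos_nonneg)
      also have "\<dots> = (- a) * V u2 - (- a) * V u1" using False by (simp only: sc)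
      also have "\<dots> = a * \<nu> u" using * by (simp add: diff algebra_simps)
      finally show ?thesis .
    qed
  next
    fix u :: "'k \<Rightarrow> real" assume u: "continuous_on UNIV u" "\<forall>t. 0 \<le> u t"
    obtain c where c: "\<And>t. u t \<le> c" using continuous_bounded_above[OF K u(1)] by metis
    show "0 \<le> \<nu> u" using u c variation_nonneg[of u c \<mu>] pos[of u] by (simp add: V_def)
  qed
qed

section \<open>Control functionals of exhaustive operators\<close>

lemma positive_functional_sum:
  assumes \<nu>: "positive_functional \<nu>" and "finite I" and "\<And>i. i \<in> I \<Longrightarrow> continuous_on UNIV (g i)"
  shows "\<nu> (\<lambda>t. \<Sum>i\<in>I. g i t) = (\<Sum>i\<in>I. \<nu> (g i))"
  using assms(2,3)
proof (induction I rule: finite_induct)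
  case empty
  have "\<nu> (\<lambda>t. 0 * 0) = 0 * \<nu> (\<lambda>t. 0)"
    by (rule positive_functionalD(2)[OF \<nu>]) (rule continuous_on_const)
  then show ?case by simp
next
  case (insert i I)
  have "\<nu> (\<lambda>t. g i t + (\<Sum>i\<in>I. g i t)) = \<nu> (g i) + \<nu> (\<lambda>t. \<Sum>i\<in>I. g i t)"
    using insert by (intro positive_functionalD(1)[OF \<nu>] continuous_on_sum) auto
  then show ?case using insert by simp
qed

lemma positive_functional_le_const:
  assumes "positive_functional \<nu>" "continuous_on UNIV u" "\<And>t. u t \<le> c"
  shows "\<nu> u \<le> c * \<nu> (\<lambda>t. 1)"
proof -
  have "\<nu> u \<le> \<nu> (\<lambda>t. c * 1)"
    by (rule positive_functional_mono[OF assms(1,2)]) (simp_all add: assms(3))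
  also have "\<dots> = c * \<nu> (\<lambda>t. 1)"
    by (rule positive_functionalD(2)[OF assms(1) continuous_on_const])
  finally show ?thesis .
qed

lemma positive_functional_abs_le_const:
  assumes "positive_functional \<nu>" "continuous_on UNIV u" "\<And>t. \<bar>u t\<bar> \<le> c"
  shows "\<bar>\<nu> u\<bar> \<le> c * \<nu> (\<lambda>t. 1)"
proof -
  have "\<nu> u \<le> c * \<nu> (\<lambda>t. 1)"
    using assms(3) by (intro positive_functional_le_const[OF assms(1,2)]) (auto simp: abs_le_iff)
  moreover have "\<nu> (\<lambda>t. -1 * u t) \<le> c * \<nu> (\<lambda>t. 1)"
    using assms(3) by (intro positive_functional_le_const[OF assms(1)] continuous_intros assms(2))
      (auto simp: abs_le_iff)
  moreover have "\<nu> (\<lambda>t. -1 * u t) = -1 * \<nu> u" by (rule positive_functionalD(2)[OF assms(1,2)])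
  ultimately show ?thesis by simp
qed

text \<open>The analogue for operators of an exhaustive (strongly additive) vector measure.\<close>

definition exhaustive_op ::
  "(('k::topological_space \<Rightarrow>\<^sub>C 'f::real_normed_vector) \<Rightarrow>\<^sub>L 'y::real_normed_vector) \<Rightarrow> bool"
  where "exhaustive_op T \<longleftrightarrow> (\<forall>k. (\<forall>n t. (\<Sum>i<n. norm (apply_bcontfun (k i) t)) \<le> 1) \<longrightarrow>
    (\<lambda>n. T (k n)) \<longlonglongrightarrow> 0)"

text \<open>Otherwise disjoint blocks of the increasing sequence would dominate functions with images bounded
  away from zero.\<close>

lemma exhaustive_increasing:
  fixes T :: "('k::topological_space \<Rightarrow>\<^sub>C 'f::real_normed_vector) \<Rightarrow>\<^sub>L 'y::real_normed_vector"
  assumes ex: "exhaustive_op T" and c: "\<And>t. 0 \<le> c 0 t" "\<And>n t. c n t \<le> c (Suc n) t" "\<And>n t. c n t \<le> (1::real)"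
    and \<epsilon>: "\<epsilon> > 0"
  obtains N where "\<And>M f. M \<ge> N \<Longrightarrow> (\<And>t. norm (apply_bcontfun f t) \<le> c M t - c N t) \<Longrightarrow> norm (T f) \<le> \<epsilon>"
proof (rule ccontr)
  note conclude = that
  assume no: "\<not> thesis"
  have "\<exists>M f. M \<ge> N \<and> (\<forall>t. norm (apply_bcontfun f t) \<le> c M t - c N t) \<and> norm (T f) > \<epsilon>" for N
  proof (rule ccontr)
    assume none: "\<not> ?thesis"
    have thesis
    proof (rule conclude[of N])
      show "norm (T f) \<le> \<epsilon>" if "M \<ge> N" "\<And>t. norm (apply_bcontfun f t) \<le> c M t - c N t" for M f
        using none that by (meson not_le)
    qed
    then show False using no by simp
  qed
  then obtain m F where mF: "\<And>N t. norm (apply_bcontfun (F N) t) \<le> c (m N) t - c N t"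
    "\<And>N. norm (T (F N)) > \<epsilon>" by metis
  define s where "s k = (m ^^ k) 0" for k :: nat
  have "(\<Sum>i<n. norm (apply_bcontfun (F (s i)) t)) \<le> 1" for n t
  proof -
    have "(\<Sum>i<n. norm (apply_bcontfun (F (s i)) t)) \<le> (\<Sum>i<n. c (s (Suc i)) t - c (s i) t)"
      by (intro sum_mono) (use mF in \<open>simp add: s_def\<close>)
    also have "\<dots> = c (s n) t - c (s 0) t" by (rule sum_lessThan_telescope)
    also have "\<dots> \<le> 1" using c(1)[of t] c(3)[of "s n" t] by (simp add: s_def)
    finally show ?thesis .
  qed
  then have "(\<lambda>n. T (F (s n))) \<longlonglongrightarrow> 0"
    using ex[unfolded exhaustive_op_def, THEN spec[of _ "\<lambda>n. F (s n)"]] by simp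
  then have "\<exists>n. norm (T (F (s n))) < \<epsilon>"
    using \<epsilon> by (auto simp: lim_sequentially)
  then show False using mF(2) by (meson less_asym)
qed

lemma exhaustive_decreasing:
  fixes T :: "('k::topological_space \<Rightarrow>\<^sub>C 'f::real_normed_vector) \<Rightarrow>\<^sub>L 'y::real_normed_vector"
  assumes ex: "exhaustive_op T" and c: "\<And>t. c 0 t \<le> 1" "\<And>n t. c (Suc n) t \<le> c n t" "\<And>n t. (0::real) \<le> c n t"
    and \<epsilon>: "\<epsilon> > 0"
  obtains N where "\<And>M f. M \<ge> N \<Longrightarrow> (\<And>t. norm (apply_bcontfun f t) \<le> c N t - c M t) \<Longrightarrow> norm (T f) \<le> \<epsilon>"
proof -
  obtain N where "\<And>M f. M \<ge> N \<Longrightarrow> (\<And>t. norm (apply_bcontfun f t) \<le> (1 - c M t) - (1 - c N t)) \<Longrightarrow> norm (T f) \<le> \<epsilon>"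
    using exhaustive_increasing[OF ex, of "\<lambda>n t. 1 - c n t" \<epsilon>] c \<epsilon> by auto
  then show thesis using that[of N] by simp
qed

text \<open>Otherwise choose inductively functions \<open>f n\<close> in the unit ball with \<open>\<parallel>T (f n)\<parallel> > \<eta>\<close> that are small for the
  variations of the functionals norming \<open>T (f i)\<close>, \<open>i < n\<close>. With \<open>w n = \<bar>f n\<bar>\<close>, form a decreasing
  sequence \<open>a n\<close> that plays the role of \<open>sup {w j | j \<ge> n}\<close>. The variation of the \<open>n\<close>-th functional is
  tiny on \<open>a m\<close> for large \<open>m\<close>, and by exhaustivity \<open>a n - a m\<close> is negligible for large \<open>n\<close>; yet
  \<open>w n\<close> is almost below \<open>a n\<close> and has variation more than \<open>\<eta>\<close>.\<close>

lemma control_step: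
  fixes T :: "('k::topological_space \<Rightarrow>\<^sub>C 'f::real_normed_vector) \<Rightarrow>\<^sub>L 'y::real_normed_vector"
  assumes K: "compact (UNIV :: 'k set)" and ex: "exhaustive_op T" and \<eta>: "\<eta> > 0"
  obtains \<nu> \<rho> where "positive_functional \<nu>" "\<rho> > 0"
    "\<And>f. (\<And>t. norm (apply_bcontfun f t) \<le> 1) \<Longrightarrow> \<nu> (\<lambda>t. norm (apply_bcontfun f t)) < \<rho> \<Longrightarrow> norm (T f) \<le> \<eta>"
proof (rule ccontr)
  note conclude = that
  assume no: "\<not> thesis"
  have "\<exists>f. (\<forall>t. norm (apply_bcontfun f t) \<le> 1) \<and> \<nu> (\<lambda>t. norm (apply_bcontfun f t)) < \<rho> \<and> norm (T f) > \<eta>"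
    if "positive_functional \<nu>" "\<rho> > 0" for \<nu> \<rho>
  proof (rule ccontr)
    assume none: "\<not> ?thesis"
    have thesis
    proof (rule conclude[OF that])
      show "norm (T f) \<le> \<eta>" if "\<And>t. norm (apply_bcontfun f t) \<le> 1"
        "\<nu> (\<lambda>t. norm (apply_bcontfun f t)) < \<rho>" for f
        using none that by (meson not_le)
    qed
    then show False using no by simp
  qed
  then have "\<exists>F. \<forall>\<nu> \<rho>. positive_functional \<nu> \<longrightarrow> \<rho> > 0 \<longrightarrow> (\<forall>t. norm (apply_bcontfun (F \<nu> \<rho>) t) \<le> 1) \<and>
      \<nu> (\<lambda>t. norm (apply_bcontfun (F \<nu> \<rho>) t)) < \<rho> \<and> norm (T (F \<nu> \<rho>)) > \<eta>"
    by metis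
  then obtain F where F: "\<And>\<nu> \<rho> t. positive_functional \<nu> \<Longrightarrow> \<rho> > 0 \<Longrightarrow> norm (apply_bcontfun (F \<nu> \<rho>) t) \<le> 1"
    "\<And>\<nu> \<rho>. positive_functional \<nu> \<Longrightarrow> \<rho> > 0 \<Longrightarrow> \<nu> (\<lambda>t. norm (apply_bcontfun (F \<nu> \<rho>) t)) < \<rho>"
    "\<And>\<nu> \<rho>. positive_functional \<nu> \<Longrightarrow> \<rho> > 0 \<Longrightarrow> norm (T (F \<nu> \<rho>)) > \<eta>"
    by blast
  have "\<exists>N. positive_functional N \<and> norm (T f) \<le> N (\<lambda>t. norm (apply_bcontfun f t)) \<and>
      (\<forall>w q. (\<forall>t. 0 \<le> w t) \<longrightarrow> (\<forall>g. (\<forall>t. norm (apply_bcontfun g t) \<le> w t) \<longrightarrow> norm (T g) \<le> q) \<longrightarrow> N w \<le> q)" for f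
  proof -
    obtain \<phi> :: "'y \<Rightarrow>\<^sub>L real" where \<phi>: "norm \<phi> \<le> 1" "blinfun_apply \<phi> (T f) = norm (T f)"
      using norming_functional by metis
    obtain N where N: "positive_functional N" "\<And>w. (\<And>t. 0 \<le> w t) \<Longrightarrow> N w = variation (\<phi> o\<^sub>L T) w"
      using variation_functional[OF K] by metis
    have "norm (T f) = (\<phi> o\<^sub>L T) f" using \<phi>(2) by simp
    also have "\<dots> \<le> variation (\<phi> o\<^sub>L T) (\<lambda>t. norm (apply_bcontfun f t))"
      by (rule variation_upper[of _ "norm f"]) (simp_all add: norm_bounded)
    also have "\<dots> = N (\<lambda>t. norm (apply_bcontfun f t))" using N(2) by simp
    finally have "norm (T f) \<le> N (\<lambda>t. norm (apply_bcontfun f t))" .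
    moreover have "N w \<le> q" if w: "\<forall>t. 0 \<le> w t"
      and q: "\<forall>g. (\<forall>t. norm (apply_bcontfun g t) \<le> w t) \<longrightarrow> norm (T g) \<le> q" for w q
    proof -
      have "variation (\<phi> o\<^sub>L T) w \<le> q"
      proof (rule variation_least)
        fix g :: "'k \<Rightarrow>\<^sub>C 'f" assume g: "\<And>t. norm (apply_bcontfun g t) \<le> w t"
        have "(\<phi> o\<^sub>L T) g \<le> norm \<phi> * norm (T g)"
          using norm_blinfun[of \<phi> "T g"] by simp
        also have "\<dots> \<le> 1 * norm (T g)" using \<phi>(1) by (intro mult_right_mono) auto
        finally show "(\<phi> o\<^sub>L T) g \<le> q" using q g by fastforce
      qed (use w in auto)
      then show ?thesis using N(2) w by simp
    qed
    ultimately show ?thesis using N(1) by blast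
  qed
  then have "\<exists>N. \<forall>f. positive_functional (N f) \<and> norm (T f) \<le> N f (\<lambda>t. norm (apply_bcontfun f t)) \<and>
      (\<forall>w q. (\<forall>t. 0 \<le> w t) \<longrightarrow> (\<forall>g. (\<forall>t. norm (apply_bcontfun g t) \<le> w t) \<longrightarrow> norm (T g) \<le> q) \<longrightarrow> N f w \<le> q)"
    by (intro choice) blast
  then obtain N where N: "\<And>f. positive_functional (N f)"
    "\<And>f. norm (T f) \<le> N f (\<lambda>t. norm (apply_bcontfun f t))"
    and N_le: "\<And>f w q. (\<And>t. 0 \<le> w t) \<Longrightarrow>
      (\<And>g. (\<And>t. norm (apply_bcontfun g t) \<le> w t) \<Longrightarrow> norm (T g) \<le> q) \<Longrightarrow> N f w \<le> q"
    by blast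
  \<comment> \<open>\<open>\<nu> n\<close> sums the variations of the functionals norming \<open>T (f i)\<close> for \<open>i < n\<close>.\<close>
  define \<nu> where "\<nu> = rec_nat (\<lambda>_. 0) (\<lambda>n v u. v u + N (F v ((1/2) ^ n)) u)"
  define f where "f n = F (\<nu> n) ((1/2) ^ n)" for n
  have \<nu>_Suc: "\<nu> (Suc n) u = \<nu> n u + N (f n) u" for n u by (simp add: \<nu>_def f_def)
  have \<nu>_pos: "positive_functional (\<nu> n)" for n
  proof (induction n)
    case 0
    then show ?case by (simp add: \<nu>_def positive_functional_def)
  next
    case (Suc n)
    have "\<nu> (Suc n) = (\<lambda>u. \<nu> n u + N (f n) u)" by (rule ext) (rule \<nu>_Suc)
    then show ?case using Suc N(1)[of "f n"]
      unfolding positive_functional_def by (simp add: algebra_simps)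
  qed
  define w where "w n t = norm (apply_bcontfun (f n) t)" for n t
  have w_cont: "continuous_on UNIV (w n)" for n
    unfolding w_def by (intro continuous_intros continuous_on_apply_bcontfun)
  have w: "0 \<le> w n t" "w n t \<le> 1" "\<nu> n (w n) < (1/2) ^ n" "\<eta> < N (f n) (w n)" for n t
  proof -
    show "0 \<le> w n t" by (simp add: w_def)
    show "w n t \<le> 1" using F(1)[OF \<nu>_pos] by (simp add: w_def f_def)
    show "\<nu> n (w n) < (1/2) ^ n" using F(2)[OF \<nu>_pos, of "(1/2)^n" n] by (simp add: w_def[abs_def] f_def)
    have "\<eta> < norm (T (f n))" using F(3)[OF \<nu>_pos, of "(1/2)^n" n] by (simp add: f_def)
    then show "\<eta> < N (f n) (w n)" using N(2)[of "f n"] by (simp add: w_def[abs_def])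
  qed
  have \<nu>_mono: "\<nu> i u \<le> \<nu> n u" if "i \<le> n" "continuous_on UNIV u" "\<And>t. 0 \<le> u t" for i n u
    using that(1)
  proof (induction rule: dec_induct)
    case (step n)
    then show ?case using positive_functionalD(3)[OF N(1) that(2,3), of "f n"] by (simp add: \<nu>_Suc)
  qed simp
  have small: "N (f i) (w n) \<le> (1/2) ^ n" if "i < n" for i n
  proof -
    have "N (f i) (w n) \<le> \<nu> (Suc i) (w n)"
      using positive_functionalD(3)[OF \<nu>_pos w_cont[of n] w(1), of i] by (simp add: \<nu>_Suc)
    also have "\<dots> \<le> \<nu> n (w n)" using that w w_cont by (intro \<nu>_mono) auto
    finally show ?thesis using w(3)[of n] by simp
  qed
  \<comment> \<open>\<open>c i m\<close> is the maximum of \<open>w j\<close> over \<open>i \<le> j \<le> i + m\<close>.\<close>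
  define c where "c i = rec_nat (w i) (\<lambda>m v t. max (v t) (w (i + Suc m) t))" for i
  have c_0: "c i 0 t = w i t" and c_Suc: "c i (Suc m) t = max (c i m t) (w (i + Suc m) t)" for i m t
    by (simp_all add: c_def)
  have c_cont: "continuous_on UNIV (c i m)" for i m
  proof (induction m)
    case 0
    have "c i 0 = w i" by (rule ext) (rule c_0)
    then show ?case using w_cont by simp
  next
    case (Suc m)
    have "c i (Suc m) = (\<lambda>t. max (c i m t) (w (i + Suc m) t))" by (rule ext) (rule c_Suc)
    then show ?case using Suc w_cont by (auto intro!: continuous_intros)
  qed
  have c_bd: "0 \<le> c i m t" "c i m t \<le> 1" "c i m t \<le> (\<Sum>j\<le>m. w (i + j) t)" for i m t
    using w(1)[of _ t] w(2)[of _ t]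
    by (induction m) (auto simp: c_0 c_Suc max_def add_increasing add_increasing2 sum_nonneg)
  have c_mono: "c i m t \<le> c i m' t" if "m \<le> m'" for i m m' t
    using that by (induction rule: dec_induct) (auto simp: c_Suc)
  have c_ge: "w (i + j) t \<le> c i m t" if "j \<le> m" for i j m t
  proof -
    have "w (i + j) t \<le> c i j t" by (cases j) (auto simp: c_0 c_Suc)
    also have "\<dots> \<le> c i m t" by (rule c_mono[OF that])
    finally show ?thesis .
  qed
  have "\<exists>n. \<forall>M g. M \<ge> n \<longrightarrow> (\<forall>t. norm (apply_bcontfun g t) \<le> c i M t - c i n t) \<longrightarrow>
      norm (T g) \<le> \<eta> / 2 ^ (i + 3)" for i
  proof -
    obtain n where "\<And>M g. M \<ge> n \<Longrightarrow> (\<And>t. norm (apply_bcontfun g t) \<le> c i M t - c i n t) \<Longrightarrow>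
        norm (T g) \<le> \<eta> / 2 ^ (i + 3)"
      using exhaustive_increasing[OF ex, of "c i" "\<eta> / 2 ^ (i + 3)"] c_bd c_mono \<eta> by auto
    then show ?thesis by blast
  qed
  then obtain n0 where n0: "\<And>i M g. M \<ge> n0 i \<Longrightarrow>
      (\<And>t. norm (apply_bcontfun g t) \<le> c i M t - c i (n0 i) t) \<Longrightarrow> norm (T g) \<le> \<eta> / 2 ^ (i + 3)"
    by metis
  \<comment> \<open>A continuous stand-in for \<open>sup {w j | j \<ge> i}\<close>, which need not be continuous.\<close>
  define e where "e i = c i (n0 i)" for i
  have e_cont: "continuous_on UNIV (e i)" for i by (simp add: e_def c_cont)
  define a where "a = rec_nat (e 0) (\<lambda>n v t. min (v t) (e (Suc n) t))"
  have a_0: "a 0 t = e 0 t" and a_Suc: "a (Suc n) t = min (a n t) (e (Suc n) t)" for n t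
    by (simp_all add: a_def)
  have a_cont: "continuous_on UNIV (a n)" for n
  proof (induction n)
    case 0
    have "a 0 = e 0" by (rule ext) (rule a_0)
    then show ?case using e_cont by simp
  next
    case (Suc n)
    have "a (Suc n) = (\<lambda>t. min (a n t) (e (Suc n) t))" by (rule ext) (rule a_Suc)
    then show ?case using Suc e_cont by (auto intro!: continuous_intros)
  qed
  have a_bd: "0 \<le> a n t" "a n t \<le> 1" "a n t \<le> e n t" "\<exists>i\<le>n. a n t = e i t" for n t
  proof -
    show "0 \<le> a n t" by (induction n) (auto simp: a_0 a_Suc e_def c_bd)
    show "a n t \<le> 1" by (induction n) (auto simp: a_0 a_Suc e_def c_bd min_def)
    show "a n t \<le> e n t" by (cases n) (auto simp: a_0 a_Suc)
    show "\<exists>i\<le>n. a n t = e i t"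
    proof (induction n)
      case (Suc n)
      then show ?case by (cases "a n t \<le> e (Suc n) t") (auto simp: a_Suc min_def intro: le_SucI)
    qed (simp add: a_0)
  qed
  obtain n where n: "\<And>m g. m \<ge> n \<Longrightarrow> (\<And>t. norm (apply_bcontfun g t) \<le> a n t - a m t) \<Longrightarrow>
      norm (T g) \<le> \<eta> / 4"
    using exhaustive_decreasing[OF ex, of a "\<eta> / 4"] a_bd \<eta> by (auto simp: a_Suc)
  have a_anti: "a m t \<le> a n t" if "n \<le> m" for m t
    using that by (induction rule: dec_induct) (auto simp: a_Suc min_def)
  \<comment> \<open>The part of \<open>w n\<close> that was lost by stopping the \<open>i\<close>-th maximum at \<open>n0 i\<close>.\<close>
  define r where "r i t = max 0 (w n t - e i t)" for i t
  have r_cont: "continuous_on UNIV (r i)" for i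
    unfolding r_def by (intro continuous_intros w_cont e_cont)
  have r_le: "N (f n) (r i) \<le> \<eta> / 2 ^ (i + 3)" if "i \<le> n" for i
  proof (rule N_le)
    fix g :: "'k \<Rightarrow>\<^sub>C 'f" assume g: "\<And>t. norm (apply_bcontfun g t) \<le> r i t"
    show "norm (T g) \<le> \<eta> / 2 ^ (i + 3)"
    proof (rule n0[of i "max (n0 i) (n - i)"])
      fix t
      have "w n t \<le> c i (max (n0 i) (n - i)) t"
        using c_ge[of "n - i" "max (n0 i) (n - i)" i t] that by simp
      moreover have "e i t \<le> c i (max (n0 i) (n - i)) t" unfolding e_def by (rule c_mono) simp
      ultimately have "r i t \<le> c i (max (n0 i) (n - i)) t - e i t" by (simp add: r_def)
      then show "norm (apply_bcontfun g t) \<le> c i (max (n0 i) (n - i)) t - c i (n0 i) t"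
        using g[of t] by (simp add: e_def)
    qed simp
  qed (simp add: r_def)
  have geo: "(\<Sum>i\<le>m. \<eta> / 2 ^ (i + 3)) \<le> \<eta> / 4" for m
  proof -
    have "(\<Sum>i\<le>m. \<eta> / 2 ^ (i + 3)) = \<eta> / 4 - \<eta> / 2 ^ (m + 3)"
    proof (induction m)
      case (Suc m)
      have "\<eta> / 2 ^ (m + 3) = 2 * (\<eta> / 2 ^ (Suc m + 3))"
        by (simp only: add_Suc power_Suc) 
      with Suc show ?case by simp
    qed simp
    then show ?thesis using \<eta> by simp
  qed
  have geo': "(\<Sum>j\<le>k. (1/2::real) ^ (m + j)) = 2 * (1/2) ^ m - (1/2) ^ (m + k)" for m k
    by (induction k) auto
  have main: "\<eta> / 2 < 2 * (1/2) ^ m" if m: "m > n" for m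
  proof -
    have "w n t \<le> a m t + ((a n t - a m t) + (\<Sum>i\<le>n. r i t))" for t
    proof -
      obtain i where i: "i \<le> n" "a n t = e i t" using a_bd(4) by blast
      have "r i t \<le> (\<Sum>i\<le>n. r i t)"
        using i by (intro member_le_sum) (auto simp: r_def)
      then show ?thesis using i by (simp add: r_def)
    qed
    then have "N (f n) (w n) \<le> N (f n) (\<lambda>t. a m t + ((a n t - a m t) + (\<Sum>i\<le>n. r i t)))"
      by (intro positive_functional_mono[OF N(1)] continuous_intros w_cont a_cont r_cont)
    also have "\<dots> = N (f n) (a m) + N (f n) (\<lambda>t. (a n t - a m t) + (\<Sum>i\<le>n. r i t))"
      by (intro positive_functionalD(1)[OF N(1)] continuous_intros w_cont a_cont r_cont)
    also have "N (f n) (\<lambda>t. (a n t - a m t) + (\<Sum>i\<le>n. r i t)) =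
        N (f n) (\<lambda>t. a n t - a m t) + N (f n) (\<lambda>t. \<Sum>i\<le>n. r i t)"
      by (intro positive_functionalD(1)[OF N(1)] continuous_intros w_cont a_cont r_cont)
    also have "N (f n) (\<lambda>t. \<Sum>i\<le>n. r i t) = (\<Sum>i\<le>n. N (f n) (r i))"
      by (intro positive_functional_sum[OF N(1)] r_cont) auto
    finally have "N (f n) (w n) \<le> N (f n) (a m) + (N (f n) (\<lambda>t. a n t - a m t) + (\<Sum>i\<le>n. N (f n) (r i)))" .
    moreover have "(\<Sum>i\<le>n. N (f n) (r i)) \<le> \<eta> / 4"
      using sum_mono[of "{..n}" "\<lambda>i. N (f n) (r i)" "\<lambda>i. \<eta> / 2 ^ (i + 3)"] r_le geo[of n] by force
    moreover have "N (f n) (\<lambda>t. a n t - a m t) \<le> \<eta> / 4"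
      using m n[of m] a_anti[of m] by (intro N_le) auto
    moreover have "N (f n) (a m) \<le> 2 * (1/2) ^ m"
    proof -
      have "N (f n) (a m) \<le> N (f n) (\<lambda>t. \<Sum>j\<le>n0 m. w (m + j) t)"
        using a_bd(3) c_bd(3) unfolding e_def
        by (intro positive_functional_mono[OF N(1)] a_cont continuous_intros w_cont) (meson order_trans)
      also have "\<dots> = (\<Sum>j\<le>n0 m. N (f n) (w (m + j)))"
        by (intro positive_functional_sum[OF N(1)] w_cont) auto
      also have "\<dots> \<le> (\<Sum>j\<le>n0 m. (1/2) ^ (m + j))"
        using m by (intro sum_mono small) auto
      also have "\<dots> \<le> 2 * (1/2) ^ m" by (simp add: geo')
      finally show ?thesis .
    qed
    ultimately show ?thesis using w(4)[of n] by linarith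
  qed
  obtain m where m: "(1/2::real) ^ m < \<eta> / 4"
    using real_arch_pow_inv[of "\<eta> / 4" "1/2"] \<eta> by auto
  have "(1/2::real) ^ (m + Suc n) \<le> (1/2) ^ m" by (rule power_decreasing) auto
  with main[of "m + Suc n"] m show False by simp
qed

text \<open>The counterpart of the theorem of Bartle, Dunford and Schwartz on control measures: normalize the
  functionals of \<open>control_step\<close> for \<open>\<eta> = 1, 1/2, 1/3, \<dots>\<close> and add them with summable weights.\<close>

theorem control_functional:
  fixes T :: "('k::topological_space \<Rightarrow>\<^sub>C 'f::real_normed_vector) \<Rightarrow>\<^sub>L 'y::real_normed_vector"
  assumes K: "compact (UNIV :: 'k set)" and ex: "exhaustive_op T"
  obtains \<nu> where "positive_functional \<nu>" "\<nu> (\<lambda>t. 1) \<le> 1"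
    "\<And>\<eta>. \<eta> > 0 \<Longrightarrow> \<exists>\<rho>>0. \<forall>f. (\<forall>t. norm (apply_bcontfun f t) \<le> 1) \<longrightarrow>
      \<nu> (\<lambda>t. norm (apply_bcontfun f t)) < \<rho> \<longrightarrow> norm (T f) \<le> \<eta>"
proof -
  have "\<exists>\<nu> \<rho>. positive_functional \<nu> \<and> \<rho> > 0 \<and> (\<forall>f. (\<forall>t. norm (apply_bcontfun f t) \<le> 1) \<longrightarrow>
      \<nu> (\<lambda>t. norm (apply_bcontfun f t)) < \<rho> \<longrightarrow> norm (T f) \<le> 1 / real (Suc k))" for k
    using control_step[OF K ex, of "1 / real (Suc k)"] by (metis of_nat_0_less_iff zero_less_Suc zero_less_divide_1_iff)
  then obtain \<nu> \<rho> where \<nu>: "\<And>k. positive_functional (\<nu> k)" and \<rho>: "\<And>k. \<rho> k > (0::real)"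
    and T: "\<And>k f. (\<And>t. norm (apply_bcontfun f t) \<le> 1) \<Longrightarrow>
      \<nu> k (\<lambda>t. norm (apply_bcontfun f t)) < \<rho> k \<Longrightarrow> norm (T f) \<le> 1 / real (Suc k)"
    by metis
  define b where "b k = (1/2) ^ Suc k / (1 + \<nu> k (\<lambda>t. 1))" for k
  have one: "0 \<le> \<nu> k (\<lambda>t. 1)" for k
    by (rule positive_functionalD(3)[OF \<nu>]) (auto intro: continuous_on_const)
  have b: "b k > 0" "b k * \<nu> k (\<lambda>t. 1) \<le> (1/2) ^ Suc k" for k
  proof -
    have p: "1 + \<nu> k (\<lambda>t. 1) > 0" using one[of k] by linarith
    then show "b k > 0" by (simp add: b_def)
    have "\<nu> k (\<lambda>t. 1) / (1 + \<nu> k (\<lambda>t. 1)) \<le> 1" using p by simp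
    from mult_left_mono[OF this, of "(1/2) ^ Suc k"]
    show "b k * \<nu> k (\<lambda>t. 1) \<le> (1/2) ^ Suc k" by (simp add: b_def)
  qed
  have geo: "(\<lambda>k. (1/2) ^ Suc k :: real) sums 1" by (rule power_half_series)
  have sm: "summable (\<lambda>k. b k * \<nu> k u)" if u: "continuous_on UNIV u" for u
  proof -
    obtain c where c: "\<And>t. \<bar>u t\<bar> \<le> c" "c \<ge> 0"
      using continuous_bounded_above[OF K, of "\<lambda>t. \<bar>u t\<bar>"] u continuous_on_rabs by metis
    show ?thesis
    proof (rule summable_comparison_test')
      show "summable (\<lambda>k. c * (1/2) ^ Suc k :: real)"
        using geo by (intro summable_mult) (auto simp: sums_iff)
      show "norm (b k * \<nu> k u) \<le> c * (1/2) ^ Suc k" for k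
      proof -
        have "norm (b k * \<nu> k u) = b k * \<bar>\<nu> k u\<bar>" using b(1)[of k] by (simp add: abs_mult)
        also have "\<dots> \<le> b k * (c * \<nu> k (\<lambda>t. 1))"
          using b(1)[of k] positive_functional_abs_le_const[OF \<nu> u c(1)] by (intro mult_left_mono) auto
        also have "\<dots> \<le> c * (1/2) ^ Suc k"
          using mult_left_mono[OF b(2)[of k] c(2)] by (simp add: algebra_simps)
        finally show ?thesis .
      qed
    qed
  qed
  define N where "N u = (\<Sum>k. b k * \<nu> k u)" for u
  have nn: "0 \<le> \<nu> k u" if "continuous_on UNIV u" "\<And>t. 0 \<le> u t" for k u
    by (rule positive_functionalD(3)[OF \<nu> that])
  have N_ge: "b k * \<nu> k u \<le> N u" if u: "continuous_on UNIV u" "\<And>t. 0 \<le> u t" for k u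
    unfolding N_def
    using sum_le_suminf[OF sm[OF u(1)], of "{k}"] nn[OF u] b(1) by (simp add: less_imp_le)
  show thesis
  proof (rule that[of N])
    show "positive_functional N"
      unfolding positive_functional_def
    proof (intro conjI allI impI)
      fix u v :: "'k \<Rightarrow> real" assume uv: "continuous_on UNIV u" "continuous_on UNIV v"
      have "\<nu> k (\<lambda>t. u t + v t) = \<nu> k u + \<nu> k v" for k by (rule positive_functionalD(1)[OF \<nu> uv])
      then show "N (\<lambda>t. u t + v t) = N u + N v"
        using suminf_add[OF sm[OF uv(1)] sm[OF uv(2)]] by (simp add: N_def algebra_simps)
    next
      fix a :: real and u :: "'k \<Rightarrow> real" assume u: "continuous_on UNIV u"
      have "\<nu> k (\<lambda>t. a * u t) = a * \<nu> k u" for k by (rule positive_functionalD(2)[OF \<nu> u])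
      then show "N (\<lambda>t. a * u t) = a * N u"
        using suminf_mult[OF sm[OF u], of a] by (simp add: N_def algebra_simps)
    next
      fix u :: "'k \<Rightarrow> real" assume u: "continuous_on UNIV u" "\<forall>t. 0 \<le> u t"
      then show "0 \<le> N u"
        unfolding N_def using nn[of u] b(1) by (intro suminf_nonneg sm) (auto simp: less_imp_le)
    qed
    show "N (\<lambda>t. 1) \<le> 1"
      unfolding N_def using geo b(2) by (subst sums_unique[OF geo]) (intro suminf_le sm continuous_on_const, auto simp: sums_iff)
    fix \<eta> :: real assume \<eta>: "\<eta> > 0"
    then obtain k where k: "1 / real (Suc k) < \<eta>" using nat_approx_posE by metis
    show "\<exists>\<rho>>0. \<forall>f. (\<forall>t. norm (apply_bcontfun f t) \<le> 1) \<longrightarrow>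
      N (\<lambda>t. norm (apply_bcontfun f t)) < \<rho> \<longrightarrow> norm (T f) \<le> \<eta>"
    proof (intro exI[of _ "b k * \<rho> k"] conjI allI impI)
      show "b k * \<rho> k > 0" using b(1) \<rho> by simp
      fix f :: "'k \<Rightarrow>\<^sub>C 'f" assume f: "\<forall>t. norm (apply_bcontfun f t) \<le> 1" "N (\<lambda>t. norm (apply_bcontfun f t)) < b k * \<rho> k"
      have "b k * \<nu> k (\<lambda>t. norm (apply_bcontfun f t)) \<le> N (\<lambda>t. norm (apply_bcontfun f t))"
        by (rule N_ge) (auto intro!: continuous_intros)
      then have "\<nu> k (\<lambda>t. norm (apply_bcontfun f t)) < \<rho> k"
        using f(2) b(1)[of k] by (meson le_less_trans mult_less_cancel_left_pos)
      then have "norm (T f) \<le> 1 / real (Suc k)" using f(1) by (intro T) auto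
      then show "norm (T f) \<le> \<eta>" using k by linarith
    qed
  qed
qed

section \<open>Weak topologies over real or complex scalars\<close>

text \<open>Real and complex scalars at once; \<open>cj\<close> is the conjugation. The last assumption says that
  conjugation is the adjoint of multiplication, that is \<open>inner a b = Re (a * cj b)\<close>.\<close>

locale scalar_field =
  fixes cj :: "'f::{real_normed_field,euclidean_space} \<Rightarrow> 'f"
  assumes cj_linear: "linear cj"
    and cj_mult: "cj (a * b) = cj a * cj b"
    and cj_cj: "cj (cj a) = a"
    and cj_norm: "norm (cj a) = norm a"
    and cj_adj: "inner (a * b) c = inner a (cj b * c)"
begin

lemma cj_one: "cj 1 = 1"
proof -
  have "cj 1 \<noteq> 0" using cj_norm[of 1] by auto
  moreover have "cj 1 * cj 1 = cj 1" using cj_mult[of 1 1] by simp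
  ultimately show ?thesis by simp
qed

text \<open>For complex scalars this is \<open>\<rho> x - \<i> \<rho> (\<i> x)\<close>, the complex linear functional with real part \<open>\<rho>\<close>.\<close>

definition scalar_extension :: "('f \<Rightarrow> 'a::real_normed_vector \<Rightarrow> 'a) \<Rightarrow> ('a \<Rightarrow> real) \<Rightarrow> 'a \<Rightarrow> 'f"
  where "scalar_extension s \<rho> x = (\<Sum>b\<in>Basis. \<rho> (s (cj b) x) *\<^sub>R b)"

context
  fixes s :: "'f \<Rightarrow> 'a::real_normed_vector \<Rightarrow> 'a"
  assumes s: "normed_space_over s"
begin

interpretation normed_space_over s by (rule s)

lemma scale_scaleR: "s (r *\<^sub>R a) x = r *\<^sub>R s a x"
proof -
  have "s (of_real r * a) x = s (of_real r) (s a x)" by (simp only: scale_scale)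
  then show ?thesis by (simp only: scale_of_real scaleR_conv_of_real)
qed

lemma inner_scalar_extension:
  assumes "linear \<rho>" shows "inner (scalar_extension s \<rho> x) c = \<rho> (s (cj c) x)"
proof -
  have "s (cj c) x = s (cj (\<Sum>b\<in>Basis. inner c b *\<^sub>R b)) x" by (simp add: euclidean_representation)
  also have "\<dots> = (\<Sum>b\<in>Basis. inner c b *\<^sub>R s (cj b) x)"
    by (simp add: linear_sum[OF cj_linear] linear_cmul[OF cj_linear] scale_sum_left scale_scaleR)
  finally have "\<rho> (s (cj c) x) = (\<Sum>b\<in>Basis. inner c b * \<rho> (s (cj b) x))"
    by (simp add: linear_sum[OF assms] linear_cmul[OF assms])
  then show ?thesis
    by (simp add: scalar_extension_def inner_sum_left inner_commute[of c] mult.commute)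
qed

lemma scalar_extension_linear:
  assumes "linear \<rho>" shows "Vector_Spaces.linear s (*) (scalar_extension s \<rho>)"
proof -
  have vs: "vector_space s" by unfold_locales
  have vf: "vector_space ((*) :: 'f \<Rightarrow> 'f \<Rightarrow> 'f)" by unfold_locales (auto simp: algebra_simps)
  have eqI: "a = b" if "\<And>c. inner a c = inner b c" for a b :: 'f
    using that by (metis inner_commute vector_eq_rdot)
  show ?thesis
    unfolding Vector_Spaces.linear_iff
  proof (intro conjI allI vs vf)
    show "scalar_extension s \<rho> (x + y) = scalar_extension s \<rho> x + scalar_extension s \<rho> y" for x y
      by (simp add: scalar_extension_def scale_right_distrib linear_add[OF assms]
          scaleR_add_left sum.distrib)
    show "scalar_extension s \<rho> (s a x) = a * scalar_extension s \<rho> x" for a x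
    proof (rule eqI)
      fix c
      have "inner (a * scalar_extension s \<rho> x) c = inner (scalar_extension s \<rho> x) (cj a * c)"
        using cj_adj[of "scalar_extension s \<rho> x" a c] by (simp add: mult.commute)
      also have "\<dots> = \<rho> (s (cj c) (s a x))"
        by (simp add: inner_scalar_extension[OF assms] cj_mult cj_cj mult.commute)
      finally show "inner (scalar_extension s \<rho> (s a x)) c = inner (a * scalar_extension s \<rho> x) c"
        by (simp add: inner_scalar_extension[OF assms])
    qed
  qed
qed

text \<open>Rotate \<open>x\<close> by the conjugate of the phase of the value.\<close>

lemma norm_scalar_extension:
  assumes "linear \<rho>"
  obtains c where "norm c = 1" "norm (scalar_extension s \<rho> x) = \<rho> (s c x)"
proof (cases "scalar_extension s \<rho> x = 0")
  case True
  then have "\<rho> (s 1 x) = 0" using inner_scalar_extension[OF assms, of x 1] by (simp add: cj_one)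
  then show thesis using True that[of 1] by simp
next
  case False
  define z where "z = scalar_extension s \<rho> x"
  have "norm (cj (sgn z)) = 1" using False by (simp add: cj_norm z_def norm_sgn)
  moreover have "norm z = \<rho> (s (cj (sgn z)) x)"
    using False unfolding z_def inner_scalar_extension[OF assms, symmetric]
    by (simp add: sgn_div_norm dot_square_norm power2_eq_square)
  ultimately show thesis using that by (simp add: z_def)
qed

lemma scalar_extension_bound:
  assumes "linear \<rho>" "\<And>x. \<rho> x \<le> C * norm x"
  shows "norm (scalar_extension s \<rho> x) \<le> C * norm x"
proof -
  obtain c where "norm c = 1" "norm (scalar_extension s \<rho> x) = \<rho> (s c x)"
    using norm_scalar_extension[OF assms(1)] .
  then show ?thesis using assms(2)[of "s c x"] by (simp add: norm_scale)
qed

lemma linear_over_imp_linear: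
  assumes "Vector_Spaces.linear s (*) f" shows "linear (f :: 'a \<Rightarrow> 'f)"
proof (rule linearI)
  show "f (x + y) = f x + f y" for x y using assms by (simp add: Vector_Spaces.linear_iff)
  show "f (r *\<^sub>R x) = r *\<^sub>R f x" for r x
  proof -
    have "f (s (of_real r) x) = of_real r * f x" using assms by (simp add: Vector_Spaces.linear_iff)
    then show ?thesis by (simp add: scale_of_real scaleR_conv_of_real)
  qed
qed

text \<open>Every real functional is the real part of a scalar functional. Hence the weak topology is the same
  for real and for complex scalars.\<close>

lemma real_functional_extension:
  fixes \<phi> :: "'a \<Rightarrow>\<^sub>L real"
  obtains \<Phi> :: "'a \<Rightarrow>\<^sub>L 'f" where "\<Phi> \<in> bounded_ops s (*)" "\<And>x. blinfun_apply \<phi> x = inner (blinfun_apply \<Phi> x) 1"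
proof -
  have lin: "linear (blinfun_apply \<phi>)" by (simp add: blinfun.bounded_linear_right bounded_linear.linear)
  define \<Phi> where "\<Phi> = scalar_extension s (blinfun_apply \<phi>)"
  have L: "Vector_Spaces.linear s (*) \<Phi>" unfolding \<Phi>_def by (rule scalar_extension_linear[OF lin])
  have "norm (\<Phi> x) \<le> norm \<phi> * norm x" for x
    unfolding \<Phi>_def using lin by (rule scalar_extension_bound) (use norm_blinfun[of \<phi>] in \<open>auto simp: abs_le_iff\<close>)
  then have "bounded_linear \<Phi>"
    using linear_over_imp_linear[OF L]
    by (intro bounded_linear.intro bounded_linear_axioms.intro exI[of _ "norm \<phi>"]) (auto simp: mult.commute)
  then have ap: "blinfun_apply (Blinfun \<Phi>) = \<Phi>" by (rule bounded_linear_Blinfun_apply)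
  show thesis
  proof (rule that[of "Blinfun \<Phi>"])
    show "Blinfun \<Phi> \<in> bounded_ops s (*)" using L by (simp add: bounded_ops_def ap)
    show "blinfun_apply \<phi> x = inner (blinfun_apply (Blinfun \<Phi>) x) 1" for x
      unfolding ap unfolding \<Phi>_def inner_scalar_extension[OF lin] cj_one by simp
  qed
qed

lemma topspace_weak: "topspace (weak_topology s) = UNIV"
proof -
  have vs: "vector_space s" by unfold_locales
  have vf: "vector_space ((*) :: 'f \<Rightarrow> 'f \<Rightarrow> 'f)" by unfold_locales (auto simp: algebra_simps)
  have "(0 :: 'a \<Rightarrow>\<^sub>L 'f) \<in> bounded_ops s (*)"
    by (simp add: bounded_ops_def Vector_Spaces.linear_iff vs vf)
  then have "blinfun_apply (0 :: 'a \<Rightarrow>\<^sub>L 'f) -` UNIV \<in> {blinfun_apply \<phi> -` U | \<phi> U. \<phi> \<in> bounded_ops s (*) \<and> open U}"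
    using open_UNIV by blast
  then show ?thesis by (auto simp: weak_topology_def)
qed

lemma weak_open_vimage:
  assumes "\<phi> \<in> bounded_ops s (*)" "open U"
  shows "openin (weak_topology s) (blinfun_apply \<phi> -` U)"
  unfolding weak_topology_def using assms by (intro topology_generated_by_Basis) blast

lemma weak_open_real:
  fixes \<phi> :: "'a \<Rightarrow>\<^sub>L real"
  assumes "open U" shows "openin (weak_topology s) (blinfun_apply \<phi> -` U)"
proof -
  obtain \<Phi> :: "'a \<Rightarrow>\<^sub>L 'f" where \<Phi>: "\<Phi> \<in> bounded_ops s (*)" "\<And>x. blinfun_apply \<phi> x = inner (blinfun_apply \<Phi> x) 1"
    using real_functional_extension by metis
  have "open ((\<lambda>z :: 'f. inner z 1) -` U)"
    using assms by (intro open_vimage continuous_intros)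
  from weak_open_vimage[OF \<Phi>(1) this] show ?thesis by (simp add: vimage_def \<Phi>(2))
qed

lemma weak_Hausdorff: "Hausdorff_space (weak_topology s)"
  unfolding Hausdorff_space_def
proof (intro allI impI, elim conjE)
  fix x y :: 'a assume "x \<noteq> y"
  obtain \<phi> :: "'a \<Rightarrow>\<^sub>L real" where "blinfun_apply \<phi> (x - y) = norm (x - y)"
    using norming_functional by metis
  then have "\<phi> x - \<phi> y \<noteq> 0" using \<open>x \<noteq> y\<close> unfolding blinfun.diff_right by simp
  then have "\<phi> x \<noteq> \<phi> y" by simp
  then obtain U V where "open U" "open V" "\<phi> x \<in> U" "\<phi> y \<in> V" "U \<inter> V = {}"
    using hausdorff by metis
  then show "\<exists>U V. openin (weak_topology s) U \<and> openin (weak_topology s) V \<and> x \<in> U \<and> y \<in> V \<and> disjnt U V"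
    using weak_open_real[of U \<phi>] weak_open_real[of V \<phi>]
    by (intro exI[of _ "blinfun_apply \<phi> -` U"] exI[of _ "blinfun_apply \<phi> -` V"]) (auto simp: disjnt_def)
qed

lemma weak_open_imp_open: "openin (weak_topology s) U \<Longrightarrow> open U"
proof -
  assume "openin (weak_topology s) U"
  then have "generate_topology_on {blinfun_apply \<phi> -` U | \<phi> U. \<phi> \<in> bounded_ops s (*) \<and> open U} U"
    unfolding weak_topology_def by (rule openin_topology_generated_by)
  then show "open U"
    by induction (auto intro!: open_vimage blinfun.continuous_on continuous_intros)
qed

lemma weak_closed_imp_closed: "closedin (weak_topology s) A \<Longrightarrow> closed A"
  using weak_open_imp_open[of "- A"] by (simp add: closedin_def topspace_weak Compl_eq_Diff_UNIV closed_def)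

text \<open>The weak closures of the tails have the finite intersection property. The conclusion is stated for one real
  functional at a time, which is all that \<open>unconditional_terms_null\<close> asks for.\<close>

lemma weak_cluster_point:
  fixes y :: "nat \<Rightarrow> 'a"
  assumes D: "compactin (weak_topology s) (weak_topology s closure_of A)" and y: "\<And>n. y n \<in> A"
  obtains x where "\<And>(\<phi> :: 'a \<Rightarrow>\<^sub>L real) \<epsilon> N. \<epsilon> > 0 \<Longrightarrow> \<exists>n\<ge>N. \<bar>\<phi> (y n) - \<phi> x\<bar> < \<epsilon>"
proof -
  define C where "C N = weak_topology s closure_of (y ` {N..})" for N :: nat
  have "\<exists>x. x \<in> weak_topology s closure_of A \<inter> \<Inter>(range C)"
  proof -
    have "weak_topology s closure_of A \<inter> \<Inter>F \<noteq> {}" if F: "finite F" "F \<subseteq> range C" for F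
    proof -
      obtain I where I: "finite I" "F = C ` I" using F by (meson finite_subset_image)
      obtain m where m: "\<And>N. N \<in> I \<Longrightarrow> N \<le> m" using I(1) finite_nat_set_iff_bounded_le by metis
      have "y m \<in> C N" if "N \<in> I" for N
        unfolding C_def using m[OF that] by (intro subsetD[OF closure_of_subset]) (auto simp: topspace_weak)
      moreover have "y m \<in> weak_topology s closure_of A"
        using y by (intro subsetD[OF closure_of_subset]) (auto simp: topspace_weak)
      ultimately show ?thesis using I by auto
    qed
    moreover have "\<forall>B\<in>range C. closedin (weak_topology s) B" by (auto simp: C_def)
    ultimately show ?thesis using D unfolding compactin_fip by blast
  qed
  then obtain x where x: "\<And>N. x \<in> C N" by blast
  have "\<exists>n\<ge>N. \<bar>\<phi> (y n) - \<phi> x\<bar> < \<epsilon>" if "\<epsilon> > 0" for \<phi> :: "'a \<Rightarrow>\<^sub>L real" and \<epsilon> N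
  proof -
    have "openin (weak_topology s) (blinfun_apply \<phi> -` ball (\<phi> x) \<epsilon>)" by (rule weak_open_real) simp
    moreover have "x \<in> blinfun_apply \<phi> -` ball (\<phi> x) \<epsilon>" using that by simp
    ultimately obtain z where "z \<in> y ` {N..}" "z \<in> blinfun_apply \<phi> -` ball (\<phi> x) \<epsilon>"
      using x[of N] unfolding C_def in_closure_of by metis
    then show ?thesis by (auto simp: dist_real_def abs_minus_commute)
  qed
  then show thesis using that by blast
qed

text \<open>A continuous image of \<open>D\<close> times a closed disc; closed because the weak topology is Hausdorff.\<close>

lemma weakly_compact_add_line:
  fixes C :: real
  assumes D: "compactin (weak_topology s) D"
    and D': "D' = (\<lambda>(d, c). d + s c e) ` (D \<times> cball 0 C)"
  shows "compactin (weak_topology s) D'" "closedin (weak_topology s) D'"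
proof -
  have "continuous_map (prod_topology (weak_topology s) (euclidean :: 'f topology)) (weak_topology s)
      (\<lambda>(d, c). d + s c e)"
    unfolding weak_topology_def[of s, THEN arg_cong, of "\<lambda>W. continuous_map _ W _"]
  proof (rule continuous_on_generated_topo)
    fix U assume "U \<in> {blinfun_apply \<phi> -` U | \<phi> U. \<phi> \<in> bounded_ops s (*) \<and> open U}"
    then obtain \<phi> V where \<phi>: "\<phi> \<in> bounded_ops s (*)" "open V" "U = blinfun_apply \<phi> -` V" by blast
    have "continuous_map (weak_topology s) euclidean (blinfun_apply \<phi>)"
      using weak_open_vimage[OF \<phi>(1)] by (auto simp: continuous_map_def topspace_weak vimage_def)
    then have 1: "continuous_map (prod_topology (weak_topology s) euclidean) euclidean (blinfun_apply \<phi> \<circ> fst)"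
      by (intro continuous_map_compose[OF continuous_map_fst])
    have "continuous_map euclidean euclidean (\<lambda>c. c * \<phi> e)"
      by (simp add: continuous_map_iff_continuous2) (intro continuous_intros)
    then have 2: "continuous_map (prod_topology (weak_topology s) euclidean) euclidean ((\<lambda>c. c * \<phi> e) \<circ> snd)"
      by (intro continuous_map_compose[OF continuous_map_snd])
    have "continuous_map (prod_topology (weak_topology s) euclidean) euclidean
        (\<lambda>p. (blinfun_apply \<phi> \<circ> fst) p + ((\<lambda>c. c * \<phi> e) \<circ> snd) p)"
      using 1 2 by (rule continuous_map_add)
    from openin_continuous_map_preimage[OF this, of V] \<phi>(2)
    have "openin (prod_topology (weak_topology s) euclidean)
        {p \<in> UNIV. \<phi> (fst p) + snd p * \<phi> e \<in> V}" by (simp add: topspace_weak)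
    moreover have "blinfun_apply \<phi> (d + s c e) = \<phi> d + c * \<phi> e" for d c
      using \<phi>(1) by (simp add: bounded_ops_def Vector_Spaces.linear_iff)
    ultimately show "openin (prod_topology (weak_topology s) euclidean)
        ((\<lambda>(d, c). d + s c e) -` U \<inter> topspace (prod_topology (weak_topology s) euclidean))"
      by (simp add: \<phi>(3) topspace_weak vimage_def case_prod_unfold)
  qed (use topspace_weak in \<open>simp add: weak_topology_def\<close>)
  moreover have "compactin (prod_topology (weak_topology s) euclidean) (D \<times> cball (0::'f) C)"
    using D by (simp add: compactin_Times)
  ultimately show "compactin (weak_topology s) D'"
    unfolding D' by (rule image_compactin[rotated])
  then show "closedin (weak_topology s) D'" by (rule compactin_imp_closedin[OF weak_Hausdorff])
qed

end

text \<open>The partial sums of \<open>T (k n)\<close>, in any order, are images of functions in the unit ball, so weak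
  compactness provides the cluster points.\<close>

lemma weakly_compact_imp_exhaustive:
  fixes T :: "('k::topological_space \<Rightarrow>\<^sub>C 'f) \<Rightarrow>\<^sub>L 'y::real_normed_vector"
    and sY :: "'f \<Rightarrow> 'y \<Rightarrow> 'y"
  assumes sY: "normed_space_over sY" and T: "T \<in> weakly_compact_ops sX sY"
  shows "exhaustive_op T"
  unfolding exhaustive_op_def
proof (intro allI impI)
  fix k :: "nat \<Rightarrow> 'k \<Rightarrow>\<^sub>C 'f" assume k: "\<forall>n t. (\<Sum>i<n. norm (apply_bcontfun (k i) t)) \<le> 1"
  have D: "compactin (weak_topology sY) (weak_topology sY closure_of (blinfun_apply T ` cball 0 1))"
    using T by (simp add: weakly_compact_ops_def)
  have ap_sum: "apply_bcontfun (\<Sum>j\<in>F. g j) t = (\<Sum>j\<in>F. apply_bcontfun (g j) t)"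
    for F :: "nat set" and g :: "nat \<Rightarrow> 'k \<Rightarrow>\<^sub>C 'f" and t
    by (induction F rule: infinite_finite_induct) auto
  have bd: "norm (\<Sum>j\<in>F. c j *\<^sub>R k j) \<le> 1" if F: "finite F" and c: "\<And>j. \<bar>c j\<bar> \<le> 1" for F c
  proof (rule norm_bound)
    fix t
    obtain n where n: "F \<subseteq> {..<n}" using F finite_nat_iff_bounded by blast
    have "norm (apply_bcontfun (\<Sum>j\<in>F. c j *\<^sub>R k j) t) \<le> (\<Sum>j\<in>F. \<bar>c j\<bar> * norm (apply_bcontfun (k j) t))"
      unfolding ap_sum by (rule order_trans[OF norm_sum]) simp
    also have "\<dots> \<le> (\<Sum>j\<in>F. norm (apply_bcontfun (k j) t))"
      using c by (intro sum_mono mult_left_le_one_le) auto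
    also have "\<dots> \<le> (\<Sum>j<n. norm (apply_bcontfun (k j) t))" using n by (intro sum_mono2) auto
    also have "\<dots> \<le> 1" using k by blast
    finally show "norm (apply_bcontfun (\<Sum>j\<in>F. c j *\<^sub>R k j) t) \<le> 1" .
  qed
  show "(\<lambda>n. T (k n)) \<longlonglongrightarrow> 0"
  proof (rule unconditional_terms_null[where C = "norm T"])
    fix F :: "nat set" and c :: "nat \<Rightarrow> real" assume Fc: "finite F" "\<And>j. \<bar>c j\<bar> \<le> 1"
    have "(\<Sum>j\<in>F. c j *\<^sub>R T (k j)) = T (\<Sum>j\<in>F. c j *\<^sub>R k j)"
      by (simp add: blinfun.sum_right blinfun.scaleR_right)
    also have "norm \<dots> \<le> norm T * norm (\<Sum>j\<in>F. c j *\<^sub>R k j)" by (rule norm_blinfun)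
    also have "\<dots> \<le> norm T * 1" using bd[OF Fc] by (intro mult_left_mono) auto
    finally show "norm (\<Sum>j\<in>F. c j *\<^sub>R T (k j)) \<le> norm T" by simp
  next
    fix r :: "nat \<Rightarrow> nat" assume r: "inj r"
    have "(\<Sum>i<n. T (k (r i))) \<in> blinfun_apply T ` cball 0 1" for n
    proof -
      have "(\<Sum>i<n. k (r i)) = (\<Sum>j\<in>r ` {..<n}. 1 *\<^sub>R k j)"
        using r by (subst sum.reindex) (auto simp: inj_on_def)
      then have "norm (\<Sum>i<n. k (r i)) \<le> 1" using bd[of "r ` {..<n}" "\<lambda>_. 1"] by simp
      then show ?thesis
        by (intro image_eqI[of _ _ "\<Sum>i<n. k (r i)"]) (auto simp: blinfun.sum_right)
    qed
    then obtain x where "\<And>(\<phi> :: 'y \<Rightarrow>\<^sub>L real) \<epsilon> N. \<epsilon> > 0 \<Longrightarrow> \<exists>n\<ge>N. \<bar>\<phi> (\<Sum>i<n. T (k (r i))) - \<phi> x\<bar> < \<epsilon>"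
      using weak_cluster_point[OF sY D, of "\<lambda>n. \<Sum>i<n. T (k (r i))"] by metis
    then show "\<exists>x. \<forall>\<phi> :: 'y \<Rightarrow>\<^sub>L real. \<forall>\<epsilon>>0. \<forall>N. \<exists>n\<ge>N.
      \<bar>blinfun_apply \<phi> (\<Sum>i<n. T (k (r i))) - blinfun_apply \<phi> x\<bar> < \<epsilon>" by blast
  qed
qed

text \<open>Weak compactness only depends on the image of the ball. Here it lies in the set of
  \<open>weakly_compact_add_line\<close>, which is also norm closed.\<close>

lemma weakly_compact_near_rank_one:
  fixes T S T1 :: "'a::real_normed_vector \<Rightarrow>\<^sub>L 'y::real_normed_vector"
    and sX :: "'f \<Rightarrow> 'a \<Rightarrow> 'a" and sY :: "'f \<Rightarrow> 'y \<Rightarrow> 'y"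
  assumes sY: "normed_space_over sY" and T: "T \<in> weakly_compact_ops sX sY" and S: "S \<in> bounded_ops sX sY"
    and T1: "\<And>f. T1 f = T f + sY (\<psi> f) e" and \<psi>: "\<And>f. norm (\<psi> f) \<le> C * norm f"
    and sub: "blinfun_apply S ` cball 0 1 \<subseteq> closure (blinfun_apply T1 ` cball 0 1)"
  shows "S \<in> weakly_compact_ops sX sY"
proof -
  let ?W = "weak_topology sY"
  define D where "D = ?W closure_of (blinfun_apply T ` cball 0 1)"
  have D: "compactin ?W D" using T by (simp add: weakly_compact_ops_def D_def)
  have TD: "blinfun_apply T ` cball 0 1 \<subseteq> D"
    unfolding D_def by (rule closure_of_subset) (simp add: topspace_weak[OF sY])
  define D' where "D' = (\<lambda>(d, c). d + sY c e) ` (D \<times> cball 0 \<bar>C\<bar>)"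
  have D': "compactin ?W D'" "closedin ?W D'"
    using weakly_compact_add_line[OF sY D D'_def] by auto
  have "T1 f \<in> D'" if "f \<in> cball 0 1" for f
  proof -
    have "norm (\<psi> f) \<le> \<bar>C\<bar> * norm f" using \<psi>[of f] by (meson abs_ge_self mult_right_mono norm_ge_zero order_trans)
    also have "\<dots> \<le> \<bar>C\<bar>" using that by (simp add: mult_left_le)
    finally have "norm (\<psi> f) \<le> \<bar>C\<bar>" .
    moreover have "T f \<in> D" using TD that by blast
    ultimately show ?thesis unfolding D'_def by (intro image_eqI[of _ _ "(T f, \<psi> f)"]) (auto simp: T1)
  qed
  then have "closure (blinfun_apply T1 ` cball 0 1) \<subseteq> D'"
    using weak_closed_imp_closed[OF sY D'(2)] by (intro closure_minimal) auto
  with sub have "?W closure_of (blinfun_apply S ` cball 0 1) \<subseteq> D'"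
    by (intro closure_of_minimal D') auto
  then have "compactin ?W (?W closure_of (blinfun_apply S ` cball 0 1))"
    using D'(1) by (intro closed_compactin[OF D'(1)]) auto
  then show ?thesis using S by (simp add: weakly_compact_ops_def)
qed

end

section \<open>An Egorov theorem for operators on C(K)\<close>

lemma scale_fun_simps:
  assumes K: "compact (UNIV :: 'k::topological_space set)" and u: "continuous_on UNIV (u :: 'k \<Rightarrow> real)"
  shows "scale_fun u (f + g) = scale_fun u f + scale_fun u g"
    and "scale_fun u (f - g) = scale_fun u f - scale_fun u g"
    and "scale_fun u (c *\<^sub>R f) = c *\<^sub>R scale_fun u f"
  by (rule bcontfun_eqI, simp add: apply_scale_fun[OF K u] algebra_simps)+

lemma norm_scale_fun_le:
  assumes K: "compact (UNIV :: 'k::topological_space set)" and u: "continuous_on UNIV (u :: 'k \<Rightarrow> real)"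
    and u1: "\<And>t. \<bar>u t\<bar> \<le> 1"
  shows "norm (scale_fun u f) \<le> norm f"
proof (rule norm_bound)
  fix t
  have "\<bar>u t\<bar> * norm (apply_bcontfun f t) \<le> 1 * norm f"
    using u1 norm_bounded by (intro mult_mono) auto
  then show "norm (apply_bcontfun (scale_fun u f) t) \<le> norm f" by (simp add: apply_scale_fun[OF K u])
qed

text \<open>Needed in spaces that may be incomplete, where absolute convergence of the increments gives only
  the Cauchy property.\<close>

lemma Cauchy_of_geometric:
  fixes x :: "nat \<Rightarrow> 'a::real_normed_vector"
  assumes C: "C \<ge> 0" and tail: "\<And>n m. n \<le> m \<Longrightarrow> norm (x m - x n) \<le> C * (1/2) ^ n"
  shows "Cauchy x"
proof (rule metric_CauchyI)
  fix e :: real assume e: "e > 0"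
  have "(\<lambda>n. C * (1/2) ^ n) \<longlonglongrightarrow> C * 0" by (intro tendsto_intros LIMSEQ_power_zero) simp
  then have "(\<lambda>n. C * (1/2) ^ n) \<longlonglongrightarrow> 0" by simp
  from order_tendstoD(2)[OF this, of "e / 2"] e obtain N where N: "C * (1/2) ^ N < e / 2"
    by (auto simp: eventually_sequentially)
  have "dist (x m) (x n) < e" if "m \<ge> N" "n \<ge> N" for m n
  proof -
    have "dist (x m) (x n) \<le> dist (x m) (x N) + dist (x n) (x N)" by (rule dist_triangle2)
    then show ?thesis using tail[OF that(1)] tail[OF that(2)] N unfolding dist_norm by linarith
  qed
  then show "\<exists>M. \<forall>m\<ge>M. \<forall>n\<ge>M. dist (x m) (x n) < e" by blast
qed

text \<open>Completeness of the space of bounded continuous functions over an arbitrary topological space.\<close>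

lemma bcontfun_Cauchy_convergent:
  fixes x :: "nat \<Rightarrow> ('k::topological_space \<Rightarrow>\<^sub>C 'b::complete_space)"
  assumes "Cauchy x" shows "convergent x"
proof -
  have "uniformly_Cauchy_on UNIV (\<lambda>n t. apply_bcontfun (x n) t)"
    using assms unfolding uniformly_Cauchy_on_def Cauchy_def
    by (meson UNIV_I dist_fun_lt_imp_dist_val_lt)
  then obtain g where "uniform_limit UNIV (\<lambda>n t. apply_bcontfun (x n) t) g sequentially"
    using Cauchy_uniformly_convergent uniformly_convergent_on_def by blast
  then show ?thesis
    using uniform_limit_bcontfunE[of x g sequentially] sequentially_bot convergentI by metis
qed

text \<open>The cut-off \<open>u n\<close> is a product of factors \<open>1 - w i\<close>, where \<open>w i = 1\<close> wherever the increment
  \<open>f (i + 1) - f i\<close> is at least \<open>1/2\<^sup>i\<close>; as \<open>\<nu> (w i)\<close> is tiny, cutting off costs \<open>T\<close> little. The continuous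
  limit \<open>x\<close> is built by moving towards \<open>f (i + 1)\<close> by at most \<open>1/2\<^sup>i\<close> at each point. These moves are convex
  combinations, so they respect the unit ball and the value at \<open>t0\<close>, they converge uniformly, and where
  \<open>u n\<close> does not vanish they have never been truncated, so that there the \<open>n\<close>-th stage is \<open>f n\<close>.\<close>

lemma Egorov_localization:
  fixes T :: "('k::topological_space \<Rightarrow>\<^sub>C 'f::{real_normed_field,euclidean_space}) \<Rightarrow>\<^sub>L 'y::real_normed_vector"
    and f :: "nat \<Rightarrow> ('k \<Rightarrow>\<^sub>C 'f)"
  assumes K: "compact (UNIV :: 'k set)" and \<nu>: "positive_functional \<nu>"
    and f: "\<And>n. norm (f n) \<le> 1" "\<And>n. apply_bcontfun (f n) t0 = 1"
    and \<epsilon>: "\<epsilon> \<ge> 0"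
    and T: "\<And>n g. norm g \<le> 1 \<Longrightarrow> \<nu> (\<lambda>t. norm (apply_bcontfun g t) ^ 2) < r n \<Longrightarrow> norm (T g) \<le> \<epsilon> * (1/2) ^ Suc n"
    and fast: "\<And>n. 4 ^ n * \<nu> (\<lambda>t. norm (apply_bcontfun (f (Suc n)) t - apply_bcontfun (f n) t) ^ 2) < r n"
  obtains u x where "\<And>n. continuous_on UNIV (u n)" "\<And>n t. 0 \<le> u n t" "\<And>n t. u n t \<le> (1::real)"
    "\<And>g. Cauchy (\<lambda>n. T (scale_fun (u n) g))" "\<And>n g. norm (T g - T (scale_fun (u n) g)) \<le> \<epsilon> * norm g"
    "norm x \<le> 1" "apply_bcontfun x t0 = 1" "(\<lambda>n. scale_fun (u n) (x - f n)) \<longlonglongrightarrow> 0"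
proof -
  let ?d = "\<lambda>n t. apply_bcontfun (f (Suc n)) t - apply_bcontfun (f n) t"
  define w where "w n t = min 1 (4 ^ n * norm (?d n t) ^ 2)" for n t
  have w: "0 \<le> w n t" "w n t \<le> 1" for n t by (auto simp: w_def)
  have w_cont: "continuous_on UNIV (w n)" for n
    unfolding w_def by (intro continuous_intros continuous_on_apply_bcontfun)
  have \<nu>w: "\<nu> (w n) < r n" for n
  proof -
    have c: "continuous_on UNIV (\<lambda>t. norm (?d n t) ^ 2)" by (intro continuous_intros continuous_on_apply_bcontfun)
    have "\<nu> (w n) \<le> \<nu> (\<lambda>t. 4 ^ n * norm (?d n t) ^ 2)"
      by (rule positive_functional_mono[OF \<nu> w_cont]) (intro continuous_intros c, simp add: w_def)
    also have "\<dots> = 4 ^ n * \<nu> (\<lambda>t. norm (?d n t) ^ 2)" by (rule positive_functionalD(2)[OF \<nu> c])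
    also have "\<dots> < r n" by (rule fast)
    finally show ?thesis .
  qed
  define u where "u n t = (\<Prod>i<n. 1 - w i t)" for n t
  have u_Suc: "u (Suc n) t = u n t * (1 - w n t)" for n t by (simp add: u_def)
  have u: "0 \<le> u n t" "u n t \<le> 1" for n t
    unfolding u_def using w by (auto intro!: prod_nonneg prod_le_1)
  have u_cont: "continuous_on UNIV (u n)" for n
    unfolding u_def by (intro continuous_intros w_cont)
  have step1: "norm (T (scale_fun (u (Suc n)) g) - T (scale_fun (u n) g)) \<le> \<epsilon> * (1/2) ^ Suc n"
    if g: "norm g \<le> 1" for n g
  proof -
    define v where "v t = u n t * w n t" for t
    have v_cont: "continuous_on UNIV v" unfolding v_def by (intro continuous_intros u_cont w_cont)
    have v: "0 \<le> v t" "v t \<le> w n t" for t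
      using u[of n t] w[of n t] mult_left_le_one_le[of "w n t" "u n t"] by (auto simp: v_def)
    have v1: "v t \<le> 1" for t using v(2)[of t] w(2)[of n t] by linarith
    have "norm (T (scale_fun v g)) \<le> \<epsilon> * (1/2) ^ Suc n"
    proof (rule T)
      show "norm (scale_fun v g) \<le> 1"
        using norm_scale_fun_le[OF K v_cont, of g] v v1 g by (simp add: abs_of_nonneg) 
      have "\<nu> (\<lambda>t. norm (apply_bcontfun (scale_fun v g) t) ^ 2) \<le> \<nu> (w n)"
      proof (rule positive_functional_mono[OF \<nu> _ w_cont])
        show "continuous_on UNIV (\<lambda>t. norm (apply_bcontfun (scale_fun v g) t) ^ 2)"
          by (intro continuous_intros continuous_on_apply_bcontfun)
        fix t
        have gt: "norm (apply_bcontfun g t) \<le> 1" using norm_bounded[of g t] g by linarith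
        then have "v t * norm (apply_bcontfun g t) \<le> v t" using v(1)[of t] by (simp add: mult_left_le)
        then have le: "v t * norm (apply_bcontfun g t) \<le> w n t" using v(2)[of t] by linarith
        have "(v t * norm (apply_bcontfun g t)) ^ 2 \<le> v t * norm (apply_bcontfun g t)"
          using v(1)[of t] le w(2)[of n t] by (simp add: power2_eq_square mult_left_le)
        then show "norm (apply_bcontfun (scale_fun v g) t) ^ 2 \<le> w n t"
          using le v(1)[of t] by (simp add: apply_scale_fun[OF K v_cont])
      qed
      then show "\<nu> (\<lambda>t. norm (apply_bcontfun (scale_fun v g) t) ^ 2) < r n" using \<nu>w[of n] by linarith
    qed
    moreover have "scale_fun (u n) g - scale_fun (u (Suc n)) g = scale_fun v g"
      by (rule bcontfun_eqI)
        (simp add: apply_scale_fun[OF K u_cont] apply_scale_fun[OF K v_cont] v_def u_Suc algebra_simps)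
    ultimately show ?thesis by (subst norm_minus_commute) (simp add: blinfun.diff_right[symmetric])
  qed
  have step: "norm (T (scale_fun (u (Suc n)) g) - T (scale_fun (u n) g)) \<le> \<epsilon> * (1/2) ^ Suc n * norm g" for n g
  proof (cases "g = 0")
    case True
    have "scale_fun (u m) (0 *\<^sub>R g) = 0 *\<^sub>R scale_fun (u m) g" for m
      by (rule scale_fun_simps(3)[OF K u_cont])
    then show ?thesis using True by (simp add: blinfun.zero_right)
  next
    case False
    let ?g = "inverse (norm g) *\<^sub>R g"
    have "norm (T (scale_fun (u (Suc n)) ?g) - T (scale_fun (u n) ?g)) \<le> \<epsilon> * (1/2) ^ Suc n"
      using False by (intro step1) simp
    moreover have "T (scale_fun (u (Suc n)) ?g) - T (scale_fun (u n) ?g) =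
        inverse (norm g) *\<^sub>R (T (scale_fun (u (Suc n)) g) - T (scale_fun (u n) g))"
      by (simp add: scale_fun_simps(3)[OF K u_cont] blinfun.scaleR_right scaleR_diff_right)
    ultimately have "inverse (norm g) * norm (T (scale_fun (u (Suc n)) g) - T (scale_fun (u n) g)) \<le> \<epsilon> * (1/2) ^ Suc n"
      by simp
    from mult_left_mono[OF this, of "norm g"] False show ?thesis by (simp add: mult.assoc[symmetric] mult.commute)
  qed
  have tail: "norm (T (scale_fun (u m) g) - T (scale_fun (u n) g)) \<le> \<epsilon> * ((1/2) ^ n - (1/2) ^ m) * norm g"
    if "n \<le> m" for n m g
    using that
  proof (induction rule: dec_induct)
    case (step m)
    have "norm (T (scale_fun (u (Suc m)) g) - T (scale_fun (u n) g)) \<le>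
        norm (T (scale_fun (u (Suc m)) g) - T (scale_fun (u m) g)) + norm (T (scale_fun (u m) g) - T (scale_fun (u n) g))"
      using norm_triangle_ineq[of "T (scale_fun (u (Suc m)) g) - T (scale_fun (u m) g)"
          "T (scale_fun (u m) g) - T (scale_fun (u n) g)"] by simp
    also have "\<dots> \<le> \<epsilon> * (1/2) ^ Suc m * norm g + \<epsilon> * ((1/2) ^ n - (1/2) ^ m) * norm g"
      by (intro add_mono step.IH \<open>\<And>n g. norm (T (scale_fun (u (Suc n)) g) - T (scale_fun (u n) g)) \<le> \<epsilon> * (1/2) ^ Suc n * norm g\<close>)
    also have "\<dots> = \<epsilon> * ((1/2) ^ n - (1/2) ^ Suc m) * norm g" by (simp add: algebra_simps)
    finally show ?case .
  qed simp
  have u0: "scale_fun (u 0) g = g" for g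
    by (rule bcontfun_eqI) (simp add: apply_scale_fun[OF K u_cont] u_def[of 0])
  define x where "x = rec_nat (f 0) (\<lambda>n y. Bcontfun (\<lambda>t. apply_bcontfun y t +
    ((1/2) ^ n / max ((1/2) ^ n) (norm (apply_bcontfun (f (Suc n)) t - apply_bcontfun y t))) *\<^sub>R
      (apply_bcontfun (f (Suc n)) t - apply_bcontfun y t)))"
  \<comment> \<open>The fraction of the way from \<open>x n\<close> to \<open>f (Suc n)\<close> that respects the step bound \<open>1/2\<^sup>n\<close>.\<close>
  define l where "l n t = (1/2) ^ n / max ((1/2) ^ n) (norm (apply_bcontfun (f (Suc n)) t - apply_bcontfun (x n) t))" for n t
  have mx: "max ((1/2::real) ^ n) b > 0" for n b by (simp add: less_max_iff_disj)
  have l: "0 \<le> l n t" "l n t \<le> 1" for n t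
  proof -
    show "0 \<le> l n t" unfolding l_def by (intro divide_nonneg_pos mx) simp
    show "l n t \<le> 1" unfolding l_def using mx by (subst pos_divide_le_eq) auto
  qed
  have x_0: "x 0 = f 0" by (simp add: x_def)
  have x_Suc: "apply_bcontfun (x (Suc n)) t = apply_bcontfun (x n) t + l n t *\<^sub>R (apply_bcontfun (f (Suc n)) t - apply_bcontfun (x n) t)" for n t
  proof -
    have "continuous_on UNIV (l n)"
      unfolding l_def using mx[of n] by (intro continuous_intros continuous_on_apply_bcontfun) (simp add: less_imp_neq[symmetric])
    then have "continuous_on UNIV (\<lambda>t. apply_bcontfun (x n) t + l n t *\<^sub>R (apply_bcontfun (f (Suc n)) t - apply_bcontfun (x n) t))"
      by (intro continuous_intros continuous_on_apply_bcontfun)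
    moreover have "x (Suc n) = Bcontfun (\<lambda>t. apply_bcontfun (x n) t + l n t *\<^sub>R (apply_bcontfun (f (Suc n)) t - apply_bcontfun (x n) t))"
      by (simp add: x_def l_def)
    ultimately show ?thesis by (simp add: apply_Bcontfun[OF K])
  qed
  have x_norm: "norm (x n) \<le> 1" for n
  proof (induction n)
    case (Suc n)
    show ?case
    proof (rule norm_bound)
      fix t
      have "apply_bcontfun (x (Suc n)) t = (1 - l n t) *\<^sub>R apply_bcontfun (x n) t + l n t *\<^sub>R apply_bcontfun (f (Suc n)) t"
        by (simp add: x_Suc algebra_simps)
      then have "norm (apply_bcontfun (x (Suc n)) t) \<le> (1 - l n t) * norm (apply_bcontfun (x n) t) + l n t * norm (apply_bcontfun (f (Suc n)) t)"
        using l[of n t] norm_triangle_ineq[of "(1 - l n t) *\<^sub>R apply_bcontfun (x n) t" "l n t *\<^sub>R apply_bcontfun (f (Suc n)) t"] by simp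
      also have "\<dots> \<le> (1 - l n t) * 1 + l n t * 1"
        using l[of n t] order_trans[OF norm_bounded Suc] order_trans[OF norm_bounded f(1)]
        by (intro add_mono mult_left_mono) auto
      finally show "norm (apply_bcontfun (x (Suc n)) t) \<le> 1" by simp
    qed
  qed (simp add: x_0 f)
  have x_t0: "apply_bcontfun (x n) t0 = 1" for n
    by (induction n) (simp_all add: x_0 x_Suc f)
  have x_step: "norm (x (Suc n) - x n) \<le> (1/2) ^ n" for n
  proof (rule norm_bound)
    fix t
    let ?b = "norm (apply_bcontfun (f (Suc n)) t - apply_bcontfun (x n) t)"
    have "?b / max ((1/2) ^ n) ?b \<le> 1" using mx[of n ?b] by simp
    from mult_left_mono[OF this, of "(1/2) ^ n"]
    have "l n t * ?b \<le> (1/2) ^ n" by (simp add: l_def)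
    then show "norm (apply_bcontfun (x (Suc n) - x n) t) \<le> (1/2) ^ n" using l[of n t] by (simp add: x_Suc)
  qed
  have "norm (x m - x n) \<le> 2 * (1/2) ^ n - 2 * (1/2) ^ m" if "n \<le> m" for n m
    using that
  proof (induction rule: dec_induct)
    case (step m)
    have "norm (x (Suc m) - x n) \<le> norm (x (Suc m) - x m) + norm (x m - x n)"
      using norm_triangle_ineq[of "x (Suc m) - x m" "x m - x n"] by simp
    then show ?case using step.IH x_step[of m] by simp
  qed simp
  note x_tail = this
  have "norm (x m - x n) \<le> 2 * (1/2) ^ n" if "n \<le> m" for n m
  proof -
    have "(0::real) \<le> (1/2) ^ m" by simp
    then show ?thesis using x_tail[OF that] by linarith
  qed
  then have "Cauchy x" by (intro Cauchy_of_geometric[of 2]) auto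
  then have "convergent x" by (rule bcontfun_Cauchy_convergent)
  then obtain x' where x': "x \<longlonglongrightarrow> x'" unfolding convergent_def ..
  have diff0: "(\<lambda>n. norm (x' - x n)) \<longlonglongrightarrow> 0"
    using tendsto_norm[OF tendsto_diff[OF tendsto_const[of x'] x']] by simp
  have agree: "apply_bcontfun (x n) t = apply_bcontfun (f n) t" if "u n t \<noteq> 0" for n t
    using that
  proof (induction n)
    case (Suc n)
    then have eq: "apply_bcontfun (x n) t = apply_bcontfun (f n) t" and "w n t \<noteq> 1" by (auto simp: u_Suc)
    then have "4 ^ n * norm (?d n t) ^ 2 < 1" by (auto simp: w_def min_def split: if_splits)
    moreover have "(2 ^ n * norm (?d n t)) ^ 2 = 4 ^ n * norm (?d n t) ^ 2"
    proof -
      have "(2::real) ^ n * 2 ^ n = 4 ^ n" by (simp flip: power_mult_distrib)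
      then show ?thesis by (simp add: power_mult_distrib power2_eq_square)
    qed
    ultimately have "(2 ^ n * norm (?d n t)) ^ 2 < 1 ^ 2" by simp
    then have "2 ^ n * norm (?d n t) < 1" by (rule power2_less_imp_less) simp
    from mult_strict_left_mono[OF this, of "(1/2) ^ n"]
    have "norm (?d n t) < (1/2) ^ n" by (simp add: mult.assoc[symmetric] flip: power_mult_distrib)
    then have "l n t = 1" by (simp add: l_def eq max_def)
    then show ?case by (simp add: x_Suc)
  qed (simp add: x_0)
  show thesis
  proof (rule that[of u x'])
    show "Cauchy (\<lambda>n. T (scale_fun (u n) g))" for g
    proof (rule Cauchy_of_geometric[of "\<epsilon> * norm g"])
      fix n m :: nat assume nm: "n \<le> m"
      have "\<epsilon> * ((1/2) ^ n - (1/2) ^ m) * norm g \<le> \<epsilon> * (1/2) ^ n * norm g"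
        using \<epsilon> by (intro mult_right_mono mult_left_mono) auto
      then show "norm (T (scale_fun (u m) g) - T (scale_fun (u n) g)) \<le> \<epsilon> * norm g * (1/2) ^ n"
        using tail[OF nm, of g] by (simp add: ac_simps)
    qed (use \<epsilon> in simp)
    show "norm (T g - T (scale_fun (u n) g)) \<le> \<epsilon> * norm g" for n g
    proof -
      have "\<epsilon> * ((1/2) ^ 0 - (1/2) ^ n) * norm g \<le> \<epsilon> * 1 * norm g"
        using \<epsilon> by (intro mult_right_mono mult_left_mono) auto
      then show ?thesis using tail[of 0 n g] unfolding u0 by (simp add: norm_minus_commute)
    qed
    show "norm x' \<le> 1"
      using x_norm by (intro tendsto_upperbound[OF tendsto_norm[OF x']]) auto
    show "apply_bcontfun x' t0 = 1"
    proof -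
      have "norm (apply_bcontfun x' t0 - 1) \<le> norm (x' - x n)" for n
        using norm_bounded[of "x' - x n" t0] by (simp add: x_t0)
      then have "norm (apply_bcontfun x' t0 - 1) \<le> 0"
        by (intro tendsto_lowerbound[OF diff0]) auto
      then show ?thesis by simp
    qed
    show "(\<lambda>n. scale_fun (u n) (x' - f n)) \<longlonglongrightarrow> 0"
    proof (rule Lim_null_comparison[OF _ diff0], intro always_eventually allI)
      fix n
      have "scale_fun (u n) (x' - f n) = scale_fun (u n) (x' - x n)"
        using agree by (intro bcontfun_eqI) (auto simp: apply_scale_fun[OF K u_cont])
      then show "norm (scale_fun (u n) (x' - f n)) \<le> norm (x' - x n)"
        using norm_scale_fun_le[OF K u_cont, of n "x' - x n"] u by (simp add: abs_of_nonneg)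
    qed
  qed (use u u_cont in auto)
qed

section \<open>Operators on C(K) with essentially unique maximizers\<close>

lemma almost_norming_vector:
  fixes T :: "'a::real_normed_vector \<Rightarrow>\<^sub>L 'b::real_normed_vector"
  assumes "e > 0" obtains f where "norm f \<le> 1" "norm T - e < norm (T f)"
proof (rule ccontr)
  note conclude = that
  assume no: "\<not> thesis"
  have le: "norm (T f) \<le> norm T - e" if "norm f \<le> 1" for f
    using no conclude[OF that] by (meson not_le)
  have b: "0 \<le> norm T - e" using le[of 0] by (simp add: blinfun.zero_right)
  have "norm (T f) \<le> (norm T - e) * norm f" for f
  proof (cases "f = 0")
    case False
    have "norm (T (f /\<^sub>R norm f)) \<le> norm T - e" using False by (intro le) simp
    then show ?thesis using False by (simp add: blinfun.scaleR_right field_simps)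
  qed (simp add: blinfun.zero_right)
  then have "norm T \<le> norm T - e" by (rule norm_blinfun_bound[OF b])
  then show False using assms by simp
qed

text \<open>Selects one sequence \<open>c\<close> out of choices that depend on the tolerance \<open>\<eta>\<close>, by almost minimizing.\<close>

lemma almost_minimizers_null:
  fixes v :: "nat \<Rightarrow> 'c \<Rightarrow> real"
  assumes C: "c0 \<in> C" and pos: "\<And>n c. 0 \<le> v n c"
    and ev: "\<And>\<eta>. \<eta> > 0 \<Longrightarrow> \<exists>N. \<forall>n\<ge>N. \<exists>c\<in>C. v n c \<le> \<eta>"
  obtains c where "\<And>n. c n \<in> C" "(\<lambda>n. v n (c n)) \<longlonglongrightarrow> 0"
proof -
  have bdd: "bdd_below (v n ` C)" for n using pos by (intro bdd_belowI2)
  have "\<exists>c\<in>C. v n c < Inf (v n ` C) + 1 / real (Suc n)" for n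
    using cInf_lessD[of "v n ` C" "Inf (v n ` C) + 1 / real (Suc n)"] C by auto
  then obtain c where c: "\<And>n. c n \<in> C" "\<And>n. v n (c n) < Inf (v n ` C) + 1 / real (Suc n)"
    by metis
  have "(\<lambda>n. v n (c n)) \<longlonglongrightarrow> 0"
  proof (rule LIMSEQ_I)
    fix \<eta> :: real assume \<eta>: "\<eta> > 0"
    obtain N where N: "\<And>n. n \<ge> N \<Longrightarrow> \<exists>c\<in>C. v n c \<le> \<eta> / 2" using ev[of "\<eta> / 2"] \<eta> by auto
    obtain M where M: "1 / real (Suc M) < \<eta> / 2" using nat_approx_posE[of "\<eta> / 2"] \<eta> by auto
    have "norm (v n (c n) - 0) < \<eta>" if n: "n \<ge> max N M" for n
    proof -
      obtain d where d: "d \<in> C" "v n d \<le> \<eta> / 2" using N[of n] n by auto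
      have "Inf (v n ` C) \<le> v n d" using d(1) by (intro cInf_lower bdd) auto
      moreover have "1 / real (Suc n) \<le> 1 / real (Suc M)"
        using n by (intro divide_left_mono) auto
      ultimately show ?thesis using c(2)[of n] d(2) M pos[of n "c n"] by simp
    qed
    then show "\<exists>no. \<forall>n\<ge>no. norm (v n (c n) - 0) < \<eta>" by blast
  qed
  with c(1) show thesis by (rule that)
qed

locale C_K = scalar_field cj for cj :: "'f::{real_normed_field,euclidean_space} \<Rightarrow> 'f" +
  fixes sX :: "'f \<Rightarrow> ('k::topological_space \<Rightarrow>\<^sub>C 'f) \<Rightarrow> 'k \<Rightarrow>\<^sub>C 'f"
    and sY :: "'f \<Rightarrow> 'y::banach \<Rightarrow> 'y"
  assumes K: "compact (UNIV :: 'k set)"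
    and sX_apply: "apply_bcontfun (sX c f) t = c * apply_bcontfun f t"
    and sX: "normed_space_over sX"
    and sY: "normed_space_over sY"
begin

lemmas norm_sX = normed_space_over.norm_scale[OF sX]
lemmas norm_sY = normed_space_over.norm_scale[OF sY]

lemma sY_module: "sY a (x + y) = sY a x + sY a y" "sY (a + b) x = sY a x + sY b x"
  "sY a (sY b x) = sY (a * b) x" "sY 1 x = x" "sY a (x - y) = sY a x - sY a y"
  "sY (a - b) x = sY a x - sY b x"
proof -
  interpret normed_space_over sY by (rule sY)
  show "sY a (x + y) = sY a x + sY a y" "sY (a + b) x = sY a x + sY b x"
    "sY a (sY b x) = sY (a * b) x" "sY 1 x = x" "sY a (x - y) = sY a x - sY a y"
    "sY (a - b) x = sY a x - sY b x"
    by (simp_all add: scale_right_distrib scale_left_distrib scale_right_diff_distrib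
        scale_left_diff_distrib)
qed

lemma tendsto_sY:
  assumes "(y \<longlongrightarrow> z) F" shows "((\<lambda>n. sY a (y n)) \<longlongrightarrow> sY a z) F"
proof (rule LIM_zero_cancel)
  have "((\<lambda>n. norm a * norm (y n - z)) \<longlongrightarrow> norm a * 0) F"
    by (intro tendsto_intros tendsto_norm_zero LIM_zero assms)
  then have "((\<lambda>n. norm (sY a (y n) - sY a z)) \<longlongrightarrow> 0) F"
    by (simp add: sY_module(5)[symmetric] norm_sY)
  then show "((\<lambda>n. sY a (y n) - sY a z) \<longlongrightarrow> 0) F" by (rule tendsto_norm_zero_cancel)
qed

lemma bounded_opsD:
  assumes "T \<in> bounded_ops sX sY" shows "blinfun_apply T (sX c f) = sY c (blinfun_apply T f)"
  using assms by (simp add: bounded_ops_def Vector_Spaces.linear_iff)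

lemma bounded_opsI:
  assumes "\<And>c f. blinfun_apply T (sX c f) = sY c (blinfun_apply T f)"
  shows "T \<in> bounded_ops sX sY"
  using assms sX sY
  by (simp add: bounded_ops_def Vector_Spaces.linear_iff normed_space_over_def blinfun.add_right)

lemma norm_apply_le_one: "norm f \<le> 1 \<Longrightarrow> norm (apply_bcontfun f t) \<le> 1"
  using norm_bounded[of f t] by linarith

text \<open>Replace \<open>f\<close> near \<open>t0\<close> by a constant: \<open>G \<zeta> = (1 - h) f + h \<zeta>\<close> with a bump \<open>h\<close>, \<open>h t0 = 1\<close>, supported
  where \<open>f\<close> is close to \<open>z = f t0\<close>. Then \<open>G z\<close> is close to \<open>f\<close>, each \<open>G \<zeta>\<close> with \<open>\<bar>\<zeta>\<bar> \<le> 1\<close> is in the unit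
  ball, and the convex function \<open>\<zeta> \<mapsto> \<parallel>T (G \<zeta>)\<parallel>\<close> is at least as large as at \<open>z\<close> at one of the two points
  where the line through \<open>z\<close> and the origin leaves the disc. A rotation makes the value equal to one.\<close>

lemma almost_norming_with_value_one:
  assumes T: "T \<in> bounded_ops sX sY" and e: "e > 0"
  obtains g where "norm g \<le> 1" "apply_bcontfun g t0 = 1" "norm T - e < norm (T g)"
proof -
  obtain f where f: "norm f \<le> 1" "norm T - e / 2 < norm (T f)" using almost_norming_vector[of "e / 2" T] e by auto
  define \<delta> where "\<delta> = e / (2 * (norm T + 1))"
  have p1: "norm T + 1 > 0" using norm_ge_zero[of T] by linarith
  have \<delta>: "\<delta> > 0" "norm T * \<delta> \<le> e / 2"
    using e p1 by (auto simp: \<delta>_def field_simps)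
  define z where "z = apply_bcontfun f t0"
  have z1: "norm z \<le> 1" unfolding z_def by (rule norm_apply_le_one[OF f(1)])
  define h where "h t = max 0 (1 - norm (apply_bcontfun f t - z) / \<delta>)" for t
  have h: "0 \<le> h t" "h t \<le> 1" for t using \<delta>(1) by (auto simp: h_def)
  have h_cont: "continuous_on UNIV h"
    unfolding h_def using \<delta>(1) by (intro continuous_intros) auto
  have h_t0: "h t0 = 1" by (simp add: h_def z_def)
  have h_small: "h t * norm (z - apply_bcontfun f t) \<le> \<delta>" for t
  proof (cases "norm (apply_bcontfun f t - z) \<ge> \<delta>")
    case True
    then have "h t = 0" using \<delta>(1) by (simp add: h_def max_def)
    then show ?thesis using \<delta>(1) by simp
  next
    case False
    then show ?thesis
      using mult_right_mono[OF h(2)[of t], of "norm (z - apply_bcontfun f t)"]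
      by (simp add: norm_minus_commute)
  qed
  define G where "G \<zeta> = Bcontfun (\<lambda>t. (1 - h t) *\<^sub>R apply_bcontfun f t + h t *\<^sub>R \<zeta>)" for \<zeta>
  have G: "apply_bcontfun (G \<zeta>) t = (1 - h t) *\<^sub>R apply_bcontfun f t + h t *\<^sub>R \<zeta>" for \<zeta> t
    unfolding G_def by (subst apply_Bcontfun[OF K]) (auto intro!: continuous_intros h_cont)
  have G_norm: "norm (G \<zeta>) \<le> 1" if "norm \<zeta> \<le> 1" for \<zeta>
  proof (rule norm_bound)
    fix t
    have "norm (apply_bcontfun (G \<zeta>) t) \<le> (1 - h t) * norm (apply_bcontfun f t) + h t * norm \<zeta>"
      unfolding G by (rule order_trans[OF norm_triangle_ineq]) (use h[of t] in simp)
    also have "\<dots> \<le> (1 - h t) * 1 + h t * 1"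
      using h[of t] that norm_apply_le_one[OF f(1), of t] by (intro add_mono mult_left_mono) auto
    finally show "norm (apply_bcontfun (G \<zeta>) t) \<le> 1" by simp
  qed
  have near: "norm (G z - f) \<le> \<delta>"
  proof (rule norm_bound)
    fix t
    have "apply_bcontfun (G z - f) t = h t *\<^sub>R (z - apply_bcontfun f t)"
      by (simp add: G algebra_simps)
    then show "norm (apply_bcontfun (G z - f) t) \<le> \<delta>" using h_small[of t] h[of t] by simp
  qed
  have "norm (T f) \<le> norm (T (G z)) + e / 2"
  proof -
    have "norm (T (G z - f)) \<le> norm T * norm (G z - f)" by (rule norm_blinfun)
    also have "\<dots> \<le> norm T * \<delta>" using near by (intro mult_left_mono) auto
    finally have "norm (T (G z) - T f) \<le> e / 2" using \<delta>(2) by (simp add: blinfun.diff_right)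
    then show ?thesis using norm_triangle_ineq2[of "T f" "T (G z)"] by (simp add: norm_minus_commute)
  qed
  then have Gz: "norm T - e < norm (T (G z))" using f(2) by linarith
  define u where "u = (if z = 0 then 1 else sgn z)"
  have u: "norm u = 1" "z = norm z *\<^sub>R u"
    by (auto simp: u_def norm_sgn sgn_div_norm)
  \<comment> \<open>\<open>z\<close> is the convex combination of \<open>u\<close> and \<open>- u\<close> with weights \<open>a\<close> and \<open>1 - a\<close>.\<close>
  define a where "a = (1 + norm z) / 2"
  have a: "0 \<le> a" "0 \<le> 1 - a" using z1 by (auto simp: a_def)
  have "G z = a *\<^sub>R G u + (1 - a) *\<^sub>R G (- u)"
  proof (rule bcontfun_eqI)
    fix t
    have "z = a *\<^sub>R u + (1 - a) *\<^sub>R (- u)"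
      by (subst u(2)) (simp add: a_def scaleR_left_diff_distrib[symmetric] field_simps flip: scaleR_add_left)
    moreover have "a *\<^sub>R (p + r *\<^sub>R u) + (1 - a) *\<^sub>R (p + r *\<^sub>R (- u)) =
        p + r *\<^sub>R (a *\<^sub>R u + (1 - a) *\<^sub>R (- u))" for p r
      by (simp add: scaleR_conv_of_real algebra_simps)
    ultimately show "apply_bcontfun (G z) t = apply_bcontfun (a *\<^sub>R G u + (1 - a) *\<^sub>R G (- u)) t"
      unfolding plus_bcontfun.rep_eq scaleR_bcontfun.rep_eq G by metis
  qed
  then have "norm (T (G z)) \<le> a * norm (T (G u)) + (1 - a) * norm (T (G (- u)))"
    using norm_triangle_ineq[of "a *\<^sub>R T (G u)" "(1 - a) *\<^sub>R T (G (- u))"] a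
    by (simp add: blinfun.add_right blinfun.scaleR_right)
  also have "\<dots> \<le> a * max (norm (T (G u))) (norm (T (G (- u)))) + (1 - a) * max (norm (T (G u))) (norm (T (G (- u))))"
    using a by (intro add_mono mult_left_mono) auto
  also have "\<dots> = max (norm (T (G u))) (norm (T (G (- u))))" by (simp add: algebra_simps)
  finally have "\<exists>\<zeta>. norm \<zeta> = 1 \<and> norm T - e < norm (T (G \<zeta>))"
    using Gz u(1) by (cases "norm (T (G u)) \<le> norm (T (G (- u)))")
      (auto intro: exI[of _ u] exI[of _ "- u"])
  then obtain \<zeta> where \<zeta>: "norm \<zeta> = 1" "norm T - e < norm (T (G \<zeta>))" by blast
  show thesis
  proof (rule that[of "sX (inverse \<zeta>) (G \<zeta>)"])
    show "norm (sX (inverse \<zeta>) (G \<zeta>)) \<le> 1" using \<zeta>(1) G_norm[of \<zeta>] by (simp add: norm_sX norm_inverse)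
    show "apply_bcontfun (sX (inverse \<zeta>) (G \<zeta>)) t0 = 1"
      using \<zeta>(1) by (auto simp: sX_apply G h_t0 intro!: left_inverse)
    show "norm T - e < norm (T (sX (inverse \<zeta>) (G \<zeta>)))"
      using \<zeta> by (simp add: bounded_opsD[OF T] norm_sY norm_inverse)
  qed
qed

text \<open>On the unit ball, \<open>T\<close> is continuous at zero for the \<open>L\<^sup>2(\<nu>)\<close> seminorm.\<close>

definition dominated :: "(('k \<Rightarrow> real) \<Rightarrow> real) \<Rightarrow> (('k \<Rightarrow>\<^sub>C 'f) \<Rightarrow>\<^sub>L 'y) \<Rightarrow> bool" where
  "dominated \<nu> T \<longleftrightarrow> (\<forall>\<eta>>0. \<exists>\<rho>>0. \<forall>f. norm f \<le> 1 \<longrightarrow>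
     \<nu> (\<lambda>t. norm (apply_bcontfun f t) ^ 2) < \<rho> \<longrightarrow> norm (blinfun_apply T f) \<le> \<eta>)"

text \<open>Any two almost maximizers in the unit ball are close in \<open>L\<^sup>2(\<nu>)\<close> after a rotation of one of them.
  No maximizer need exist in \<open>C(K)\<close>.\<close>

definition essentially_unique_maximizer ::
    "(('k \<Rightarrow> real) \<Rightarrow> real) \<Rightarrow> (('k \<Rightarrow>\<^sub>C 'f) \<Rightarrow>\<^sub>L 'y) \<Rightarrow> bool" where
  "essentially_unique_maximizer \<nu> T \<longleftrightarrow> (\<forall>\<eta>>0. \<exists>\<delta>>0. \<forall>f g. norm f \<le> 1 \<longrightarrow> norm g \<le> 1 \<longrightarrow>
     norm T - \<delta> \<le> norm (blinfun_apply T f) \<longrightarrow> norm T - \<delta> \<le> norm (blinfun_apply T g) \<longrightarrow>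
     (\<exists>c. norm c = 1 \<and> \<nu> (\<lambda>t. norm (apply_bcontfun f t - c * apply_bcontfun g t) ^ 2) \<le> \<eta>))"

text \<open>The last clause says that \<open>\<nu>\<close> has mass at least one half at \<open>t0\<close>. Closeness for \<open>\<nu>\<close> then controls
  the value at \<open>t0\<close>, and this fixes the phase of functions that take the value one there.\<close>

definition control_at :: "'k \<Rightarrow> (('k \<Rightarrow> real) \<Rightarrow> real) \<Rightarrow> bool" where
  "control_at t0 \<nu> \<longleftrightarrow> positive_functional \<nu> \<and> \<nu> (\<lambda>t. 1) \<le> 1 \<and>
    (\<forall>u. continuous_on UNIV u \<longrightarrow> (\<forall>t. 0 \<le> u t) \<longrightarrow> u t0 \<le> 2 * \<nu> u)"

text \<open>The function \<open>(f - g)/2\<close> belongs to the unit ball.\<close>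

lemma dominated_diff:
  assumes dom: "dominated \<nu> T" and pf: "positive_functional \<nu>" and \<eta>: "\<eta> > 0"
  shows "\<exists>\<rho>>0. \<forall>f g. norm f \<le> 1 \<longrightarrow> norm g \<le> 1 \<longrightarrow>
    \<nu> (\<lambda>t. norm (apply_bcontfun f t - apply_bcontfun g t) ^ 2) < \<rho> \<longrightarrow> norm (T f - T g) \<le> \<eta>"
proof -
  obtain \<rho> where \<rho>: "\<rho> > 0" and T: "\<And>h. norm h \<le> 1 \<Longrightarrow>
      \<nu> (\<lambda>t. norm (apply_bcontfun h t) ^ 2) < \<rho> \<Longrightarrow> norm (T h) \<le> 1/2 * \<eta>"
    using dom[unfolded dominated_def, rule_format, of "1/2 * \<eta>"] \<eta> by auto
  show ?thesis
  proof (intro exI[of _ \<rho>] conjI allI impI \<rho>)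
    fix f g :: "'k \<Rightarrow>\<^sub>C 'f"
    assume fg: "norm f \<le> 1" "norm g \<le> 1" "\<nu> (\<lambda>t. norm (apply_bcontfun f t - apply_bcontfun g t) ^ 2) < \<rho>"
    define d where "d t = norm (apply_bcontfun f t - apply_bcontfun g t) ^ 2" for t
    have d: "continuous_on UNIV d" unfolding d_def by (intro continuous_intros continuous_on_apply_bcontfun)
    let ?h = "(1/2) *\<^sub>R (f - g)"
    have "norm (f - g) \<le> 1 + 1" using fg by (intro order_trans[OF norm_triangle_ineq4] add_mono)
    then have "norm ?h \<le> 1" by simp
    moreover have "\<nu> (\<lambda>t. norm (apply_bcontfun ?h t) ^ 2) < \<rho>"
    proof -
      have "(\<lambda>t. norm (apply_bcontfun ?h t) ^ 2) = (\<lambda>t. (1/4) * d t)"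
        by (rule ext) (simp add: d_def power_mult_distrib power_divide)
      then have "\<nu> (\<lambda>t. norm (apply_bcontfun ?h t) ^ 2) = (1/4) * \<nu> d"
        by (simp only: positive_functionalD(2)[OF pf d])
      moreover have "0 \<le> \<nu> d" by (rule positive_functionalD(3)[OF pf d]) (simp add: d_def)
      ultimately show ?thesis using fg(3) unfolding d_def[abs_def, symmetric] by linarith
    qed
    ultimately have "norm (T ?h) \<le> 1/2 * \<eta>" by (rule T)
    then show "norm (T f - T g) \<le> \<eta>" by (simp add: blinfun.scaleR_right blinfun.diff_right)
  qed
qed

text \<open>Average a control functional with evaluation at \<open>t0\<close>. The passage from \<open>\<mu> \<bar>f\<bar>\<close> to \<open>\<mu> (\<bar>f\<bar>\<^sup>2)\<close> uses
  \<open>\<bar>f\<bar> \<le> \<bar>f\<bar>\<^sup>2 / (2 \<rho>) + \<rho> / 2\<close>.\<close>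

lemma exhaustive_imp_dominated:
  assumes "exhaustive_op T"
  obtains \<nu> where "control_at t0 \<nu>" "dominated \<nu> T"
proof -
  obtain \<mu> where \<mu>: "positive_functional \<mu>" "\<mu> (\<lambda>t. 1) \<le> 1"
    and dom: "\<And>\<eta>. \<eta> > 0 \<Longrightarrow> \<exists>\<rho>>0. \<forall>f. (\<forall>t. norm (apply_bcontfun f t) \<le> 1) \<longrightarrow>
      \<mu> (\<lambda>t. norm (apply_bcontfun f t)) < \<rho> \<longrightarrow> norm (T f) \<le> \<eta>"
    using control_functional[OF K assms] by metis
  define \<nu> where "\<nu> u = 1/2 * \<mu> u + 1/2 * u t0" for u
  have \<nu>: "positive_functional \<nu>"
    using \<mu>(1) by (auto simp: positive_functional_def \<nu>_def algebra_simps add_divide_distrib)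
  have "control_at t0 \<nu>"
    using \<nu> \<mu>(2) positive_functionalD(3)[OF \<mu>(1)] by (auto simp: control_at_def \<nu>_def)
  moreover have "dominated \<nu> T"
    unfolding dominated_def
  proof (intro allI impI)
    fix \<eta> :: real assume "\<eta> > 0"
    then obtain \<rho> where \<rho>: "\<rho> > 0" and T: "\<And>f. (\<And>t. norm (apply_bcontfun f t) \<le> 1) \<Longrightarrow>
      \<mu> (\<lambda>t. norm (apply_bcontfun f t)) < \<rho> \<Longrightarrow> norm (T f) \<le> \<eta>" using dom[of \<eta>] by auto
    show "\<exists>\<rho>>0. \<forall>f. norm f \<le> 1 \<longrightarrow> \<nu> (\<lambda>t. norm (apply_bcontfun f t) ^ 2) < \<rho> \<longrightarrow> norm (T f) \<le> \<eta>"
    proof (intro exI[of _ "\<rho>^2 / 2"] conjI allI impI)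
      fix f :: "'k \<Rightarrow>\<^sub>C 'f" assume f: "norm f \<le> 1" "\<nu> (\<lambda>t. norm (apply_bcontfun f t) ^ 2) < \<rho>^2 / 2"
      let ?w = "\<lambda>t. norm (apply_bcontfun f t)"
      have wc: "continuous_on UNIV ?w" "continuous_on UNIV (\<lambda>t. ?w t ^ 2)"
        by (auto intro!: continuous_intros)
      have half: "M < R" if "1/2 * M + 1/2 * N < R / 2" "0 \<le> N" for M N R :: real
        using that by linarith
      have "\<mu> (\<lambda>t. ?w t ^ 2) < \<rho>^2"
        by (rule half[OF f(2)[unfolded \<nu>_def]]) simp
      moreover have "\<mu> ?w \<le> \<mu> (\<lambda>t. (1 / (2 * \<rho>)) * ?w t ^ 2 + (\<rho> / 2) * 1)"
      proof (rule positive_functional_mono[OF \<mu>(1) wc(1)])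
        fix t
        have "0 \<le> (?w t - \<rho>)^2" by simp
        then show "?w t \<le> (1 / (2 * \<rho>)) * ?w t ^ 2 + (\<rho> / 2) * 1"
          using \<rho> by (simp add: field_simps power2_eq_square)
      qed (intro continuous_intros wc)
      moreover have "\<mu> (\<lambda>t. (1 / (2 * \<rho>)) * ?w t ^ 2 + (\<rho> / 2) * 1) =
          \<mu> (\<lambda>t. (1 / (2 * \<rho>)) * ?w t ^ 2) + \<mu> (\<lambda>t. (\<rho> / 2) * 1)"
        by (intro positive_functionalD(1)[OF \<mu>(1)] continuous_intros wc)
      moreover have "\<mu> (\<lambda>t. (1 / (2 * \<rho>)) * ?w t ^ 2) = (1 / (2 * \<rho>)) * \<mu> (\<lambda>t. ?w t ^ 2)"
        by (rule positive_functionalD(2)[OF \<mu>(1) wc(2)])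
      moreover have "\<mu> (\<lambda>t. (\<rho> / 2) * 1) = (\<rho> / 2) * \<mu> (\<lambda>t. 1)"
        by (rule positive_functionalD(2)[OF \<mu>(1) continuous_on_const])
      moreover have "(\<rho> / 2) * \<mu> (\<lambda>t. 1) \<le> \<rho> / 2" using \<rho> \<mu>(2) by simp
      moreover have "(1 / (2 * \<rho>)) * \<mu> (\<lambda>t. ?w t ^ 2) < (1 / (2 * \<rho>)) * \<rho>^2"
        using calculation(1) \<rho> by (intro mult_strict_left_mono) auto
      moreover have "(1 / (2 * \<rho>)) * \<rho>^2 = \<rho> / 2" using \<rho> by (simp add: power2_eq_square)
      ultimately have "\<mu> ?w < \<rho>" by linarith
      then show "norm (T f) \<le> \<eta>" using norm_apply_le_one[OF f(1)] by (intro T)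
    qed (use \<rho> in simp)
  qed
  ultimately show thesis by (rule that)
qed


definition ip :: "(('k \<Rightarrow> real) \<Rightarrow> real) \<Rightarrow> ('k \<Rightarrow>\<^sub>C 'f) \<Rightarrow> ('k \<Rightarrow>\<^sub>C 'f) \<Rightarrow> real" where
  "ip \<nu> f g = \<nu> (\<lambda>t. inner (apply_bcontfun f t) (apply_bcontfun g t))"

lemma semi_inner_ip:
  assumes \<nu>: "positive_functional \<nu>" shows "semi_inner (ip \<nu>)"
proof
  have cont: "continuous_on UNIV (\<lambda>t. inner (apply_bcontfun f t) (apply_bcontfun g t))" for f g :: "'k \<Rightarrow>\<^sub>C 'f"
    by (auto intro!: continuous_intros)
  fix x y z :: "'k \<Rightarrow>\<^sub>C 'f" and c :: real
  show "ip \<nu> x y = ip \<nu> y x" by (simp add: ip_def inner_commute)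
  show "ip \<nu> (x + y) z = ip \<nu> x z + ip \<nu> y z"
    using positive_functionalD(1)[OF \<nu> cont cont] by (simp add: ip_def inner_add_left)
  show "ip \<nu> (c *\<^sub>R x) z = c * ip \<nu> x z"
    using positive_functionalD(2)[OF \<nu> cont] by (simp add: ip_def)
  show "0 \<le> ip \<nu> x x" unfolding ip_def by (rule positive_functionalD(3)[OF \<nu> cont]) simp
qed

lemma ip_same: "ip \<nu> f f = \<nu> (\<lambda>t. norm (apply_bcontfun f t) ^ 2)"
  by (simp add: ip_def dot_square_norm)

lemma ip_le_one:
  assumes "positive_functional \<nu>" "\<nu> (\<lambda>t. 1) \<le> 1" "norm f \<le> 1"
  shows "ip \<nu> f f \<le> 1"
proof -
  have "\<nu> (\<lambda>t. norm (apply_bcontfun f t) ^ 2) \<le> 1 * \<nu> (\<lambda>t. 1)"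
    using norm_apply_le_one[OF assms(3)]
    by (intro positive_functional_le_const[OF assms(1)]) (auto intro!: continuous_intros power_le_one)
  then show ?thesis using assms(2) by (simp add: ip_same)
qed

lemma norm_Re_le: "a + inner z 1 \<le> norm (a *\<^sub>R 1 + z)" for z :: 'f
proof -
  have "inner (a *\<^sub>R 1 + z) 1 \<le> norm (a *\<^sub>R 1 + z) * norm (1 :: 'f)" by (rule norm_cauchy_schwarz)
  moreover have "inner (1::'f) 1 = 1" by (simp add: dot_square_norm)
  ultimately show ?thesis by (simp add: inner_add_left)
qed

text \<open>Let \<open>\<psi>\<close> be the scalar functional with real part \<open>\<rho>\<close> from \<open>strongly_exposing_perturbation\<close> for
  \<open>F f = \<parallel>T f\<parallel>\<close>, and let \<open>M\<close> be the supremum of \<open>\<parallel>T f\<parallel> + \<rho> f\<close>, which by rotation is also that of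
  \<open>\<parallel>T f\<parallel> + \<bar>\<psi> f\<bar>\<close>. A maximizing sequence is Cauchy in \<open>L\<^sup>2(\<nu>)\<close>, so its images under \<open>T\<close> converge to
  some \<open>y0\<close>. With \<open>e\<close> in the direction of \<open>y0\<close>, the triangle inequality for \<open>T f + \<psi> f e\<close> is
  asymptotically an equality along this sequence, so the perturbed operator has norm exactly \<open>M\<close>.
  Its almost maximizers are then, up to rotation, almost maximizers of \<open>\<parallel>T f\<parallel> + \<rho> f\<close>.\<close>

lemma rank_one_perturbation:
  assumes T: "T \<in> bounded_ops sX sY" and \<nu>: "control_at t0 \<nu>" and dom: "dominated \<nu> T"
    and \<epsilon>: "\<epsilon> > 0" and nz: "\<exists>y :: 'y. y \<noteq> 0"
  obtains T1 \<psi> e where "T1 \<in> bounded_ops sX sY" "\<And>f. blinfun_apply T1 f = blinfun_apply T f + sY (\<psi> f) e"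
    "\<And>f. norm (\<psi> f) \<le> \<epsilon> * norm f" "norm e = 1" "dominated \<nu> T1" "essentially_unique_maximizer \<nu> T1"
proof -
  have pf: "positive_functional \<nu>" and n1: "\<nu> (\<lambda>t. 1) \<le> 1" using \<nu> by (auto simp: control_at_def)
  interpret semi_inner "ip \<nu>" by (rule semi_inner_ip[OF pf])
  define B where "B = {f :: 'k \<Rightarrow>\<^sub>C 'f. norm f \<le> 1}"
  have B0: "B \<noteq> {}" by (auto simp: B_def intro: exI[of _ 0])
  have nrm1: "nrm f \<le> 1" if "f \<in> B" for f
    using ip_le_one[OF pf n1, of f] that by (simp add: nrm_def B_def)
  have nrm_le_norm: "nrm f \<le> norm f" for f
  proof (cases "f = 0")
    case False
    then have "nrm (inverse (norm f) *\<^sub>R f) \<le> 1" by (intro nrm1) (simp add: B_def)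
    then show ?thesis using False by (simp add: nrm_scale field_simps)
  qed simp
  have sXB: "sX c f \<in> B" if "norm c = 1" "f \<in> B" for c f
    using that by (simp add: B_def norm_sX)
  have T_bd: "norm (T f) \<le> norm T" if "f \<in> B" for f
    using norm_blinfun[of T f] mult_left_mono[of "norm f" 1 "norm T"] that by (simp add: B_def)
  obtain \<rho> where \<rho>: "linear \<rho>" "\<And>f. \<bar>\<rho> f\<bar> \<le> \<epsilon> * nrm f"
    and slice: "\<And>\<eta>. \<eta> > 0 \<Longrightarrow> \<exists>\<delta>>0. \<forall>f1\<in>B. \<forall>f2\<in>B.
      (\<forall>h\<in>B. norm (T h) + \<rho> h \<le> norm (T f1) + \<rho> f1 + \<delta>) \<longrightarrow>
      (\<forall>h\<in>B. norm (T h) + \<rho> h \<le> norm (T f2) + \<rho> f2 + \<delta>) \<longrightarrow> nrm (f1 - f2) \<le> \<eta>"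
    by (rule strongly_exposing_perturbation[of B "\<lambda>f. norm (T f)" "norm T" \<epsilon>, OF B0 nrm1 T_bd \<epsilon>])
      (assumption, assumption, rule that)
  define \<psi> where "\<psi> = scalar_extension sX \<rho>"
  have \<psi>_lin: "Vector_Spaces.linear sX (*) \<psi>"
    unfolding \<psi>_def by (rule scalar_extension_linear[OF sX \<rho>(1)])
  have \<psi>_rot: "\<exists>c. norm c = 1 \<and> norm (\<psi> f) = \<rho> (sX c f)" for f
    using norm_scalar_extension[OF sX \<rho>(1), of f] unfolding \<psi>_def by metis
  have nrm_rot: "nrm (sX c f) = nrm f" if "norm c = 1" for c f
    using that by (simp add: nrm_def ip_same sX_apply norm_mult)
  have \<psi>_nrm: "norm (\<psi> f) \<le> \<epsilon> * nrm f" for f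
    using \<psi>_rot[of f] \<rho>(2) nrm_rot by (metis abs_le_D1)
  have \<psi>_bd: "norm (\<psi> f) \<le> \<epsilon> * norm f" for f
    using \<psi>_nrm[of f] mult_left_mono[OF nrm_le_norm[of f], of \<epsilon>] \<epsilon> by linarith
  have \<psi>_1: "inner (\<psi> f) 1 = \<rho> f" for f
  proof -
    have "sX 1 f = f" by (rule bcontfun_eqI) (simp add: sX_apply)
    then show ?thesis
      using inner_scalar_extension[OF sX \<rho>(1), of f 1] by (simp add: \<psi>_def cj_one)
  qed
  define J where "J f = norm (T f) + \<rho> f" for f
  define M where "M = (SUP f\<in>B. J f)"
  have J_bd: "J f \<le> norm T + \<epsilon>" if "f \<in> B" for f
  proof -
    have "\<epsilon> * nrm f \<le> \<epsilon> * 1" using nrm1[OF that] \<epsilon> by (intro mult_left_mono) auto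
    then show ?thesis using T_bd[OF that] \<rho>(2)[of f] unfolding J_def by linarith
  qed
  have bdd: "bdd_above (J ` B)" using J_bd by (intro bdd_aboveI2)
  have J_le: "J f \<le> M" if "f \<in> B" for f unfolding M_def using that bdd by (rule cSUP_upper)
  have M_rot: "\<exists>c. norm c = 1 \<and> norm (T f) + norm (\<psi> f) = J (sX c f)" for f
  proof -
    obtain c where "norm c = 1" "norm (\<psi> f) = \<rho> (sX c f)" using \<psi>_rot by blast
    then show ?thesis by (intro exI[of _ c]) (simp add: J_def bounded_opsD[OF T] norm_sY)
  qed
  have M_ge: "norm (T f) + norm (\<psi> f) \<le> M" if f: "f \<in> B" for f
    using M_rot[of f] J_le sXB f by metis
  have "\<exists>f\<in>B. M - 1 / real (Suc n) < J f" for n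
    using less_cSUP_iff[OF B0 bdd, of "M - 1 / real (Suc n)"] by (simp add: M_def)
  then obtain f where f: "\<And>n. f n \<in> B" "\<And>n. M - 1 / real (Suc n) < J (f n)" by metis
  have J_lim: "(\<lambda>n. J (f n)) \<longlonglongrightarrow> M"
  proof (rule tendsto_sandwich)
    show "(\<lambda>n. M - 1 / real (Suc n)) \<longlonglongrightarrow> M"
      using tendsto_diff[OF tendsto_const LIMSEQ_inverse_real_of_nat, of M] by (simp add: inverse_eq_divide)
    show "\<forall>\<^sub>F n in sequentially. J (f n) \<le> M" using J_le f(1) by simp
    show "\<forall>\<^sub>F n in sequentially. M - 1 / real (Suc n) \<le> J (f n)" using f(2) by (simp add: less_imp_le)
  qed simp
  have f_close: "\<exists>N. \<forall>n\<ge>N. \<forall>m\<ge>N. nrm (f n - f m) \<le> \<eta>" if "\<eta> > 0" for \<eta>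
  proof -
    obtain \<delta> where \<delta>: "\<delta> > 0" "\<And>f1 f2. f1 \<in> B \<Longrightarrow> f2 \<in> B \<Longrightarrow> (\<forall>h\<in>B. J h \<le> J f1 + \<delta>) \<Longrightarrow>
      (\<forall>h\<in>B. J h \<le> J f2 + \<delta>) \<Longrightarrow> nrm (f1 - f2) \<le> \<eta>"
      using slice[OF \<open>\<eta> > 0\<close>] unfolding J_def by blast
    have "\<forall>\<^sub>F n in sequentially. M - \<delta> < J (f n)"
      using order_tendstoD(1)[OF J_lim, of "M - \<delta>"] \<delta>(1) by simp
    then obtain N where N: "\<And>n. n \<ge> N \<Longrightarrow> M - \<delta> < J (f n)" by (auto simp: eventually_sequentially)
    have "J h \<le> J (f n) + \<delta>" if "h \<in> B" "n \<ge> N" for h n using J_le[OF that(1)] N[OF that(2)] by linarith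
    then show ?thesis using \<delta>(2) f(1) by blast
  qed
  have "Cauchy (\<lambda>n. T (f n))"
  proof (rule metric_CauchyI)
    fix e :: real assume e: "e > 0"
    obtain r where r: "r > 0" and D: "\<And>f g. norm f \<le> 1 \<Longrightarrow> norm g \<le> 1 \<Longrightarrow>
        \<nu> (\<lambda>t. norm (apply_bcontfun f t - apply_bcontfun g t) ^ 2) < r \<Longrightarrow> norm (T f - T g) \<le> 1/2 * e"
      using dominated_diff[OF dom pf, of "1/2 * e"] e by auto
    obtain N where N: "\<And>n m. n \<ge> N \<Longrightarrow> m \<ge> N \<Longrightarrow> nrm (f n - f m) \<le> sqrt (1/2 * r)"
      using f_close[of "sqrt (1/2 * r)"] r by auto
    have "dist (T (f m)) (T (f n)) < e" if mn: "m \<ge> N" "n \<ge> N" for m n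
    proof -
      have "nrm (f m - f n) ^ 2 \<le> sqrt (1/2 * r) ^ 2"
        using N[OF mn] nrm_nonneg by (intro power_mono)
      then have "\<nu> (\<lambda>t. norm (apply_bcontfun (f m) t - apply_bcontfun (f n) t) ^ 2) \<le> 1/2 * r"
        using r by (simp add: nrm_sq ip_same)
      then have "norm (T (f m) - T (f n)) \<le> 1/2 * e"
        using r f(1) by (intro D) (auto simp: B_def)
      then show ?thesis using e by (simp add: dist_norm)
    qed
    then show "\<exists>M. \<forall>m\<ge>M. \<forall>n\<ge>M. dist (T (f m)) (T (f n)) < e" by blast
  qed
  then obtain y0 where y0: "(\<lambda>n. T (f n)) \<longlonglongrightarrow> y0" using Cauchy_convergent convergent_def by blast
  \<comment> \<open>If \<open>y0 = 0\<close> then any unit vector will do; this is where \<open>Y\<close> has to be nonzero.\<close>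
  obtain e :: 'y where e: "norm e = 1" "y0 = norm y0 *\<^sub>R e"
  proof (cases "y0 = 0")
    case True
    obtain y :: 'y where "y \<noteq> 0" using nz by blast
    then show ?thesis using True that[of "sgn y"] by (simp add: norm_sgn)
  next
    case False
    then show ?thesis using that[of "sgn y0"] by (simp add: norm_sgn sgn_div_norm)
  qed
  define T1' where "T1' g = T g + sY (\<psi> g) e" for g
  have \<psi>_add: "\<psi> (g + h) = \<psi> g + \<psi> h" and \<psi>_sX: "\<psi> (sX c g) = c * \<psi> g" for g h c
    using \<psi>_lin by (simp_all add: Vector_Spaces.linear_iff)
  have T1'_add: "T1' (g + h) = T1' g + T1' h" and T1'_sX: "T1' (sX c g) = sY c (T1' g)" for g h c
    by (simp_all add: T1'_def blinfun.add_right \<psi>_add \<psi>_sX sY_module bounded_opsD[OF T])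
  have T1'_norm: "norm (T1' g) \<le> norm (T g) + norm (\<psi> g)" for g
    unfolding T1'_def using norm_triangle_ineq[of "T g" "sY (\<psi> g) e"] by (simp add: norm_sY e(1))
  have "bounded_linear T1'"
  proof (rule bounded_linear_intro[of _ "norm T + \<epsilon>"])
    show "T1' (r *\<^sub>R g) = r *\<^sub>R T1' g" for r g
      using T1'_sX[of "of_real r" g] sX sY by (simp add: normed_space_over.scale_of_real)
    show "norm (T1' g) \<le> norm g * (norm T + \<epsilon>)" for g
      using T1'_norm[of g] norm_blinfun[of T g] \<psi>_bd[of g] by (simp add: algebra_simps)
  qed (rule T1'_add)
  define T1 where "T1 = Blinfun T1'"
  have T1: "blinfun_apply T1 = T1'"
    unfolding T1_def using \<open>bounded_linear T1'\<close> by (rule bounded_linear_Blinfun_apply)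
  have T1_ops: "T1 \<in> bounded_ops sX sY" by (rule bounded_opsI) (simp add: T1 T1'_sX)
  have norm_T1: "norm T1 = M"
  proof (rule antisym)
    have "0 \<le> M" using M_ge[of 0] by (simp add: B_def)
         (meson add_nonneg_nonneg norm_ge_zero order_trans)
    then show "norm T1 \<le> M"
    proof (rule norm_blinfun_bound)
      fix g
      show "norm (T1 g) \<le> M * norm g"
      proof (cases "g = 0")
        case False
        have "norm (T1 (inverse (norm g) *\<^sub>R g)) \<le> M"
          unfolding T1 using False by (intro order_trans[OF T1'_norm M_ge]) (simp add: B_def)
        then show ?thesis using False by (simp add: blinfun.scaleR_right field_simps)
      qed (simp add: blinfun.zero_right)
    qed
    show "M \<le> norm T1"
    proof (rule tendsto_upperbound)
      show "(\<lambda>n. norm y0 + (J (f n) - norm (T (f n))) - norm (y0 - T (f n))) \<longlonglongrightarrow> M"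
        by (rule tendsto_eq_intros J_lim y0 refl | simp)+
      have "norm y0 + (J (f n) - norm (T (f n))) - norm (y0 - T (f n)) \<le> norm T1" for n
      proof -
        have "sY (norm y0 *\<^sub>R 1 + \<psi> (f n)) e = y0 + sY (\<psi> (f n)) e"
          using e(2) normed_space_over.scale_of_real[OF sY, of "norm y0" e]
          by (simp add: sY_module scaleR_conv_of_real)
        then have "norm (norm y0 *\<^sub>R 1 + \<psi> (f n)) = norm (y0 + sY (\<psi> (f n)) e)"
          using norm_sY[of "norm y0 *\<^sub>R 1 + \<psi> (f n)" e] e(1) by simp
        moreover have "y0 + sY (\<psi> (f n)) e = T1 (f n) + (y0 - T (f n))"
          by (simp add: T1 T1'_def)
        ultimately have "norm y0 + \<rho> (f n) \<le> norm (T1 (f n)) + norm (y0 - T (f n))"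
          using norm_Re_le[of "norm y0" "\<psi> (f n)"] norm_triangle_ineq[of "T1 (f n)" "y0 - T (f n)"]
          by (simp add: \<psi>_1)
        moreover have "norm (T1 (f n)) \<le> norm T1"
          using norm_blinfun[of T1 "f n"] mult_left_mono[of "norm (f n)" 1 "norm T1"] f(1)[of n]
          by (simp add: B_def)
        ultimately show ?thesis by (simp add: J_def)
      qed
      then show "\<forall>\<^sub>F n in sequentially. norm y0 + (J (f n) - norm (T (f n))) - norm (y0 - T (f n)) \<le> norm T1"
        by simp
    qed simp
  qed
  have "dominated \<nu> T1"
    unfolding dominated_def
  proof (intro allI impI)
    fix \<eta> :: real assume \<eta>: "\<eta> > 0"
    then obtain r where r: "r > 0" "\<And>g. norm g \<le> 1 \<Longrightarrow> ip \<nu> g g < r \<Longrightarrow> norm (T g) \<le> \<eta> / 2"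
      using dom[unfolded dominated_def, rule_format, of "\<eta> / 2"] unfolding ip_same by auto
    show "\<exists>r>0. \<forall>g. norm g \<le> 1 \<longrightarrow> \<nu> (\<lambda>t. norm (apply_bcontfun g t) ^ 2) < r \<longrightarrow> norm (T1 g) \<le> \<eta>"
    proof (intro exI[of _ "min r ((\<eta> / (2 * \<epsilon>))^2)"] conjI allI impI)
      fix g :: "'k \<Rightarrow>\<^sub>C 'f"
      assume g: "norm g \<le> 1" "\<nu> (\<lambda>t. norm (apply_bcontfun g t) ^ 2) < min r ((\<eta> / (2 * \<epsilon>))^2)"
      have "nrm g ^ 2 < (\<eta> / (2 * \<epsilon>))^2" using g(2) by (simp add: nrm_sq ip_same)
      then have "nrm g < \<eta> / (2 * \<epsilon>)" using \<eta> \<epsilon> by (intro power2_less_imp_less[of "nrm g"]) auto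
      then have "\<epsilon> * nrm g < \<eta> / 2" using \<epsilon> by (simp add: field_simps)
      then have "norm (\<psi> g) \<le> \<eta> / 2" using \<psi>_nrm[of g] by linarith
      moreover have "norm (T g) \<le> \<eta> / 2" using g by (intro r(2)) (auto simp: ip_same)
      ultimately show "norm (T1 g) \<le> \<eta>" using T1'_norm[of g] by (simp add: T1)
    qed (use r \<eta> \<epsilon> in simp)
  qed
  moreover have "essentially_unique_maximizer \<nu> T1"
    unfolding essentially_unique_maximizer_def
  proof (intro allI impI)
    fix \<eta> :: real assume \<eta>: "\<eta> > 0"
    then obtain \<delta> where \<delta>: "\<delta> > 0" "\<And>f1 f2. f1 \<in> B \<Longrightarrow> f2 \<in> B \<Longrightarrow> (\<forall>h\<in>B. J h \<le> J f1 + \<delta>) \<Longrightarrow>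
      (\<forall>h\<in>B. J h \<le> J f2 + \<delta>) \<Longrightarrow> nrm (f1 - f2) \<le> sqrt \<eta>"
      using slice[of "sqrt \<eta>"] unfolding J_def by auto
    show "\<exists>\<delta>>0. \<forall>g h. norm g \<le> 1 \<longrightarrow> norm h \<le> 1 \<longrightarrow> norm T1 - \<delta> \<le> norm (T1 g) \<longrightarrow>
      norm T1 - \<delta> \<le> norm (T1 h) \<longrightarrow>
      (\<exists>c. norm c = 1 \<and> \<nu> (\<lambda>t. norm (apply_bcontfun g t - c * apply_bcontfun h t) ^ 2) \<le> \<eta>)"
    proof (intro exI[of _ \<delta>] conjI allI impI \<delta>(1))
      fix g h :: "'k \<Rightarrow>\<^sub>C 'f" assume gh: "norm g \<le> 1" "norm h \<le> 1"
        "norm T1 - \<delta> \<le> norm (T1 g)" "norm T1 - \<delta> \<le> norm (T1 h)"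
      have rot: "\<exists>c. norm c = 1 \<and> M - \<delta> \<le> J (sX c u)" if "norm T1 - \<delta> \<le> norm (T1 u)" for u
      proof -
        obtain c where c: "norm c = 1" "norm (T u) + norm (\<psi> u) = J (sX c u)" using M_rot by blast
        then show ?thesis
          using T1'_norm[of u] that unfolding norm_T1 T1 by (intro exI[of _ c]) linarith
      qed
      obtain c where c: "norm c = 1" "M - \<delta> \<le> J (sX c g)" using rot[OF gh(3)] by blast
      obtain d where d: "norm d = 1" "M - \<delta> \<le> J (sX d h)" using rot[OF gh(4)] by blast
      have in_B: "sX c g \<in> B" "sX d h \<in> B" using gh c d by (simp_all add: norm_sX B_def)
      have mx: "\<forall>k\<in>B. J k \<le> J (sX c g) + \<delta>" "\<forall>k\<in>B. J k \<le> J (sX d h) + \<delta>"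
        using J_le c(2) d(2) by fastforce+
      have "nrm (sX c g - sX d h) \<le> sqrt \<eta>" by (rule \<delta>(2)[OF in_B mx])
      then have "nrm (sX c g - sX d h) ^ 2 \<le> sqrt \<eta> ^ 2" by (intro power_mono nrm_nonneg)
      then have "\<nu> (\<lambda>t. norm (c * apply_bcontfun g t - d * apply_bcontfun h t) ^ 2) \<le> \<eta>"
        using \<eta> by (simp add: nrm_sq ip_same sX_apply)
      moreover have "norm (c * x - d * y) = norm (x - (inverse c * d) * y)" for x y
      proof -
        have "c \<noteq> 0" using c(1) by auto
        then have "c * x - d * y = c * (x - (inverse c * d) * y)" by (simp add: algebra_simps)
        then show ?thesis using c(1) by (simp add: norm_mult)
      qed
      ultimately show "\<exists>c. norm c = 1 \<and> \<nu> (\<lambda>t. norm (apply_bcontfun g t - c * apply_bcontfun h t) ^ 2) \<le> \<eta>"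
        using c(1) d(1) by (intro exI[of _ "inverse c * d"]) (simp add: norm_mult norm_inverse)
    qed
  qed
  ultimately show thesis
    using that[OF T1_ops, of \<psi> e] \<psi>_bd e(1) by (simp add: T1 T1'_def)
qed

text \<open>If both functions take the value one at \<open>t0\<close>, the mass of \<open>\<nu>\<close> at \<open>t0\<close> forces the rotation \<open>c\<close> to be close
  to one.\<close>

lemma maximizers_with_value_one:
  assumes \<nu>: "control_at t0 \<nu>" and u: "essentially_unique_maximizer \<nu> T" and \<eta>: "\<eta> > 0"
  shows "\<exists>\<delta>>0. \<forall>f g. norm f \<le> 1 \<longrightarrow> norm g \<le> 1 \<longrightarrow> apply_bcontfun f t0 = 1 \<longrightarrow> apply_bcontfun g t0 = 1 \<longrightarrow>
     norm T - \<delta> \<le> norm (blinfun_apply T f) \<longrightarrow> norm T - \<delta> \<le> norm (blinfun_apply T g) \<longrightarrow>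
     \<nu> (\<lambda>t. norm (apply_bcontfun f t - apply_bcontfun g t) ^ 2) \<le> \<eta>"
proof -
  have pf: "positive_functional \<nu>" and n1: "\<nu> (\<lambda>t. 1) \<le> 1" using \<nu> by (auto simp: control_at_def)
  obtain \<delta> where \<delta>: "\<delta> > 0" "\<And>f g. norm f \<le> 1 \<Longrightarrow> norm g \<le> 1 \<Longrightarrow> norm T - \<delta> \<le> norm (T f) \<Longrightarrow>
    norm T - \<delta> \<le> norm (T g) \<Longrightarrow> \<exists>c. norm c = 1 \<and> \<nu> (\<lambda>t. norm (apply_bcontfun f t - c * apply_bcontfun g t) ^ 2) \<le> \<eta> / 6"
    using u[unfolded essentially_unique_maximizer_def, rule_format, of "\<eta> / 6"] \<eta> by auto
  show ?thesis
  proof (intro exI[of _ \<delta>] conjI allI impI \<delta>(1))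
    fix f g :: "'k \<Rightarrow>\<^sub>C 'f" assume fg: "norm f \<le> 1" "norm g \<le> 1" "apply_bcontfun f t0 = 1" "apply_bcontfun g t0 = 1"
      "norm T - \<delta> \<le> norm (blinfun_apply T f)" "norm T - \<delta> \<le> norm (blinfun_apply T g)"
    let ?f = "apply_bcontfun f" and ?g = "apply_bcontfun g"
    obtain c where c: "norm c = 1" "\<nu> (\<lambda>t. norm (?f t - c * ?g t) ^ 2) \<le> \<eta> / 6"
      using \<delta>(2)[OF fg(1,2,5,6)] by blast
    have cont: "continuous_on UNIV (\<lambda>t. norm (?f t - c * ?g t) ^ 2)" "continuous_on UNIV (\<lambda>t. norm (?f t - ?g t) ^ 2)"
      by (auto intro!: continuous_intros)
    have "norm (?f t0 - c * ?g t0) ^ 2 \<le> 2 * \<nu> (\<lambda>t. norm (?f t - c * ?g t) ^ 2)"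
      using \<nu>[unfolded control_at_def, THEN conjunct2, THEN conjunct2, rule_format, OF cont(1)] by simp
    then have c1: "norm (1 - c) ^ 2 \<le> \<eta> / 3" using c(2) by (simp add: fg)
    have "norm (?f t - ?g t) ^ 2 \<le> 2 * norm (?f t - c * ?g t) ^ 2 + (2 * norm (1 - c) ^ 2) * 1" for t
    proof -
      have "norm (?f t - ?g t) \<le> norm (?f t - c * ?g t) + norm ((c - 1) * ?g t)"
        using norm_triangle_ineq[of "?f t - c * ?g t" "(c - 1) * ?g t"] by (simp add: algebra_simps)
      also have "norm ((c - 1) * ?g t) \<le> norm (1 - c)"
        using mult_left_mono[OF norm_apply_le_one[OF fg(2), of t], of "norm (1 - c)"]
        by (simp add: norm_mult norm_minus_commute)
      finally have "norm (?f t - ?g t) ^ 2 \<le> (norm (?f t - c * ?g t) + norm (1 - c)) ^ 2"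
        by (intro power_mono) auto
      also have "\<dots> \<le> 2 * norm (?f t - c * ?g t) ^ 2 + 2 * norm (1 - c) ^ 2"
        using zero_le_power2[of "norm (?f t - c * ?g t) - norm (1 - c)"]
        unfolding power2_sum power2_diff by linarith
      finally show ?thesis by simp
    qed
    then have "\<nu> (\<lambda>t. norm (?f t - ?g t) ^ 2) \<le> \<nu> (\<lambda>t. 2 * norm (?f t - c * ?g t) ^ 2 + (2 * norm (1 - c) ^ 2) * 1)"
      by (intro positive_functional_mono[OF pf cont(2)] continuous_intros cont(1))
    also have "\<dots> = \<nu> (\<lambda>t. 2 * norm (?f t - c * ?g t) ^ 2) + \<nu> (\<lambda>t. (2 * norm (1 - c) ^ 2) * 1)"
      by (intro positive_functionalD(1)[OF pf] continuous_intros cont(1))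
    also have "\<dots> = 2 * \<nu> (\<lambda>t. norm (?f t - c * ?g t) ^ 2) + (2 * norm (1 - c) ^ 2) * \<nu> (\<lambda>t. 1)"
      by (simp only: positive_functionalD(2)[OF pf cont(1)] positive_functionalD(2)[OF pf continuous_on_const])
    also have "\<dots> \<le> 2 * (\<eta> / 6) + (2 * (\<eta> / 3)) * 1"
      using c(2) c1 n1 \<eta> positive_functionalD(3)[OF pf continuous_on_const, of 1]
      by (intro add_mono mult_mono mult_left_mono) auto
    also have "\<dots> = \<eta>" by simp
    finally show "\<nu> (\<lambda>t. norm (?f t - ?g t) ^ 2) \<le> \<eta>" .
  qed
qed


section \<open>Attaining the norm at a continuous function\<close>

text \<open>Choose almost maximizers \<open>f n\<close> with value one at \<open>t0\<close>, so fast that \<open>Egorov_localization\<close> applies, and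
  let \<open>P n g = u n g + g(t0) (1 - u n) f n\<close>. These are contractions, \<open>S\<close> is the limit of \<open>T P n\<close>,
  and \<open>S x\<close> is the limit \<open>y\<close> of \<open>T (f n)\<close>, which has norm \<open>\<parallel>T\<parallel>\<close>. If \<open>h n\<close> is maximizing for \<open>S\<close>, then
  \<open>k n = P m (h n)\<close> with \<open>m\<close> large is maximizing for \<open>T\<close> and has nearly the same image; essential
  uniqueness compares \<open>k n\<close> with \<open>f n\<close> up to rotations, which converge along a subsequence.\<close>

theorem attaining_perturbation:
  assumes T: "T \<in> bounded_ops sX sY" and \<nu>: "control_at t0 \<nu>" and dom: "dominated \<nu> T"
    and uniq: "essentially_unique_maximizer \<nu> T" and \<epsilon>: "\<epsilon> > 0"
  obtains S where "S \<in> RSE sX sY" "norm (S - T) \<le> \<epsilon>"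
    "blinfun_apply S ` cball 0 1 \<subseteq> closure (blinfun_apply T ` cball 0 1)"
proof -
  have pf: "positive_functional \<nu>" using \<nu> by (simp add: control_at_def)
  define \<epsilon>' where "\<epsilon>' = 1/2 * \<epsilon>"
  have \<epsilon>': "\<epsilon>' > 0" using \<epsilon> by (simp add: \<epsilon>'_def)
  have T_le: "norm (T f) \<le> norm T" if "norm f \<le> 1" for f
    using norm_blinfun[of T f] mult_left_mono[OF that, of "norm T"] by simp
  have "\<exists>r>0. \<forall>g. norm g \<le> 1 \<longrightarrow> \<nu> (\<lambda>t. norm (apply_bcontfun g t) ^ 2) < r \<longrightarrow>
      norm (T g) \<le> \<epsilon>' * (1/2) ^ Suc n" for n
    using dom[unfolded dominated_def, rule_format, of "\<epsilon>' * (1/2) ^ Suc n"] \<epsilon>' by simp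
  then obtain r where r: "\<And>n. r n > (0::real)" "\<And>n g. norm g \<le> 1 \<Longrightarrow>
      \<nu> (\<lambda>t. norm (apply_bcontfun g t) ^ 2) < r n \<Longrightarrow> norm (T g) \<le> \<epsilon>' * (1/2) ^ Suc n"
    by metis
  define Q where "Q n \<delta> \<longleftrightarrow> (\<forall>f g. norm f \<le> 1 \<longrightarrow> norm g \<le> 1 \<longrightarrow>
     apply_bcontfun f t0 = 1 \<longrightarrow> apply_bcontfun g t0 = 1 \<longrightarrow>
     norm T - \<delta> \<le> norm (T f) \<longrightarrow> norm T - \<delta> \<le> norm (T g) \<longrightarrow>
     \<nu> (\<lambda>t. norm (apply_bcontfun f t - apply_bcontfun g t) ^ 2) \<le> r n / 2 / 4 ^ n)" for n \<delta>
  have "\<exists>\<delta>>0. Q n \<delta>" for n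
    unfolding Q_def by (rule maximizers_with_value_one[OF \<nu> uniq]) (use r(1)[of n] in simp)
  then obtain \<delta> where \<delta>: "\<And>n. \<delta> n > (0::real)" and Q: "\<And>n. Q n (\<delta> n)" by metis
  have close: "\<nu> (\<lambda>t. norm (apply_bcontfun f t - apply_bcontfun g t) ^ 2) \<le> r n / 2 / 4 ^ n"
    if "norm f \<le> 1" "norm g \<le> 1" "apply_bcontfun f t0 = 1" "apply_bcontfun g t0 = 1"
      "norm T - \<delta> n \<le> norm (T f)" "norm T - \<delta> n \<le> norm (T g)" for n f g
    using Q[of n] that unfolding Q_def by blast
  \<comment> \<open>Below all \<open>\<delta> i\<close> with \<open>i \<le> n\<close>, so that \<open>f n\<close> and \<open>f (Suc n)\<close> can both be compared at level \<open>n\<close>.\<close>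
  define d where "d n = min (1 / real (Suc n)) (Min (\<delta> ` {..n}))" for n
  have d: "d n > 0" "d n \<le> 1 / real (Suc n)" for n using \<delta> by (auto simp: d_def)
  have d_le: "d n \<le> \<delta> i" if "i \<le> n" for i n
    unfolding d_def using that by (intro min.coboundedI2 Min_le) auto
  have "\<exists>f. norm f \<le> 1 \<and> apply_bcontfun f t0 = 1 \<and> norm T - d n < norm (T f)" for n
    using almost_norming_with_value_one[OF T d(1)[of n], of t0] by metis
  then obtain f where f: "\<And>n. norm (f n) \<le> 1" "\<And>n. apply_bcontfun (f n) t0 = 1"
    "\<And>n. norm T - d n < norm (T (f n))" by metis
  have fast: "4 ^ n * \<nu> (\<lambda>t. norm (apply_bcontfun (f (Suc n)) t - apply_bcontfun (f n) t) ^ 2) < r n" for n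
  proof -
    have "\<nu> (\<lambda>t. norm (apply_bcontfun (f (Suc n)) t - apply_bcontfun (f n) t) ^ 2) \<le> r n / 2 / 4 ^ n"
      using f(3)[of n] f(3)[of "Suc n"] d_le[of n n] d_le[of n "Suc n"] by (intro close f) auto
    from mult_left_mono[OF this, of "4 ^ n"] show ?thesis using r(1)[of n] by simp
  qed
  have norm_lim: "(\<lambda>n. norm (T (f n))) \<longlonglongrightarrow> norm T"
  proof (rule tendsto_sandwich)
    show "(\<lambda>n. norm T - 1 / real (Suc n)) \<longlonglongrightarrow> norm T"
      using tendsto_diff[OF tendsto_const LIMSEQ_inverse_real_of_nat, of "norm T"] by (simp add: inverse_eq_divide)
    show "\<forall>\<^sub>F n in sequentially. norm (T (f n)) \<le> norm T" using T_le f(1) by simp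
    show "\<forall>\<^sub>F n in sequentially. norm T - 1 / real (Suc n) \<le> norm (T (f n))"
    proof (intro always_eventually allI)
      show "norm T - 1 / real (Suc n) \<le> norm (T (f n))" for n using f(3)[of n] d(2)[of n] by linarith
    qed
  qed simp
  have "Cauchy (\<lambda>n. T (f n))"
  proof (rule metric_CauchyI)
    fix e :: real assume e: "e > 0"
    obtain \<rho> where \<rho>: "\<rho> > 0" and D: "\<And>f g. norm f \<le> 1 \<Longrightarrow> norm g \<le> 1 \<Longrightarrow>
      \<nu> (\<lambda>t. norm (apply_bcontfun f t - apply_bcontfun g t) ^ 2) < \<rho> \<Longrightarrow> norm (T f - T g) \<le> 1/2 * e"
      using dominated_diff[OF dom pf, of "1/2 * e"] e by auto
    obtain \<kappa> where \<kappa>: "\<kappa> > 0" and E: "\<And>f g. norm f \<le> 1 \<Longrightarrow> norm g \<le> 1 \<Longrightarrow>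
     apply_bcontfun f t0 = 1 \<Longrightarrow> apply_bcontfun g t0 = 1 \<Longrightarrow>
     norm T - \<kappa> \<le> norm (T f) \<Longrightarrow> norm T - \<kappa> \<le> norm (T g) \<Longrightarrow>
     \<nu> (\<lambda>t. norm (apply_bcontfun f t - apply_bcontfun g t) ^ 2) \<le> 1/2 * \<rho>"
      using maximizers_with_value_one[OF \<nu> uniq, of "1/2 * \<rho>"] \<rho> by auto
    have "\<forall>\<^sub>F n in sequentially. norm T - \<kappa> < norm (T (f n))"
      using order_tendstoD(1)[OF norm_lim, of "norm T - \<kappa>"] \<kappa> by simp
    then obtain N where N: "\<And>n. n \<ge> N \<Longrightarrow> norm T - \<kappa> < norm (T (f n))" by (auto simp: eventually_sequentially)
    have "dist (T (f m)) (T (f n)) < e" if mn: "m \<ge> N" "n \<ge> N" for m n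
    proof -
      have "\<nu> (\<lambda>t. norm (apply_bcontfun (f m) t - apply_bcontfun (f n) t) ^ 2) \<le> 1/2 * \<rho>"
        using N[OF mn(1)] N[OF mn(2)] by (intro E f) auto
      then have "norm (T (f m) - T (f n)) \<le> 1/2 * e" using \<rho> by (intro D f) auto
      then show ?thesis using e by (simp add: dist_norm)
    qed
    then show "\<exists>M. \<forall>m\<ge>M. \<forall>n\<ge>M. dist (T (f m)) (T (f n)) < e" by blast
  qed
  then have "convergent (\<lambda>n. T (f n))" by (rule Cauchy_convergent)
  then obtain y where y: "(\<lambda>n. T (f n)) \<longlonglongrightarrow> y" unfolding convergent_def ..
  have norm_y: "norm y = norm T" using LIMSEQ_unique[OF tendsto_norm[OF y] norm_lim] .
  obtain u x where u_cont: "\<And>n. continuous_on UNIV (u n)" and u: "\<And>n t. 0 \<le> u n t" "\<And>n t. u n t \<le> (1::real)"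
    and Tu: "\<And>g. Cauchy (\<lambda>n. T (scale_fun (u n) g))"
    and Tu_close: "\<And>n g. norm (T g - T (scale_fun (u n) g)) \<le> \<epsilon>' * norm g"
    and x: "norm x \<le> 1" "apply_bcontfun x t0 = 1" "(\<lambda>n. scale_fun (u n) (x - f n)) \<longlonglongrightarrow> 0"
    by (rule Egorov_localization[OF K pf f(1,2) less_imp_le[OF \<epsilon>'] r(2) fast]) (assumption, assumption, rule that)
  note su = apply_scale_fun[OF K u_cont]
  have v_cont: "continuous_on UNIV (\<lambda>t. 1 - u n t)" for n by (intro continuous_intros u_cont)
  \<comment> \<open>In this form \<open>g - P n g\<close> is \<open>h - u n h\<close> for \<open>h = g - g(t0) f n\<close>, on which \<open>T\<close> is small.\<close>
  define P where "P n g = g - (g - sX (apply_bcontfun g t0) (f n)) +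
    scale_fun (u n) (g - sX (apply_bcontfun g t0) (f n))" for n g
  have P_apply: "apply_bcontfun (P n g) t = u n t *\<^sub>R apply_bcontfun g t +
      (1 - u n t) *\<^sub>R (apply_bcontfun g t0 * apply_bcontfun (f n) t)" for n g t
    by (simp add: P_def su sX_apply algebra_simps)
  have P_norm: "norm (P n g) \<le> norm g" for n g
  proof (rule norm_bound)
    fix t
    have "norm (apply_bcontfun g t0 * apply_bcontfun (f n) t) \<le> norm g * 1"
      unfolding norm_mult using norm_bounded[of g t0] norm_apply_le_one[OF f(1)] by (intro mult_mono) auto
    then have "u n t * norm (apply_bcontfun g t) + (1 - u n t) * norm (apply_bcontfun g t0 * apply_bcontfun (f n) t)
        \<le> u n t * norm g + (1 - u n t) * norm g"
      using u[of n t] norm_bounded[of g t] by (intro add_mono mult_left_mono) auto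
    also have "\<dots> = norm g" by (simp flip: distrib_right)
    finally have "norm (u n t *\<^sub>R apply_bcontfun g t) +
        norm ((1 - u n t) *\<^sub>R (apply_bcontfun g t0 * apply_bcontfun (f n) t)) \<le> norm g"
      using u[of n t] by simp
    then show "norm (apply_bcontfun (P n g) t) \<le> norm g"
      unfolding P_apply by (rule order_trans[OF norm_triangle_ineq])
  qed
  have P_add: "P n (g + h) = P n g + P n h" for n g h
    by (rule bcontfun_eqI) (simp add: P_apply algebra_simps)
  have P_sX: "P n (sX c g) = sX c (P n g)" for n c g
    by (rule bcontfun_eqI) (simp add: P_apply sX_apply algebra_simps)
  have TP: "T (P n g) = T (scale_fun (u n) g) + sY (apply_bcontfun g t0) (T (f n) - T (scale_fun (u n) (f n)))" for n g
  proof -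
    have "P n g = scale_fun (u n) g + sX (apply_bcontfun g t0) (f n - scale_fun (u n) (f n))"
      by (rule bcontfun_eqI) (simp add: P_apply su sX_apply algebra_simps)
    then show ?thesis by (simp add: blinfun.add_right blinfun.diff_right bounded_opsD[OF T])
  qed
  define L where "L g = lim (\<lambda>n. T (scale_fun (u n) g))" for g
  have L: "(\<lambda>n. T (scale_fun (u n) g)) \<longlonglongrightarrow> L g" for g
    using Cauchy_convergent[OF Tu[of g]] by (simp add: L_def convergent_LIMSEQ_iff)
  have Lf: "(\<lambda>n. T (scale_fun (u n) (f n))) \<longlonglongrightarrow> L x"
  proof -
    have "(\<lambda>n. T (scale_fun (u n) (x - f n))) \<longlonglongrightarrow> T 0" by (intro blinfun.tendsto tendsto_const x(3))
    from tendsto_diff[OF L[of x] this] show ?thesis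
      by (simp add: scale_fun_simps(2)[OF K u_cont] blinfun.diff_right blinfun.zero_right)
  qed
  define S' where "S' g = L g + sY (apply_bcontfun g t0) (y - L x)" for g
  have S': "(\<lambda>n. T (P n g)) \<longlonglongrightarrow> S' g" for g
    unfolding TP S'_def by (intro tendsto_add L tendsto_sY tendsto_diff y Lf)
  have S'_sX: "S' (sX c g) = sY c (S' g)" for c g
    using LIMSEQ_unique[OF S'[of "sX c g"]] tendsto_sY[OF S'[of g], of c] by (simp add: P_sX bounded_opsD[OF T])
  have S'_bd: "norm (S' g) \<le> norm T * norm g" for g
  proof (rule tendsto_upperbound[OF tendsto_norm[OF S']], intro always_eventually allI)
    show "norm (T (P n g)) \<le> norm T * norm g" for n
      using norm_blinfun[of T "P n g"] mult_left_mono[OF P_norm[of n g], of "norm T"] by simp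
  qed simp
  have "bounded_linear S'"
  proof (rule bounded_linear_intro[of _ "norm T"])
    show "S' (g + h) = S' g + S' h" for g h
      using LIMSEQ_unique[OF S'[of "g + h"]] tendsto_add[OF S'[of g] S'[of h]] by (simp add: P_add blinfun.add_right)
    show "S' (a *\<^sub>R g) = a *\<^sub>R S' g" for a g
      using S'_sX[of "of_real a" g] sX sY by (simp add: normed_space_over.scale_of_real)
    show "norm (S' g) \<le> norm g * norm T" for g using S'_bd[of g] by (simp add: mult.commute)
  qed
  define S where "S = Blinfun S'"
  have S: "blinfun_apply S = S'"
    unfolding S_def using \<open>bounded_linear S'\<close> by (rule bounded_linear_Blinfun_apply)
  have S_ops: "S \<in> bounded_ops sX sY" by (rule bounded_opsI) (simp add: S S'_sX)
  have Sx: "S x = y"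
    by (simp add: S S'_def x(2) sY_module)
  have norm_x: "norm x = 1"
    using x(1) norm_bounded[of x t0] by (simp add: x(2))
  have norm_S: "norm S = norm T"
  proof (rule antisym)
    show "norm S \<le> norm T" by (rule norm_blinfun_bound) (simp_all add: S S'_bd)
    show "norm T \<le> norm S" using norm_blinfun[of S x] by (simp add: Sx norm_y norm_x)
  qed
  have "norm (S - T) \<le> \<epsilon>"
  proof (rule norm_blinfun_bound)
    fix g
    have "norm (T (P n g) - T g) \<le> \<epsilon> * norm g" for n
    proof -
      define h where "h = g - sX (apply_bcontfun g t0) (f n)"
      have "norm (sX (apply_bcontfun g t0) (f n)) \<le> norm g * 1"
        unfolding norm_sX using norm_bounded[of g t0] f(1)[of n] by (intro mult_mono) auto
      then have "norm h \<le> 2 * norm g"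
        unfolding h_def using norm_triangle_ineq4[of g "sX (apply_bcontfun g t0) (f n)"] by simp
      then have "\<epsilon>' * norm h \<le> \<epsilon>' * (2 * norm g)" using \<epsilon>' by (intro mult_left_mono) auto
      also have "\<dots> = \<epsilon> * norm g" by (simp add: \<epsilon>'_def)
      finally have "\<epsilon>' * norm h \<le> \<epsilon> * norm g" .
      moreover have "T (P n g) - T g = - (T h - T (scale_fun (u n) h))"
        by (simp add: P_def h_def blinfun.add_right blinfun.diff_right)
      ultimately show ?thesis using Tu_close[of h n] by (simp only: norm_minus_cancel)
    qed
    then have "norm (S' g - T g) \<le> \<epsilon> * norm g"
      by (intro tendsto_upperbound[OF tendsto_norm[OF tendsto_diff[OF S' tendsto_const]]]) auto
    then show "norm ((S - T) g) \<le> \<epsilon> * norm g" by (simp add: S blinfun.diff_left)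
  qed (use \<epsilon> in simp)
  moreover have "blinfun_apply S ` cball 0 1 \<subseteq> closure (blinfun_apply T ` cball 0 1)"
  proof (clarsimp simp: S)
    fix g :: "'k \<Rightarrow>\<^sub>C 'f" assume g: "norm g \<le> 1"
    have "T (P n g) \<in> blinfun_apply T ` cball 0 1" for n
      using order_trans[OF P_norm g] by (intro imageI) simp
    then show "S' g \<in> closure (blinfun_apply T ` cball 0 1)"
      unfolding closure_sequential using S'[of g]
      by (intro exI[of _ "\<lambda>n. T (P n g)"]) blast
  qed
  moreover have "S \<in> RSE sX sY"
    unfolding RSE_def
  proof (intro CollectI conjI S_ops exI[of _ x] norm_x allI impI, elim conjE)
    fix h :: "nat \<Rightarrow> 'k \<Rightarrow>\<^sub>C 'f" assume h: "\<forall>n. norm (h n) \<le> 1" "(\<lambda>n. norm (S (h n))) \<longlonglongrightarrow> norm S"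
    have "\<exists>m. norm (T (P m (h n)) - S (h n)) < 1 / real (Suc n)" for n
      using LIMSEQ_D[OF S'[of "h n"], of "1 / real (Suc n)"] by (auto simp: S)
    then obtain m where m: "\<And>n. norm (T (P (m n) (h n)) - S (h n)) < 1 / real (Suc n)" by metis
    define k where "k n = P (m n) (h n)" for n
    have k1: "norm (k n) \<le> 1" for n unfolding k_def using P_norm h(1) order_trans by blast
    have kS: "(\<lambda>n. T (k n) - S (h n)) \<longlonglongrightarrow> 0"
    proof (rule Lim_null_comparison[OF _ LIMSEQ_inverse_real_of_nat])
      show "\<forall>\<^sub>F n in sequentially. norm (T (k n) - S (h n)) \<le> inverse (real (Suc n))"
        using m by (simp add: k_def less_imp_le inverse_eq_divide)
    qed
    have k_lim: "(\<lambda>n. norm (T (k n))) \<longlonglongrightarrow> norm T"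
    proof -
      have "(\<lambda>n. norm (T (k n)) - norm (S (h n))) \<longlonglongrightarrow> 0"
        by (rule Lim_null_comparison[OF _ tendsto_norm_zero[OF kS]]) (simp add: norm_triangle_ineq3)
      from tendsto_add[OF this h(2)] show ?thesis by (simp add: norm_S)
    qed
    obtain c where c: "\<And>n. c n \<in> {c :: 'f. norm c = 1}" "(\<lambda>n. norm (T (f n) - sY (c n) (T (k n)))) \<longlonglongrightarrow> 0"
    proof (rule almost_minimizers_null[of 1 "{c :: 'f. norm c = 1}" "\<lambda>n c. norm (T (f n) - sY c (T (k n)))"])
      fix \<eta> :: real assume \<eta>: "\<eta> > 0"
      obtain \<rho> where \<rho>: "\<rho> > 0" and D: "\<And>f g. norm f \<le> 1 \<Longrightarrow> norm g \<le> 1 \<Longrightarrow>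
        \<nu> (\<lambda>t. norm (apply_bcontfun f t - apply_bcontfun g t) ^ 2) < \<rho> \<Longrightarrow> norm (T f - T g) \<le> \<eta>"
        using dominated_diff[OF dom pf \<eta>] by auto
      obtain \<kappa> where \<kappa>: "\<kappa> > 0" and E: "\<And>f g. norm f \<le> 1 \<Longrightarrow> norm g \<le> 1 \<Longrightarrow>
        norm T - \<kappa> \<le> norm (T f) \<Longrightarrow> norm T - \<kappa> \<le> norm (T g) \<Longrightarrow>
        \<exists>c. norm c = 1 \<and> \<nu> (\<lambda>t. norm (apply_bcontfun f t - c * apply_bcontfun g t) ^ 2) \<le> 1/2 * \<rho>"
        using uniq[unfolded essentially_unique_maximizer_def, rule_format, of "1/2 * \<rho>"] \<rho> by auto
      have "\<forall>\<^sub>F n in sequentially. norm T - \<kappa> < norm (T (f n)) \<and> norm T - \<kappa> < norm (T (k n))"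
        using order_tendstoD(1)[OF norm_lim, of "norm T - \<kappa>"] order_tendstoD(1)[OF k_lim, of "norm T - \<kappa>"] \<kappa>
        by (simp add: eventually_conj)
      then obtain N where N: "\<And>n. n \<ge> N \<Longrightarrow> norm T - \<kappa> < norm (T (f n)) \<and> norm T - \<kappa> < norm (T (k n))"
        by (auto simp: eventually_sequentially)
      have "\<exists>c\<in>{c. norm c = 1}. norm (T (f n) - sY c (T (k n))) \<le> \<eta>" if n: "n \<ge> N" for n
      proof -
        obtain c where c: "norm c = 1" "\<nu> (\<lambda>t. norm (apply_bcontfun (f n) t - c * apply_bcontfun (k n) t) ^ 2) \<le> 1/2 * \<rho>"
          using E[OF f(1) k1] N[OF n] by (meson less_imp_le)
        have "norm (T (f n) - T (sX c (k n))) \<le> \<eta>"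
          using c \<rho> k1[of n] by (intro D f(1)) (auto simp: norm_sX sX_apply)
        then show ?thesis using c(1) by (auto simp: bounded_opsD[OF T])
      qed
      then show "\<exists>N. \<forall>n\<ge>N. \<exists>c\<in>{c. norm c = 1}. norm (T (f n) - sY c (T (k n))) \<le> \<eta>" by blast
    qed (simp_all, blast)
    define \<theta> where "\<theta> n = inverse (c n)" for n
    have \<theta>: "norm (\<theta> n) = 1" and c0: "c n \<noteq> 0" for n
      using c(1)[of n] by (auto simp: \<theta>_def norm_inverse)
    have k_y: "(\<lambda>n. T (k n) - sY (\<theta> n) y) \<longlonglongrightarrow> 0"
    proof (rule Lim_null_comparison)
      show "(\<lambda>n. norm (T (f n) - sY (c n) (T (k n))) + norm (T (f n) - y)) \<longlonglongrightarrow> 0"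
        using tendsto_add[OF c(2) tendsto_norm_zero[OF LIM_zero[OF y]]] by simp
      show "\<forall>\<^sub>F n in sequentially. norm (T (k n) - sY (\<theta> n) y) \<le>
          norm (T (f n) - sY (c n) (T (k n))) + norm (T (f n) - y)"
      proof (intro always_eventually allI)
        fix n
        have "T (k n) - sY (\<theta> n) y = sY (\<theta> n) ((T (f n) - y) - (T (f n) - sY (c n) (T (k n))))"
          using c0[of n] by (simp add: sY_module \<theta>_def)
        then have "norm (T (k n) - sY (\<theta> n) y) = norm ((T (f n) - y) - (T (f n) - sY (c n) (T (k n))))"
          by (simp only: norm_sY \<theta>)
        also have "\<dots> \<le> norm (T (f n) - y) + norm (T (f n) - sY (c n) (T (k n)))" by (rule norm_triangle_ineq4)
        finally show "norm (T (k n) - sY (\<theta> n) y) \<le>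
          norm (T (f n) - sY (c n) (T (k n))) + norm (T (f n) - y)" by simp
      qed
    qed
    have "compact (sphere (0::'f) 1)" by simp
    moreover have "\<forall>n. \<theta> n \<in> sphere 0 1" using \<theta> by simp
    ultimately obtain \<sigma> \<theta>' where \<sigma>: "\<theta>' \<in> sphere 0 1" "strict_mono \<sigma>" "(\<theta> \<circ> \<sigma>) \<longlonglongrightarrow> \<theta>'"
      unfolding compact_def by blast
    have 1: "(\<lambda>n. T (k (\<sigma> n)) - S (h (\<sigma> n))) \<longlonglongrightarrow> 0" "(\<lambda>n. T (k (\<sigma> n)) - sY (\<theta> (\<sigma> n)) y) \<longlonglongrightarrow> 0"
      using LIMSEQ_subseq_LIMSEQ[OF kS \<sigma>(2)] LIMSEQ_subseq_LIMSEQ[OF k_y \<sigma>(2)] by (simp_all add: o_def)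
    have 2: "(\<lambda>n. sY (\<theta> (\<sigma> n)) y) \<longlonglongrightarrow> sY \<theta>' y"
    proof (rule LIM_zero_cancel)
      have "(\<lambda>n. \<theta> (\<sigma> n) - \<theta>') \<longlonglongrightarrow> 0" using LIM_zero[OF \<sigma>(3)] by (simp add: o_def)
      from tendsto_mult_right[OF tendsto_norm_zero[OF this], of "norm y"]
      have "(\<lambda>n. norm (sY (\<theta> (\<sigma> n)) y - sY \<theta>' y)) \<longlonglongrightarrow> 0"
        by (simp add: sY_module(6)[symmetric] norm_sY)
      then show "(\<lambda>n. sY (\<theta> (\<sigma> n)) y - sY \<theta>' y) \<longlonglongrightarrow> 0" by (rule tendsto_norm_zero_cancel)
    qed
    have "(\<lambda>n. S (h (\<sigma> n))) \<longlonglongrightarrow> sY \<theta>' (S x)"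
      using tendsto_add[OF tendsto_diff[OF 1(2) 1(1)] 2] by (simp add: Sx)
    then show "\<exists>\<sigma> \<theta>. strict_mono \<sigma> \<and> norm \<theta> = 1 \<and> (\<lambda>n. S (h (\<sigma> n))) \<longlonglongrightarrow> sY \<theta> (S x)"
      using \<sigma> by auto
  qed
  ultimately show thesis using that by blast
qed

text \<open>First make the maximizer essentially unique, then make it attained. The control functional of \<open>T\<close>
  serves for both steps, since it also dominates the rank one perturbation.\<close>

theorem weakly_compact_RSE_dense:
  assumes nz: "\<exists>y :: 'y. y \<noteq> 0"
  shows "(weakly_compact_ops sX sY :: (('k \<Rightarrow>\<^sub>C 'f) \<Rightarrow>\<^sub>L 'y) set) \<subseteq> closure (weakly_compact_ops sX sY \<inter> RSE sX sY)"
proof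
  fix T assume T: "T \<in> (weakly_compact_ops sX sY :: (('k \<Rightarrow>\<^sub>C 'f) \<Rightarrow>\<^sub>L 'y) set)"
  then have T_ops: "T \<in> bounded_ops sX sY" by (simp add: weakly_compact_ops_def)
  fix t0 :: 'k
  obtain \<nu> where \<nu>: "control_at t0 \<nu>" "dominated \<nu> T"
    using exhaustive_imp_dominated[OF weakly_compact_imp_exhaustive[OF sY T]] by metis
  show "T \<in> closure (weakly_compact_ops sX sY \<inter> RSE sX sY)"
    unfolding closure_approachable
  proof (intro allI impI)
    fix \<epsilon> :: real assume "\<epsilon> > 0"
    then have \<epsilon>: "\<epsilon> / 3 > 0" by simp
    obtain T1 \<psi> e where T1: "T1 \<in> bounded_ops sX sY" "\<And>f. blinfun_apply T1 f = blinfun_apply T f + sY (\<psi> f) e"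
      "\<And>f. norm (\<psi> f) \<le> \<epsilon> / 3 * norm f" "norm e = 1" "dominated \<nu> T1" "essentially_unique_maximizer \<nu> T1"
      by (rule rank_one_perturbation[OF T_ops \<nu> \<epsilon> nz]) (rule that)
    obtain S where S: "S \<in> RSE sX sY" "norm (S - T1) \<le> \<epsilon> / 3"
      "blinfun_apply S ` cball 0 1 \<subseteq> closure (blinfun_apply T1 ` cball 0 1)"
      by (rule attaining_perturbation[OF T1(1) \<nu>(1) T1(5,6) \<epsilon>]) (rule that)
    have "S \<in> bounded_ops sX sY" using S(1) by (simp add: RSE_def)
    then have "S \<in> weakly_compact_ops sX sY"
      using T1(2,3) S(3) by (rule weakly_compact_near_rank_one[OF sY T])
    moreover have "norm (T1 - T) \<le> \<epsilon> / 3"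
      by (rule norm_blinfun_bound) (use \<epsilon> T1(2-4) in \<open>auto simp: blinfun.diff_left norm_sY\<close>)
    then have "dist S T < \<epsilon>"
      using S(2) \<epsilon> norm_triangle_ineq[of "S - T1" "T1 - T"] by (simp add: dist_norm)
    ultimately show "\<exists>S\<in>weakly_compact_ops sX sY \<inter> RSE sX sY. dist S T < \<epsilon>" using S(1) by blast
  qed
qed

end

interpretation real_scalars: scalar_field "\<lambda>x :: real. x"
  by unfold_locales (auto simp: linear_iff)

interpretation complex_scalars: scalar_field cnj
  by unfold_locales (auto simp: linear_iff inner_complex_def algebra_simps)

theorem theorem3p15:
  assumes "compact (UNIV :: 'k::t2_space set)"
    and "\<exists>y :: 'y::banach. y \<noteq> 0"
  shows
    "(weakly_compact_ops (*\<^sub>R) (*\<^sub>R) :: (('k \<Rightarrow>\<^sub>C real) \<Rightarrow>\<^sub>L 'y) set)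
       \<subseteq> closure (weakly_compact_ops (*\<^sub>R) (*\<^sub>R) \<inter> RSE (*\<^sub>R) (*\<^sub>R))
     \<and>
     (\<forall>scaleC :: complex \<Rightarrow> 'y \<Rightarrow> 'y. normed_space_over scaleC \<longrightarrow>
       (weakly_compact_ops scaleC_bcontfun scaleC :: (('k \<Rightarrow>\<^sub>C complex) \<Rightarrow>\<^sub>L 'y) set)
         \<subseteq> closure (weakly_compact_ops scaleC_bcontfun scaleC \<inter> RSE scaleC_bcontfun scaleC))"
proof (intro conjI allI impI)
  have "C_K (\<lambda>x :: real. x) ((*\<^sub>R) :: real \<Rightarrow> ('k \<Rightarrow>\<^sub>C real) \<Rightarrow> _) ((*\<^sub>R) :: real \<Rightarrow> 'y \<Rightarrow> 'y)"
    by unfold_locales (use assms(1) in \<open>auto simp: algebra_simps\<close>)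
  then show "(weakly_compact_ops (*\<^sub>R) (*\<^sub>R) :: (('k \<Rightarrow>\<^sub>C real) \<Rightarrow>\<^sub>L 'y) set)
       \<subseteq> closure (weakly_compact_ops (*\<^sub>R) (*\<^sub>R) \<inter> RSE (*\<^sub>R) (*\<^sub>R))"
    using assms(2) by (rule C_K.weakly_compact_RSE_dense)
next
  fix scaleC :: "complex \<Rightarrow> 'y \<Rightarrow> 'y" assume "normed_space_over scaleC"
  then have "C_K cnj (scaleC_bcontfun :: complex \<Rightarrow> ('k \<Rightarrow>\<^sub>C complex) \<Rightarrow> _) scaleC"
    using assms(1) normed_space_over_scaleC_bcontfun
    by (intro C_K.intro complex_scalars.scalar_field_axioms C_K_axioms.intro) auto
  then show "(weakly_compact_ops scaleC_bcontfun scaleC :: (('k \<Rightarrow>\<^sub>C complex) \<Rightarrow>\<^sub>L 'y) set)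
         \<subseteq> closure (weakly_compact_ops scaleC_bcontfun scaleC \<inter> RSE scaleC_bcontfun scaleC)"
    using assms(2) by (rule C_K.weakly_compact_RSE_dense)
qed

end
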